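(* Let ${\mathcal C}$ be a subcategory of $\mathbf{Unif}$. Then the following are equivalent: 1) ${\mathcal C}$ is closed under products and closed subspaces, and is varietal. 2) Either $\mathrm{Ob}\,{\mathcal C}=\{X\in \mathrm{Ob}\,\mathbf{Unif}\mid |X|\le 1\}$, or $\mathrm{Ob}\,{\mathcal C}=\{X\in \mathrm{Ob}\,\mathbf{Unif}\mid X\text{ is indiscrete}\}$, or $\mathrm{Ob}\,{\mathcal C}=\{X\in \mathrm{Ob}\,\mathbf{Unif}\mid X\text{ is compact }T_2\}$. Moreover, none of the three properties in 1) (closedness under products, closedness under closed subspaces, being varietal) can be omitted without invalidating the implication $1)\Rightarrow 2)$ (that is, for each of the three properties there is a subcategory of $\mathbf{Unif}$ having the other two properties but not of the form in 2)).
   Context: $\mathbf{Unif}$ is the category of all uniform spaces (no separation axiom) and uniformly continuous maps. Subcategories are always full and isomorphism closed, and are identified with the classes of their objects; they are regarded as concrete categories over $\mathbf{Set}$ via the underlying set functor $U$. Products (including the empty product) and closed subspaces are taken in $\mathbf{Unif}$. A concrete category $\langle{\mathcal C}, U:{\mathcal C}\to\mathbf{Set}\rangle$ is called algebraic if ${\mathcal C}$ has coequalizers, $U$ has a left adjoint, and $U$ preserves and reflects regular epimorphisms. An algebraic category is called varietal if additionally $U$ reflects congruence relations (a congruence relation being a pair of morphisms that is the kernel pair of some morphism). For concrete categories over $\mathbf{Set}$, varietal is the same as monadic (tripleable). *)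

theory Defs
  imports "HOL-Analysis.Analysis" "HOL-Library.FuncSet" "HOL-Library.Equipollence"
begin

section \<open>The universe of small sets\<close>

text \<open>
  HOL has no type of all sets, so \<open>Set\<close> and \<open>Unif\<close> are taken relative to a universe, which
  is given by a type \<open>'u\<close>: the small sets are the subsets of \<open>'u\<close> of cardinality less than that of
  \<open>'u\<close>. If \<open>'u\<close> has (uncountable) strongly inaccessible cardinality \<open>\<kappa>\<close>, every set in the
  Grothendieck universe \<open>V\<^sub>\<kappa>\<close> is in bijection with a small subset of \<open>'u\<close>. A class is an
  arbitrary set of structures on small subsets of \<open>'u\<close>; since only isomorphism-closed classes
  of structures occur, using subsets of \<open>'u\<close> as carriers loses no generality.
\<close>

definition small :: "'u set \<Rightarrow> bool" where
  "small A \<longleftrightarrow> A \<prec> (UNIV :: 'u set)"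

text \<open>
  The three conjuncts say that the cardinality of \<open>'u\<close> is uncountable, a strong limit, and regular.
\<close>

definition inaccessible_type :: "'u itself \<Rightarrow> bool" where
  "inaccessible_type _ \<longleftrightarrow>
     (\<exists>A :: 'u set. infinite A \<and> small A) \<and>
     (\<forall>A :: 'u set. small A \<longrightarrow> Pow A \<prec> (UNIV :: 'u set)) \<and>
     (\<forall>(I :: 'u set) (A :: 'u \<Rightarrow> 'u set).
        small I \<and> (\<forall>i\<in>I. small (A i)) \<longrightarrow> small (\<Union>i\<in>I. A i))"


section \<open>Concrete categories over the category of small sets\<close>

text \<open>
  A morphism from \<open>X\<close> to \<open>Y\<close> is identified with its underlying function, an element of
  \<open>Und X \<rightarrow>\<^sub>E Und Y\<close>. Hence the composite of \<open>f\<close> from \<open>X\<close> with a morphism \<open>g\<close> is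
  \<open>compose (Und X) g f\<close>, the identity of \<open>X\<close> is \<open>\<lambda>x\<in>Und X. x\<close>, and the underlying functor
  \<open>U\<close> is \<open>Und\<close> on objects and sends every morphism to itself.
\<close>

record ('o, 'u) concrete_category =
  Ob :: "'o set"
  Und :: "'o \<Rightarrow> 'u set"
  Mor :: "'o \<Rightarrow> 'o \<Rightarrow> ('u \<Rightarrow> 'u) set"

definition Set_cat :: "('u set, 'u) concrete_category" where
  "Set_cat = \<lparr>Ob = {A. small A}, Und = (\<lambda>A. A), Mor = (\<lambda>A B. A \<rightarrow>\<^sub>E B)\<rparr>"

definition isomorphic :: "('o, 'u) concrete_category \<Rightarrow> 'o \<Rightarrow> 'o \<Rightarrow> bool" where
  "isomorphic K X Y \<longleftrightarrow>
     (\<exists>f\<in>Mor K X Y. \<exists>g\<in>Mor K Y X.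
        compose (Und K X) g f = (\<lambda>x\<in>Und K X. x) \<and>
        compose (Und K Y) f g = (\<lambda>y\<in>Und K Y. y))"

definition is_product ::
  "('o, 'u) concrete_category \<Rightarrow> 'i set \<Rightarrow> ('i \<Rightarrow> 'o) \<Rightarrow> 'o \<Rightarrow> ('i \<Rightarrow> 'u \<Rightarrow> 'u) \<Rightarrow> bool" where
  "is_product K I X P p \<longleftrightarrow>
     P \<in> Ob K \<and> (\<forall>i\<in>I. X i \<in> Ob K \<and> p i \<in> Mor K P (X i)) \<and>
     (\<forall>Z\<in>Ob K. \<forall>q. (\<forall>i\<in>I. q i \<in> Mor K Z (X i)) \<longrightarrow>
        (\<exists>!h. h \<in> Mor K Z P \<and> (\<forall>i\<in>I. compose (Und K Z) (p i) h = q i)))"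

definition is_coequalizer ::
  "('o, 'u) concrete_category \<Rightarrow> 'o \<Rightarrow> 'o \<Rightarrow> ('u \<Rightarrow> 'u) \<Rightarrow> ('u \<Rightarrow> 'u) \<Rightarrow> 'o \<Rightarrow> ('u \<Rightarrow> 'u) \<Rightarrow> bool" where
  "is_coequalizer K X Y f g Q h \<longleftrightarrow>
     Q \<in> Ob K \<and> h \<in> Mor K Y Q \<and> compose (Und K X) h f = compose (Und K X) h g \<and>
     (\<forall>W\<in>Ob K. \<forall>k\<in>Mor K Y W. compose (Und K X) k f = compose (Und K X) k g \<longrightarrow>
        (\<exists>!m. m \<in> Mor K Q W \<and> compose (Und K Y) m h = k))"

definition has_coequalizers :: "('o, 'u) concrete_category \<Rightarrow> bool" where
  "has_coequalizers K \<longleftrightarrow>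
     (\<forall>X\<in>Ob K. \<forall>Y\<in>Ob K. \<forall>f\<in>Mor K X Y. \<forall>g\<in>Mor K X Y. \<exists>Q h. is_coequalizer K X Y f g Q h)"

definition regular_epi :: "('o, 'u) concrete_category \<Rightarrow> 'o \<Rightarrow> 'o \<Rightarrow> ('u \<Rightarrow> 'u) \<Rightarrow> bool" where
  "regular_epi K Y Q h \<longleftrightarrow>
     (\<exists>X\<in>Ob K. \<exists>f\<in>Mor K X Y. \<exists>g\<in>Mor K X Y. is_coequalizer K X Y f g Q h)"

definition is_kernel_pair ::
  "('o, 'u) concrete_category \<Rightarrow> 'o \<Rightarrow> 'o \<Rightarrow> 'o \<Rightarrow> ('u \<Rightarrow> 'u) \<Rightarrow> ('u \<Rightarrow> 'u) \<Rightarrow> ('u \<Rightarrow> 'u) \<Rightarrow> bool" where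
  "is_kernel_pair K R X Y h p q \<longleftrightarrow>
     R \<in> Ob K \<and> p \<in> Mor K R X \<and> q \<in> Mor K R X \<and>
     compose (Und K R) h p = compose (Und K R) h q \<and>
     (\<forall>Z\<in>Ob K. \<forall>a\<in>Mor K Z X. \<forall>b\<in>Mor K Z X.
        compose (Und K Z) h a = compose (Und K Z) h b \<longrightarrow>
        (\<exists>!m. m \<in> Mor K Z R \<and> compose (Und K Z) p m = a \<and> compose (Und K Z) q m = b))"

definition congruence_relation ::
  "('o, 'u) concrete_category \<Rightarrow> 'o \<Rightarrow> 'o \<Rightarrow> ('u \<Rightarrow> 'u) \<Rightarrow> ('u \<Rightarrow> 'u) \<Rightarrow> bool" where
  "congruence_relation K R X p q \<longleftrightarrow>
     (\<exists>Y\<in>Ob K. \<exists>h\<in>Mor K X Y. is_kernel_pair K R X Y h p q)"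

definition is_functor ::
  "('o, 'u) concrete_category \<Rightarrow> ('p, 'u) concrete_category \<Rightarrow>
   ('o \<Rightarrow> 'p) \<Rightarrow> ('o \<Rightarrow> 'o \<Rightarrow> ('u \<Rightarrow> 'u) \<Rightarrow> ('u \<Rightarrow> 'u)) \<Rightarrow> bool" where
  "is_functor J K F0 F1 \<longleftrightarrow>
     (\<forall>X\<in>Ob J. F0 X \<in> Ob K) \<and>
     (\<forall>X\<in>Ob J. \<forall>Y\<in>Ob J. \<forall>f\<in>Mor J X Y. F1 X Y f \<in> Mor K (F0 X) (F0 Y)) \<and>
     (\<forall>X\<in>Ob J. F1 X X (\<lambda>x\<in>Und J X. x) = (\<lambda>x\<in>Und K (F0 X). x)) \<and>
     (\<forall>X\<in>Ob J. \<forall>Y\<in>Ob J. \<forall>Z\<in>Ob J. \<forall>f\<in>Mor J X Y. \<forall>g\<in>Mor J Y Z.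
        F1 X Z (compose (Und J X) g f) = compose (Und K (F0 X)) (F1 Y Z g) (F1 X Y f))"

text \<open>
  The map \<open>\<phi> S X\<close> is the adjunction bijection from the morphisms \<open>L0 S \<rightarrow> X\<close> to the functions
  \<open>S \<rightarrow> U X\<close>; the last two conjuncts are its naturality in \<open>S\<close> and in \<open>X\<close>.
\<close>

definition underlying_has_left_adjoint :: "('o, 'u) concrete_category \<Rightarrow> bool" where
  "underlying_has_left_adjoint K \<longleftrightarrow>
     (\<exists>L0 L1 \<phi>. is_functor Set_cat K L0 L1 \<and>
        (\<forall>S\<in>Ob Set_cat. \<forall>X\<in>Ob K.
           bij_betw (\<phi> S X) (Mor K (L0 S) X) (Mor Set_cat S (Und K X))) \<and>
        (\<forall>S\<in>Ob Set_cat. \<forall>T\<in>Ob Set_cat. \<forall>X\<in>Ob K. \<forall>s\<in>Mor Set_cat S T. \<forall>m\<in>Mor K (L0 T) X.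
           \<phi> S X (compose (Und K (L0 S)) m (L1 S T s)) = compose S (\<phi> T X m) s) \<and>
        (\<forall>S\<in>Ob Set_cat. \<forall>X\<in>Ob K. \<forall>Y\<in>Ob K. \<forall>f\<in>Mor K X Y. \<forall>m\<in>Mor K (L0 S) X.
           \<phi> S Y (compose (Und K (L0 S)) f m) = compose S f (\<phi> S X m)))"

definition preserves_regular_epis :: "('o, 'u) concrete_category \<Rightarrow> bool" where
  "preserves_regular_epis K \<longleftrightarrow>
     (\<forall>X\<in>Ob K. \<forall>Y\<in>Ob K. \<forall>f\<in>Mor K X Y.
        regular_epi K X Y f \<longrightarrow> regular_epi Set_cat (Und K X) (Und K Y) f)"

definition reflects_regular_epis :: "('o, 'u) concrete_category \<Rightarrow> bool" where
  "reflects_regular_epis K \<longleftrightarrow>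
     (\<forall>X\<in>Ob K. \<forall>Y\<in>Ob K. \<forall>f\<in>Mor K X Y.
        regular_epi Set_cat (Und K X) (Und K Y) f \<longrightarrow> regular_epi K X Y f)"

definition reflects_congruence_relations :: "('o, 'u) concrete_category \<Rightarrow> bool" where
  "reflects_congruence_relations K \<longleftrightarrow>
     (\<forall>R\<in>Ob K. \<forall>X\<in>Ob K. \<forall>p\<in>Mor K R X. \<forall>q\<in>Mor K R X.
        congruence_relation Set_cat (Und K R) (Und K X) p q \<longrightarrow> congruence_relation K R X p q)"

definition algebraic :: "('o, 'u) concrete_category \<Rightarrow> bool" where
  "algebraic K \<longleftrightarrow>
     has_coequalizers K \<and> underlying_has_left_adjoint K \<and>
     preserves_regular_epis K \<and> reflects_regular_epis K"

definition varietal :: "('o, 'u) concrete_category \<Rightarrow> bool" where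
  "varietal K \<longleftrightarrow> algebraic K \<and> reflects_congruence_relations K"


section \<open>Uniform spaces\<close>

text \<open>
  The library's type class \<open>uniform_space\<close> needs a whole type as carrier; this is its version for
  a carrier set, with the uniformity a filter on \<open>points X \<times> points X\<close>. On the empty carrier the
  only uniformity is \<open>bot\<close>.
\<close>

record 'u uspace =
  points :: "'u set"
  unif :: "('u \<times> 'u) filter"

definition is_uspace :: "'u uspace \<Rightarrow> bool" where
  "is_uspace X \<longleftrightarrow>
     unif X \<le> principal (points X \<times> points X) \<and>
     (\<forall>E. eventually E (unif X) \<longrightarrow> (\<forall>x\<in>points X. E (x, x))) \<and>
     (\<forall>E. eventually E (unif X) \<longrightarrow> eventually (\<lambda>(x, y). E (y, x)) (unif X)) \<and>
     (\<forall>E. eventually E (unif X) \<longrightarrow>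
        (\<exists>D. eventually D (unif X) \<and> (\<forall>x y z. D (x, y) \<longrightarrow> D (y, z) \<longrightarrow> E (x, z))))"

lemma is_uspace_uniformity:
  "is_uspace \<lparr>points = UNIV, unif = (uniformity :: ('a::uniform_space \<times> 'a) filter)\<rparr>"
  unfolding is_uspace_def
  using uniformity_trans by (auto simp: uniformity_refl uniformity_sym)

definition ucont_maps :: "'u uspace \<Rightarrow> 'u uspace \<Rightarrow> ('u \<Rightarrow> 'u) set" where
  "ucont_maps X Y =
     {f \<in> points X \<rightarrow>\<^sub>E points Y. filterlim (map_prod f f) (unif Y) (unif X)}"

definition utopology :: "'u uspace \<Rightarrow> 'u topology" where
  "utopology X = topology (\<lambda>S. S \<subseteq> points X \<and>
     (\<forall>x\<in>S. eventually (\<lambda>(x', y). x' = x \<longrightarrow> y \<in> S) (unif X)))"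

lemma openin_utopology:
  "openin (utopology X) S \<longleftrightarrow>
     S \<subseteq> points X \<and> (\<forall>x\<in>S. eventually (\<lambda>(x', y). x' = x \<longrightarrow> y \<in> S) (unif X))"
proof -
  have "istopology (\<lambda>S. S \<subseteq> points X \<and>
     (\<forall>x\<in>S. eventually (\<lambda>(x', y). x' = x \<longrightarrow> y \<in> S) (unif X)))"
    unfolding istopology_def
  proof (intro conjI allI impI ballI)
    fix S T x
    assume "S \<subseteq> points X \<and> (\<forall>x\<in>S. \<forall>\<^sub>F (x', y) in unif X. x' = x \<longrightarrow> y \<in> S)"
      and "T \<subseteq> points X \<and> (\<forall>x\<in>T. \<forall>\<^sub>F (x', y) in unif X. x' = x \<longrightarrow> y \<in> T)"
      and "x \<in> S \<inter> T"
    then have "\<forall>\<^sub>F (x', y) in unif X. x' = x \<longrightarrow> y \<in> S" "\<forall>\<^sub>F (x', y) in unif X. x' = x \<longrightarrow> y \<in> T"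
      by auto
    then show "\<forall>\<^sub>F (x', y) in unif X. x' = x \<longrightarrow> y \<in> S \<inter> T"
      by eventually_elim auto
  next
    fix \<K> x
    assume *: "\<forall>S\<in>\<K>. S \<subseteq> points X \<and> (\<forall>x\<in>S. \<forall>\<^sub>F (x', y) in unif X. x' = x \<longrightarrow> y \<in> S)"
      and "x \<in> \<Union>\<K>"
    then obtain S where "S \<in> \<K>" "x \<in> S" by auto
    then have "\<forall>\<^sub>F (x', y) in unif X. x' = x \<longrightarrow> y \<in> S" using * by auto
    then show "\<forall>\<^sub>F (x', y) in unif X. x' = x \<longrightarrow> y \<in> \<Union>\<K>"
      by eventually_elim (use \<open>S \<in> \<K>\<close> in auto)
  qed auto
  then show ?thesis
    by (simp add: utopology_def topology_inverse')
qed

lemma topspace_utopology: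
  assumes "is_uspace X"
  shows "topspace (utopology X) = points X"
proof -
  have "\<forall>\<^sub>F p in unif X. p \<in> points X \<times> points X"
    using assms unfolding is_uspace_def le_principal by blast
  then have "\<forall>x\<in>points X. \<forall>\<^sub>F (x', y) in unif X. x' = x \<longrightarrow> y \<in> points X"
    by (auto elim: eventually_mono)
  then have "openin (utopology X) (points X)"
    by (simp add: openin_utopology)
  moreover have "topspace (utopology X) \<subseteq> points X"
    using openin_utopology[of X "topspace (utopology X)"] by simp
  ultimately show ?thesis
    using openin_subset by fastforce
qed

definition usubspace :: "'u uspace \<Rightarrow> 'u set \<Rightarrow> 'u uspace" where
  "usubspace X S = \<lparr>points = S, unif = inf (unif X) (principal (S \<times> S))\<rparr>"

definition indiscrete :: "'u uspace \<Rightarrow> bool" where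
  "indiscrete X \<longleftrightarrow> unif X = principal (points X \<times> points X)"

definition compact_T2 :: "'u uspace \<Rightarrow> bool" where
  "compact_T2 X \<longleftrightarrow> compact_space (utopology X) \<and> Hausdorff_space (utopology X)"


section \<open>Subcategories of the category of uniform spaces\<close>

definition Ob_Unif :: "'u uspace set" where
  "Ob_Unif = {X. is_uspace X \<and> small (points X)}"

text \<open>The full subcategory of \<open>Unif\<close> with class of objects \<open>C\<close>.\<close>

definition full_subcat :: "'u uspace set \<Rightarrow> ('u uspace, 'u) concrete_category" where
  "full_subcat C = \<lparr>Ob = C, Und = points, Mor = ucont_maps\<rparr>"

definition Unif :: "('u uspace, 'u) concrete_category" where
  "Unif = full_subcat Ob_Unif"

definition subcategory_of_Unif :: "'u uspace set \<Rightarrow> bool" where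
  "subcategory_of_Unif C \<longleftrightarrow>
     C \<subseteq> Ob_Unif \<and> (\<forall>X\<in>C. \<forall>Y\<in>Ob_Unif. isomorphic Unif X Y \<longrightarrow> Y \<in> C)"

text \<open>The case \<open>I = {}\<close> is included.\<close>

definition closed_under_products :: "'u uspace set \<Rightarrow> bool" where
  "closed_under_products C \<longleftrightarrow>
     (\<forall>(I :: 'u set) X P p. small I \<and> (\<forall>i\<in>I. X i \<in> C) \<and> is_product Unif I X P p \<longrightarrow> P \<in> C)"

definition closed_under_closed_subspaces :: "'u uspace set \<Rightarrow> bool" where
  "closed_under_closed_subspaces C \<longleftrightarrow>
     (\<forall>X\<in>C. \<forall>S. closedin (utopology X) S \<longrightarrow> usubspace X S \<in> C)"

definition trivial_or_indiscrete_or_compact_T2 :: "'u uspace set \<Rightarrow> bool" where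
  "trivial_or_indiscrete_or_compact_T2 C \<longleftrightarrow>
     C = {X \<in> Ob_Unif. finite (points X) \<and> card (points X) \<le> 1} \<or>
     C = {X \<in> Ob_Unif. indiscrete X} \<or>
     C = {X \<in> Ob_Unif. compact_T2 X}"

end

theory Submission
  imports Defs
begin

text \<open>
  Let \<open>C\<close> be varietal and closed under products and closed subspaces, with some object having two points.
  If some object is not Hausdorff, the closure of a point is an indiscrete object with two points; splitting
  idempotents of its powers by coequalizers yields indiscrete objects of every size, and since bijective
  morphisms are isomorphisms, all objects are indiscrete. Otherwise \<open>C\<close> contains the discrete two-point
  space \<open>D\<close>. Reflection of congruence relations forces quotients of objects by suitable equivalence relations
  to be Hausdorff, and this makes all morphisms closed maps. Closedness of the projections \<open>X \<times> D\<^sup>I \<rightarrow> D\<^sup>I\<close>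
  makes every object \<open>X\<close> compact. Conversely, a compact Hausdorff space \<open>X\<close> is a quotient of the Stone--Cech
  compactification of its underlying set, a closed subspace of a power of \<open>D\<close>, by a closed equivalence
  relation, so it belongs to \<open>C\<close>.

  That the conditions are independent is witnessed by the discrete spaces (not closed under products), the
  one-point spaces (not closed under the closed subspace \<open>{}\<close>), and all of \<open>Unif\<close> (not varietal).
\<close>

section \<open>Small sets\<close>

text \<open>Nothing topological is known about quotients in \<open>C\<close>: the target of a
  reflected congruence is merely some object receiving a map with a prescribed kernel. In the
  Hausdorff case what can be exploited is that equalizers into such an object are closed. Reflection
  asks only that an equivalence relation be the image of a jointly injective pair from some object;
  that object need not carry the subspace uniformity of the relation. Hence for an injective
  morphism \<open>m\<close>, a relation built from the image of \<open>m\<close> can be parametrized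
  by the domain of \<open>m\<close> although the image is not yet known to be closed; closedness of
  the image is the outcome. General morphisms follow by factoring through the coequalizer of the
  kernel pair. Compactness is tested against powers of \<open>D\<close> because these are at hand in
  \<open>C\<close>, and the members of a family of closed sets can serve as coordinates. For the
  converse, one list of exactness properties, satisfied also by \<open>Set\<close>, describes
  regular epimorphisms and congruence relations by underlying functions alone.\<close>

locale inaccessible_universe =
  fixes U :: "'u itself"
  assumes inaccessible: "inaccessible_type U"
begin

lemma small_lepoll:
  fixes A :: "'a set" and B :: "'b set"
  assumes "A \<lesssim> B" "B \<prec> (UNIV :: 'u set)"
  shows "A \<prec> (UNIV :: 'u set)"
  using assms lesspoll_trans1 by blast

lemma small_subset: "small (B :: 'u set) \<Longrightarrow> A \<subseteq> B \<Longrightarrow> small A"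
  unfolding small_def by (rule small_lepoll[OF subset_imp_lepoll])

lemma small_image:
  fixes A :: "'a set" and f :: "'a \<Rightarrow> 'u"
  shows "A \<prec> (UNIV :: 'u set) \<Longrightarrow> small (f ` A)"
  unfolding small_def by (rule small_lepoll[OF image_lepoll])

lemma infinite_universe: "infinite (UNIV :: 'u set)"
proof -
  obtain A :: "'u set" where "infinite A"
    using inaccessible unfolding inaccessible_type_def by blast
  then show ?thesis using finite_subset[OF subset_UNIV] by blast
qed

lemma small_finite: "finite (A :: 'a set) \<Longrightarrow> A \<prec> (UNIV :: 'u set)"
  using finite_lesspoll_infinite infinite_universe by blast

text \<open>Power sets, relations and tuples live in types other than \<open>'u\<close>; such an
  injection brings them back to small carriers inside \<open>'u\<close>.\<close>

lemma ex_encoding: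
  fixes A :: "'a set"
  assumes "A \<prec> (UNIV :: 'u set)"
  obtains e :: "'a \<Rightarrow> 'u" where "inj_on e A" "small (e ` A)"
proof -
  obtain e :: "'a \<Rightarrow> 'u" where "inj_on e A"
    using lesspoll_imp_lepoll[OF assms] unfolding lepoll_def by blast
  with small_image[OF assms, of e] show ?thesis using that by blast
qed

lemma small_Pow:
  fixes A :: "'a set"
  assumes "A \<prec> (UNIV :: 'u set)"
  shows "Pow A \<prec> (UNIV :: 'u set)"
proof -
  obtain e :: "'a \<Rightarrow> 'u" where e: "inj_on e A" "small (e ` A)"
    using ex_encoding[OF assms] .
  have "Pow A \<lesssim> Pow (e ` A)"
    unfolding lepoll_def using inj_on_image_Pow[OF e(1)] by (intro exI[of _ "image e"]) auto
  moreover have "Pow (e ` A) \<prec> (UNIV :: 'u set)"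
    using inaccessible e(2) unfolding inaccessible_type_def by blast
  ultimately show ?thesis by (rule small_lepoll)
qed

lemma small_Un:
  assumes "small A" "small (B :: 'u set)"
  shows "small (A \<union> B)"
proof -
  \<comment> \<open>Regularity is stated for unions indexed by small subsets of \<open>'u\<close>,
    so a union of two sets needs a two-element index set.\<close>
  obtain a b :: 'u where ab: "a \<noteq> b"
    using infinite_universe by (metis (full_types) ex_new_if_finite finite.emptyI finite_insert insertI1)
  have "small {a, b}" using small_finite[of "{a,b}"] by (simp add: small_def)
  moreover have "\<forall>(I :: 'u set) (A :: 'u \<Rightarrow> 'u set).
      small I \<and> (\<forall>i\<in>I. small (A i)) \<longrightarrow> small (\<Union>i\<in>I. A i)"
    using inaccessible unfolding inaccessible_type_def by blast
  from this[rule_format, of "{a, b}" "\<lambda>i. if i = a then A else B"]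
  have "small {a, b} \<Longrightarrow> small (\<Union>i\<in>{a,b}. if i = a then A else B)"
    using assms by simp
  ultimately have "small (\<Union>i\<in>{a,b}. if i = a then A else B)" by blast
  then show ?thesis using ab by (simp add: Un_commute)
qed

text \<open>Kuratowski pairs embed the product into the double power set of a union of two coded
  sets, so power sets and binary unions suffice.\<close>

lemma small_Times:
  fixes A :: "'a set" and B :: "'b set"
  assumes "A \<prec> (UNIV :: 'u set)" "B \<prec> (UNIV :: 'u set)"
  shows "A \<times> B \<prec> (UNIV :: 'u set)"
proof -
  obtain e :: "'a \<Rightarrow> 'u" where e: "inj_on e A" "small (e ` A)" using ex_encoding[OF assms(1)] .
  obtain f :: "'b \<Rightarrow> 'u" where f: "inj_on f B" "small (f ` B)" using ex_encoding[OF assms(2)] .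
  let ?k = "\<lambda>(a, b). {{e a}, {e a, f b}}"
  have kuratowski: "x = x' \<and> y = y'" if "{{x}, {x, y}} = {{x'}, {x', y'}}" for x y x' y' :: 'u
    using that by (simp add: doubleton_eq_iff) blast
  have "inj_on ?k (A \<times> B)"
  proof (rule inj_onI)
    fix z w assume z: "z \<in> A \<times> B" and w: "w \<in> A \<times> B" and eq: "?k z = ?k w"
    have "{{e (fst z)}, {e (fst z), f (snd z)}} = {{e (fst w)}, {e (fst w), f (snd w)}}"
      using eq by (simp add: case_prod_unfold)
    from kuratowski[OF this] have "e (fst z) = e (fst w)" "f (snd z) = f (snd w)" by auto
    then have "fst z = fst w" "snd z = snd w"
      using z w by (auto intro: inj_onD[OF e(1)] inj_onD[OF f(1)])
    then show "z = w" by (simp add: prod_eq_iff)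
  qed
  moreover have "?k ` (A \<times> B) \<subseteq> Pow (Pow (e ` A \<union> f ` B))" by auto
  ultimately have "A \<times> B \<lesssim> Pow (Pow (e ` A \<union> f ` B))" unfolding lepoll_def by blast
  moreover have "Pow (Pow (e ` A \<union> f ` B)) \<prec> (UNIV :: 'u set)"
    using small_Pow[OF small_Pow] small_Un[OF e(2) f(2)] unfolding small_def .
  ultimately show ?thesis by (rule small_lepoll)
qed

text \<open>A function on \<open>I\<close> is determined by its graph, a subset of the product of
  \<open>I\<close> with the union of the factors.\<close>

lemma small_PiE:
  fixes I :: "'u set" and X :: "'u \<Rightarrow> 'u set"
  assumes "small I" "\<And>i. i \<in> I \<Longrightarrow> small (X i)"
  shows "(\<Pi>\<^sub>E i\<in>I. X i) \<prec> (UNIV :: 'u set)"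
proof -
  let ?k = "\<lambda>f. (\<lambda>i. (i, f i)) ` I"
  have "inj_on ?k (\<Pi>\<^sub>E i\<in>I. X i)"
  proof (rule inj_onI)
    fix f g assume fg: "f \<in> (\<Pi>\<^sub>E i\<in>I. X i)" "g \<in> (\<Pi>\<^sub>E i\<in>I. X i)" and eq: "?k f = ?k g"
    have "f i = g i" if "i \<in> I" for i
    proof -
      have "(i, f i) \<in> ?k g" using that eq by auto
      then show ?thesis by auto
    qed
    then show "f = g" using fg by (blast intro: PiE_ext)
  qed
  moreover have "?k ` (\<Pi>\<^sub>E i\<in>I. X i) \<subseteq> Pow (I \<times> (\<Union>i\<in>I. X i))" by (auto simp: PiE_iff)
  ultimately have "(\<Pi>\<^sub>E i\<in>I. X i) \<lesssim> Pow (I \<times> (\<Union>i\<in>I. X i))" unfolding lepoll_def by blast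
  moreover have "\<forall>(I :: 'u set) (A :: 'u \<Rightarrow> 'u set).
      small I \<and> (\<forall>i\<in>I. small (A i)) \<longrightarrow> small (\<Union>i\<in>I. A i)"
    using inaccessible unfolding inaccessible_type_def by blast
  from this[rule_format, of I X] have "small (\<Union>i\<in>I. X i)" using assms by simp
  then have "Pow (I \<times> (\<Union>i\<in>I. X i)) \<prec> (UNIV :: 'u set)"
    using assms(1) unfolding small_def by (intro small_Pow small_Times)
  ultimately show ?thesis by (rule small_lepoll)
qed

end


section \<open>Concrete categories\<close>

text \<open>An equivalence relation presented by an injective parametrization. This is what a
  congruence relation in \<open>Set\<close> turns out to be, and the form in which reflection of
  congruences is exploited later.\<close>

definition concrete_congruence :: "'u set \<Rightarrow> 'u set \<Rightarrow> ('u \<Rightarrow> 'u) \<Rightarrow> ('u \<Rightarrow> 'u) \<Rightarrow> bool" where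
  "concrete_congruence R X p q \<longleftrightarrow>
     inj_on (\<lambda>r. (p r, q r)) R \<and> equiv X ((\<lambda>r. (p r, q r)) ` R)"

locale concrete_cat =
  fixes K :: "('o, 'u) concrete_category"
  assumes small_Und: "X \<in> Ob K \<Longrightarrow> small (Und K X)"
    and Mor_PiE: "\<lbrakk>X \<in> Ob K; Y \<in> Ob K; f \<in> Mor K X Y\<rbrakk> \<Longrightarrow> f \<in> Und K X \<rightarrow>\<^sub>E Und K Y"
    and Mor_id: "X \<in> Ob K \<Longrightarrow> (\<lambda>x\<in>Und K X. x) \<in> Mor K X X"
    and Mor_compose: "\<lbrakk>X \<in> Ob K; Y \<in> Ob K; Z \<in> Ob K; f \<in> Mor K X Y; g \<in> Mor K Y Z\<rbrakk>
      \<Longrightarrow> compose (Und K X) g f \<in> Mor K X Z"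
    and Mor_const: "\<lbrakk>X \<in> Ob K; Y \<in> Ob K; y \<in> Und K Y\<rbrakk> \<Longrightarrow> (\<lambda>x\<in>Und K X. y) \<in> Mor K X Y"
begin

lemma Mor_in: "\<lbrakk>X \<in> Ob K; Y \<in> Ob K; f \<in> Mor K X Y; x \<in> Und K X\<rbrakk> \<Longrightarrow> f x \<in> Und K Y"
  using Mor_PiE by blast

lemma Mor_ext:
  "\<lbrakk>X \<in> Ob K; Y \<in> Ob K; f \<in> Mor K X Y; g \<in> Mor K X Y; \<And>x. x \<in> Und K X \<Longrightarrow> f x = g x\<rbrakk> \<Longrightarrow> f = g"
  using Mor_PiE PiE_ext by metis

text \<open>Constant morphisms play the role of the points of an object.\<close>

lemma kernel_pair_imp_concrete:
  assumes ob: "R \<in> Ob K" "X \<in> Ob K" "Y \<in> Ob K" and h: "h \<in> Mor K X Y"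
    and ker: "is_kernel_pair K R X Y h p q"
  shows "concrete_congruence (Und K R) (Und K X) p q"
    and "\<And>x y. \<lbrakk>x \<in> Und K X; y \<in> Und K X\<rbrakk> \<Longrightarrow> h x = h y \<longleftrightarrow> (\<exists>r\<in>Und K R. p r = x \<and> q r = y)"
proof -
  have p: "p \<in> Mor K R X" and q: "q \<in> Mor K R X" and pq: "compose (Und K R) h p = compose (Und K R) h q"
    and univ: "\<And>Z a b. \<lbrakk>Z \<in> Ob K; a \<in> Mor K Z X; b \<in> Mor K Z X;
        compose (Und K Z) h a = compose (Und K Z) h b\<rbrakk> \<Longrightarrow>
        \<exists>!m. m \<in> Mor K Z R \<and> compose (Und K Z) p m = a \<and> compose (Und K Z) q m = b"
    using ker unfolding is_kernel_pair_def by blast+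
  have hpq: "h (p r) = h (q r)" if "r \<in> Und K R" for r
    using fun_cong[OF pq, of r] that by (simp add: compose_def)
  show 1: "h x = h y \<longleftrightarrow> (\<exists>r\<in>Und K R. p r = x \<and> q r = y)" if x: "x \<in> Und K X" and y: "y \<in> Und K X" for x y
  proof
    assume eq: "h x = h y"
    \<comment> \<open>No one-point object is assumed, so \<open>X\<close> itself is the test object;
      the mediating map is then evaluated at \<open>x\<close>.\<close>
    let ?c = "\<lambda>x. \<lambda>z\<in>Und K X. x"
    have "compose (Und K X) h (?c x) = compose (Und K X) h (?c y)"
      using eq by (auto simp: compose_def)
    then obtain m where m: "m \<in> Mor K X R" "compose (Und K X) p m = ?c x" "compose (Und K X) q m = ?c y"
      using univ[OF ob(2) Mor_const[OF ob(2,2) x] Mor_const[OF ob(2,2) y]] by blast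
    have "p (m x) = x" "q (m x) = y"
      using fun_cong[OF m(2), of x] fun_cong[OF m(3), of x] x by (simp_all add: compose_def)
    then show "\<exists>r\<in>Und K R. p r = x \<and> q r = y" using Mor_in[OF ob(2,1) m(1) x] by blast
  qed (use hpq in auto)
  have "inj_on (\<lambda>r. (p r, q r)) (Und K R)"
  proof (rule inj_onI)
    fix r s assume r: "r \<in> Und K R" and s: "s \<in> Und K R" and "(p r, q r) = (p s, q s)"
    then have eq: "p r = p s" "q r = q s" by auto
    let ?c = "\<lambda>x. \<lambda>z\<in>Und K R. x"
    have pr: "p r \<in> Und K X" "q r \<in> Und K X" using Mor_in[OF ob(1,2)] p q r by auto
    have "compose (Und K R) h (?c (p r)) = compose (Und K R) h (?c (q r))"
      using hpq[OF r] by (auto simp: compose_def)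
    then have "\<exists>!m. m \<in> Mor K R R \<and> compose (Und K R) p m = ?c (p r) \<and> compose (Und K R) q m = ?c (q r)"
      using univ[OF ob(1) Mor_const[OF ob(1,2) pr(1)] Mor_const[OF ob(1,2) pr(2)]] by blast
    moreover have "?c r \<in> Mor K R R \<and> compose (Und K R) p (?c r) = ?c (p r) \<and> compose (Und K R) q (?c r) = ?c (q r)"
      using Mor_const[OF ob(1,1) r] by (auto simp: compose_def)
    moreover have "?c s \<in> Mor K R R \<and> compose (Und K R) p (?c s) = ?c (p r) \<and> compose (Und K R) q (?c s) = ?c (q r)"
      using Mor_const[OF ob(1,1) s] eq by (auto simp: compose_def)
    ultimately have "?c r = ?c s" by blast
    then show "r = s" using r by (metis restrict_apply')
  qed
  moreover have "(\<lambda>r. (p r, q r)) ` Und K R = {(x, y). x \<in> Und K X \<and> y \<in> Und K X \<and> h x = h y}"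
  proof (intro set_eqI iffI)
    fix z assume "z \<in> (\<lambda>r. (p r, q r)) ` Und K R"
    then show "z \<in> {(x, y). x \<in> Und K X \<and> y \<in> Und K X \<and> h x = h y}"
      using Mor_in[OF ob(1,2) p] Mor_in[OF ob(1,2) q] hpq by auto
  next
    fix z assume "z \<in> {(x, y). x \<in> Und K X \<and> y \<in> Und K X \<and> h x = h y}"
    then show "z \<in> (\<lambda>r. (p r, q r)) ` Und K R" using 1 by force
  qed
  ultimately show "concrete_congruence (Und K R) (Und K X) p q"
    unfolding concrete_congruence_def
    by (auto intro!: equivI refl_onI symI transI)
qed

lemma congruence_imp_concrete:
  assumes "R \<in> Ob K" "X \<in> Ob K" "congruence_relation K R X p q"
  shows "concrete_congruence (Und K R) (Und K X) p q"
  using assms kernel_pair_imp_concrete(1) unfolding congruence_relation_def by blast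

text \<open>Morphisms are functions, so surjectivity of \<open>h\<close> gives uniqueness of
  factorizations for free and only existence has to be supplied.\<close>

lemma is_coequalizerI_surj:
  assumes ob: "X \<in> Ob K" "Y \<in> Ob K" "Q \<in> Ob K" and h: "h \<in> Mor K Y Q" "h ` Und K Y = Und K Q"
    and "compose (Und K X) h f = compose (Und K X) h g"
    and ex: "\<And>W k. \<lbrakk>W \<in> Ob K; k \<in> Mor K Y W; compose (Und K X) k f = compose (Und K X) k g\<rbrakk>
      \<Longrightarrow> \<exists>m\<in>Mor K Q W. compose (Und K Y) m h = k"
  shows "is_coequalizer K X Y f g Q h"
  unfolding is_coequalizer_def
proof (intro conjI ballI impI)
  fix W k assume W: "W \<in> Ob K" and k: "k \<in> Mor K Y W" "compose (Und K X) k f = compose (Und K X) k g"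
  have uniq: "m = n" if "m \<in> Mor K Q W" "n \<in> Mor K Q W"
    "compose (Und K Y) m h = k" "compose (Und K Y) n h = k" for m n
  proof (rule Mor_ext[OF ob(3) W that(1,2)])
    fix z assume "z \<in> Und K Q"
    then obtain y where "y \<in> Und K Y" "z = h y" using h(2) by blast
    then show "m z = n z" using that(3,4) by (metis compose_eq)
  qed
  show "\<exists>!m. m \<in> Mor K Q W \<and> compose (Und K Y) m h = k"
    using ex[OF W k] uniq by (intro ex_ex1I) blast+
qed (use assms in auto)

text \<open>The map \<open>h\<close> factors through the object \<open>S\<close> on its image, and
  by uniqueness the composite \<open>Q \<rightarrow> S \<rightarrow> Q\<close> is the identity; so
  no point of \<open>Q\<close> lies outside the image.\<close>

lemma coequalizer_surj:
  assumes ob: "Y \<in> Ob K" "S \<in> Ob K" and coeq: "is_coequalizer K X Y f g Q h"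
    and S: "Und K S = h ` Und K Y" "h \<in> Mor K Y S" "(\<lambda>x\<in>Und K S. x) \<in> Mor K S Q"
  shows "h ` Und K Y = Und K Q"
proof -
  have Q: "Q \<in> Ob K" and h: "h \<in> Mor K Y Q" and fg: "compose (Und K X) h f = compose (Und K X) h g"
    and univ: "\<And>W k. \<lbrakk>W \<in> Ob K; k \<in> Mor K Y W; compose (Und K X) k f = compose (Und K X) k g\<rbrakk>
      \<Longrightarrow> \<exists>!m. m \<in> Mor K Q W \<and> compose (Und K Y) m h = k"
    using coeq unfolding is_coequalizer_def by blast+
  obtain m where m: "m \<in> Mor K Q S" "compose (Und K Y) m h = h"
    using univ[OF ob(2) S(2) fg] by blast
  let ?n = "compose (Und K Q) (\<lambda>x\<in>Und K S. x) m"
  have n: "?n \<in> Mor K Q Q" using Mor_compose[OF Q ob(2) Q m(1) S(3)] .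
  have "compose (Und K Y) ?n h = h"
  proof
    fix y show "compose (Und K Y) ?n h y = h y"
      using fun_cong[OF m(2), of y] Mor_in[OF ob(1) Q h, of y] S(1) PiE_arb[OF Mor_PiE[OF ob(1) Q h], of y]
      by (auto simp: compose_def)
  qed
  moreover have "compose (Und K Y) (\<lambda>x\<in>Und K Q. x) h = h"
    by (rule Id_compose) (use Mor_PiE[OF ob(1) Q h] in \<open>auto simp: PiE_iff\<close>)
  ultimately have eq: "?n = (\<lambda>x\<in>Und K Q. x)" using univ[OF Q h fg] n Mor_id[OF Q] by blast
  have "z \<in> h ` Und K Y" if z: "z \<in> Und K Q" for z
  proof -
    have "z = m z" using fun_cong[OF eq, of z] z Mor_in[OF Q ob(2) m(1) z] by (simp add: compose_def)
    then show ?thesis using Mor_in[OF Q ob(2) m(1) z] S(1) by metis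
  qed
  then show ?thesis using Mor_in[OF ob(1) Q h] by auto
qed

text \<open>An injective \<open>f\<close> can only coequalize a pair of equal morphisms, and then
  the identity of \<open>X\<close> factors through it.\<close>

lemma regular_epi_inj_iso:
  assumes ob: "X \<in> Ob K" "Y \<in> Ob K" and f: "f \<in> Mor K X Y" "regular_epi K X Y f" "inj_on f (Und K X)"
  obtains g where "g \<in> Mor K Y X" "\<And>x. x \<in> Und K X \<Longrightarrow> g (f x) = x"
proof -
  obtain W a b where W: "W \<in> Ob K" and ab: "a \<in> Mor K W X" "b \<in> Mor K W X"
    and coeq: "is_coequalizer K W X a b Y f"
    using f(2) unfolding regular_epi_def by blast
  have "a w = b w" if "w \<in> Und K W" for w
  proof -
    have "compose (Und K W) f a w = compose (Und K W) f b w"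
      using coeq unfolding is_coequalizer_def by simp
    then have "f (a w) = f (b w)" using that by (simp add: compose_def)
    then show ?thesis using f(3) Mor_in[OF W ob(1)] ab that by (meson inj_onD)
  qed
  then have "a = b" using Mor_ext[OF W ob(1) ab] by blast
  then obtain g where g: "g \<in> Mor K Y X" "compose (Und K X) g f = (\<lambda>x\<in>Und K X. x)"
    using coeq Mor_id[OF ob(1)] ob(1) unfolding is_coequalizer_def by blast
  have "g (f x) = x" if "x \<in> Und K X" for x
    using fun_cong[OF g(2), of x] that by (simp add: compose_def)
  with g(1) show ?thesis using that by blast
qed

end

section \<open>Free objects and the left adjoint of the underlying functor\<close>

definition universal_arrow :: "('o, 'u) concrete_category \<Rightarrow> 'u set \<Rightarrow> 'o \<Rightarrow> ('u \<Rightarrow> 'u) \<Rightarrow> bool" where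
  "universal_arrow K S F e \<longleftrightarrow> F \<in> Ob K \<and> e \<in> S \<rightarrow>\<^sub>E Und K F \<and>
     (\<forall>X\<in>Ob K. \<forall>s\<in>S \<rightarrow>\<^sub>E Und K X. \<exists>!m. m \<in> Mor K F X \<and> compose S m e = s)"

lemma compose_compose:
  "f \<in> A \<rightarrow> B \<Longrightarrow> compose A h (compose A g f) = compose A (compose B h g) f"
  by (auto simp: compose_def fun_eq_iff Pi_iff)

context concrete_cat
begin

lemma universal_arrow_unique:
  assumes "universal_arrow K S F e" "X \<in> Ob K" "m \<in> Mor K F X" "n \<in> Mor K F X"
    "compose S m e = compose S n e"
  shows "m = n"
proof -
  have "e \<in> S \<rightarrow>\<^sub>E Und K F" "F \<in> Ob K" using assms(1) unfolding universal_arrow_def by blast+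
  then have "compose S n e \<in> S \<rightarrow>\<^sub>E Und K X"
    using Mor_PiE[OF _ assms(2,4)] by (auto simp: compose_def PiE_iff)
  then show ?thesis using assms unfolding universal_arrow_def by metis
qed

text \<open>The action on \<open>s\<close> is forced to be the unique extension of \<open>s\<close>
  followed by the unit; the functor laws compare two extensions of the same function.\<close>

lemma left_adjoint_of_universal_arrows:
  assumes "\<And>S. small S \<Longrightarrow> \<exists>F e. universal_arrow K S F e"
  shows "underlying_has_left_adjoint K"
proof -
  obtain L0 e where ua: "\<And>S. small S \<Longrightarrow> universal_arrow K S (L0 S) (e S)"
    using assms by metis
  have L: "L0 S \<in> Ob K" and e: "e S \<in> S \<rightarrow>\<^sub>E Und K (L0 S)" if "small S" for S
    using ua[OF that] unfolding universal_arrow_def by blast+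
  have ex: "\<exists>!m. m \<in> Mor K (L0 S) X \<and> compose S m (e S) = s"
    if "small S" "X \<in> Ob K" "s \<in> S \<rightarrow>\<^sub>E Und K X" for S X s
    using ua[OF that(1)] that(2,3) unfolding universal_arrow_def by blast
  define L1 where "L1 S T s = (THE m. m \<in> Mor K (L0 S) (L0 T) \<and> compose S m (e S) = compose S (e T) s)" for S T s
  define \<phi> where "\<phi> S X m = compose S m (e S)" for S and X :: 'o and m :: "'u \<Rightarrow> 'u"
  have cmp: "compose S n m \<in> S \<rightarrow>\<^sub>E C" if "m \<in> S \<rightarrow>\<^sub>E B" "n \<in> B \<rightarrow>\<^sub>E C" for S B C and m n :: "'u \<Rightarrow> 'u"
    using that by (auto simp: compose_def PiE_iff)
  have L1: "L1 S T s \<in> Mor K (L0 S) (L0 T)" "compose S (L1 S T s) (e S) = compose S (e T) s"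
    if "small S" "small T" "s \<in> S \<rightarrow>\<^sub>E T" for S T s
    using theI'[OF ex[OF that(1) L[OF that(2)] cmp[OF that(3) e[OF that(2)]]]] unfolding L1_def by auto
  note uniq = universal_arrow_unique[OF ua]
  have "is_functor Set_cat K L0 L1"
    unfolding is_functor_def
  proof (intro conjI ballI)
    fix X :: "'u set" assume "X \<in> Ob Set_cat"
    then have X: "small X" by (simp add: Set_cat_def)
    have id: "(\<lambda>x\<in>X. x) \<in> X \<rightarrow>\<^sub>E X" by auto
    have "compose X (\<lambda>x\<in>Und K (L0 X). x) (e X) = compose X (e X) (\<lambda>x\<in>X. x)"
      using e[OF X] by (auto simp: compose_def fun_eq_iff)
    then show "L1 X X (\<lambda>x\<in>Und Set_cat X. x) = (\<lambda>x\<in>Und K (L0 X). x)"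
      using uniq[OF X L[OF X] L1(1)[OF X X id] Mor_id[OF L[OF X]]] L1(2)[OF X X id]
      by (simp add: Set_cat_def)
  next
    fix X Y Z :: "'u set" and f g
    assume "X \<in> Ob Set_cat" "Y \<in> Ob Set_cat" "Z \<in> Ob Set_cat" "f \<in> Mor Set_cat X Y" "g \<in> Mor Set_cat Y Z"
    then have X: "small X" and Y: "small Y" and Z: "small Z" and f: "f \<in> X \<rightarrow>\<^sub>E Y" and g: "g \<in> Y \<rightarrow>\<^sub>E Z"
      by (simp_all add: Set_cat_def)
    let ?n = "compose (Und K (L0 X)) (L1 Y Z g) (L1 X Y f)"
    have n: "?n \<in> Mor K (L0 X) (L0 Z)"
      using Mor_compose[OF L[OF X] L[OF Y] L[OF Z] L1(1)[OF X Y f] L1(1)[OF Y Z g]] .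
    have gf: "compose X g f \<in> X \<rightarrow>\<^sub>E Z" using cmp[OF f g] .
    have "compose X ?n (e X) = compose X (L1 Y Z g) (compose X (L1 X Y f) (e X))"
      using e[OF X] by (subst compose_compose[where B="Und K (L0 X)"]) auto
    also have "\<dots> = compose X (L1 Y Z g) (compose X (e Y) f)" using L1(2)[OF X Y f] by simp
    also have "\<dots> = compose X (compose Y (L1 Y Z g) (e Y)) f"
      using f by (subst compose_compose[where B=Y]) auto
    also have "\<dots> = compose X (compose Y (e Z) g) f" using L1(2)[OF Y Z g] by simp
    also have "\<dots> = compose X (e Z) (compose X g f)"
      using f by (subst compose_compose[where B=Y]) auto
    finally have "L1 X Z (compose X g f) = ?n"
      using uniq[OF X L[OF Z] L1(1)[OF X Z gf] n] L1(2)[OF X Z gf] by simp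
    then show "L1 X Z (compose (Und Set_cat X) g f) = ?n" by (simp add: Set_cat_def)
  qed (use L L1 in \<open>auto simp: Set_cat_def\<close>)
  moreover have "bij_betw (\<phi> S X) (Mor K (L0 S) X) (Mor Set_cat S (Und K X))"
    if "S \<in> Ob Set_cat" and X: "X \<in> Ob K" for S X
  proof -
    have S: "small S" using that(1) by (simp add: Set_cat_def)
    show ?thesis unfolding bij_betw_def
    proof
      show "inj_on (\<phi> S X) (Mor K (L0 S) X)"
        using uniq[OF S X] unfolding \<phi>_def inj_on_def by blast
      show "\<phi> S X ` Mor K (L0 S) X = Mor Set_cat S (Und K X)"
      proof (intro set_eqI iffI)
        fix s assume "s \<in> \<phi> S X ` Mor K (L0 S) X"
        then show "s \<in> Mor Set_cat S (Und K X)"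
          using cmp[OF e[OF S] Mor_PiE[OF L[OF S] X]] by (auto simp: \<phi>_def Set_cat_def)
      next
        fix s assume "s \<in> Mor Set_cat S (Und K X)"
        then have "s \<in> S \<rightarrow>\<^sub>E Und K X" by (simp add: Set_cat_def)
        from ex[OF S X this] show "s \<in> \<phi> S X ` Mor K (L0 S) X" unfolding \<phi>_def by blast
      qed
    qed
  qed
  moreover have "\<phi> S X (compose (Und K (L0 S)) m (L1 S T s)) = compose S (\<phi> T X m) s"
    if "S \<in> Ob Set_cat" "T \<in> Ob Set_cat" "s \<in> Mor Set_cat S T" for S T X s m
  proof -
    have S: "small S" "small T" "s \<in> S \<rightarrow>\<^sub>E T" using that by (simp_all add: Set_cat_def)
    have "\<phi> S X (compose (Und K (L0 S)) m (L1 S T s)) = compose S m (compose S (L1 S T s) (e S))"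
      unfolding \<phi>_def using e[OF S(1)] by (subst compose_compose[where B="Und K (L0 S)"]) auto
    also have "\<dots> = compose S m (compose S (e T) s)" using L1(2)[OF S] by simp
    also have "\<dots> = compose S (\<phi> T X m) s"
      unfolding \<phi>_def using S(3) by (subst compose_compose[where B=T]) auto
    finally show ?thesis .
  qed
  moreover have "\<phi> S Y (compose (Und K (L0 S)) f m) = compose S f (\<phi> S X m)"
    if "S \<in> Ob Set_cat" for S X Y f m
  proof -
    have S: "small S" using that by (simp add: Set_cat_def)
    show ?thesis unfolding \<phi>_def using e[OF S] by (subst compose_compose[where B="Und K (L0 S)"]) auto
  qed
  ultimately show ?thesis
    unfolding underlying_has_left_adjoint_def
    by (intro exI[of _ L0] exI[of _ L1] exI[of _ \<phi>] conjI ballI) simp_all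
qed

end


section \<open>A criterion for varietal categories\<close>

text \<open>\<open>kernel\<close> and \<open>factor_surj\<close> turn surjections into regular
  epimorphisms, with \<open>coeq_surj\<close> for the converse; \<open>quotient_congruence\<close>
  and \<open>lift\<close> turn concrete congruences into kernel pairs; \<open>quotient_maps\<close>
  provides coequalizers.\<close>

locale exact_cat = concrete_cat K for K :: "('o, 'u) concrete_category" +
  assumes factor_surj: "\<lbrakk>X \<in> Ob K; Y \<in> Ob K; W \<in> Ob K; h \<in> Mor K X Y; h ` Und K X = Und K Y;
      k \<in> Mor K X W; \<And>x y. \<lbrakk>x \<in> Und K X; y \<in> Und K X; h x = h y\<rbrakk> \<Longrightarrow> k x = k y\<rbrakk>
      \<Longrightarrow> \<exists>m\<in>Mor K Y W. compose (Und K X) m h = k"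
    and kernel: "\<lbrakk>X \<in> Ob K; Y \<in> Ob K; h \<in> Mor K X Y\<rbrakk>
      \<Longrightarrow> \<exists>R\<in>Ob K. \<exists>p\<in>Mor K R X. \<exists>q\<in>Mor K R X.
            (\<lambda>r. (p r, q r)) ` Und K R = {(x, y) \<in> Und K X \<times> Und K X. h x = h y}"
    and lift: "\<lbrakk>R \<in> Ob K; X \<in> Ob K; Z \<in> Ob K; p \<in> Mor K R X; q \<in> Mor K R X;
      inj_on (\<lambda>r. (p r, q r)) (Und K R); a \<in> Mor K Z X; b \<in> Mor K Z X;
      \<And>z. z \<in> Und K Z \<Longrightarrow> \<exists>r\<in>Und K R. p r = a z \<and> q r = b z\<rbrakk>
      \<Longrightarrow> \<exists>m\<in>Mor K Z R. compose (Und K Z) p m = a \<and> compose (Und K Z) q m = b"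
    and quotient_maps: "\<lbrakk>X \<in> Ob K; \<And>W k. (W, k) \<in> M \<Longrightarrow> W \<in> Ob K \<and> k \<in> Mor K X W\<rbrakk>
      \<Longrightarrow> \<exists>Q\<in>Ob K. \<exists>h\<in>Mor K X Q. h ` Und K X = Und K Q \<and>
            (\<forall>x\<in>Und K X. \<forall>y\<in>Und K X. h x = h y \<longleftrightarrow> (\<forall>W k. (W, k) \<in> M \<longrightarrow> k x = k y))"
    and quotient_congruence: "\<lbrakk>R \<in> Ob K; X \<in> Ob K; p \<in> Mor K R X; q \<in> Mor K R X;
      concrete_congruence (Und K R) (Und K X) p q\<rbrakk>
      \<Longrightarrow> \<exists>Q\<in>Ob K. \<exists>h\<in>Mor K X Q. h ` Und K X = Und K Q \<and>
            (\<forall>x\<in>Und K X. \<forall>y\<in>Und K X. h x = h y \<longleftrightarrow> (\<exists>r\<in>Und K R. p r = x \<and> q r = y))"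
    and coeq_surj: "\<lbrakk>X \<in> Ob K; Y \<in> Ob K; is_coequalizer K X Y f g Q h\<rbrakk> \<Longrightarrow> h ` Und K Y = Und K Q"
begin

text \<open>A surjection is the coequalizer of its own kernel pair.\<close>

lemma regular_epi_iff_surj:
  assumes ob: "X \<in> Ob K" "Y \<in> Ob K" and f: "f \<in> Mor K X Y"
  shows "regular_epi K X Y f \<longleftrightarrow> f ` Und K X = Und K Y"
proof
  assume "regular_epi K X Y f"
  then show "f ` Und K X = Und K Y" using coeq_surj ob unfolding regular_epi_def by blast
next
  assume surj: "f ` Und K X = Und K Y"
  obtain R p q where R: "R \<in> Ob K" and p: "p \<in> Mor K R X" and q: "q \<in> Mor K R X"
    and im: "(\<lambda>r. (p r, q r)) ` Und K R = {(x, y) \<in> Und K X \<times> Und K X. f x = f y}"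
    using kernel[OF ob f] by blast
  have "is_coequalizer K R X p q Y f"
  proof (rule is_coequalizerI_surj[OF R ob f surj])
    show "compose (Und K R) f p = compose (Und K R) f q"
      using im by (auto simp: compose_def fun_eq_iff)
  next
    fix W k assume W: "W \<in> Ob K" "k \<in> Mor K X W" and eq: "compose (Und K R) k p = compose (Und K R) k q"
    show "\<exists>m\<in>Mor K Y W. compose (Und K X) m f = k"
    proof (rule factor_surj[OF ob W(1) f surj W(2)])
      fix x y assume "x \<in> Und K X" "y \<in> Und K X" "f x = f y"
      then have "(x, y) \<in> (\<lambda>r. (p r, q r)) ` Und K R" using im by auto
      then obtain r where "r \<in> Und K R" "x = p r" "y = q r" by auto
      then show "k x = k y" using fun_cong[OF eq, of r] by (simp add: compose_def)
    qed
  qed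
  then show "regular_epi K X Y f" unfolding regular_epi_def using R p q by blast
qed

lemma coequalizers: "has_coequalizers K"
  unfolding has_coequalizers_def
proof (intro ballI)
  fix X Y f g assume ob: "X \<in> Ob K" "Y \<in> Ob K" and f: "f \<in> Mor K X Y" and g: "g \<in> Mor K X Y"
  \<comment> \<open>Instead of generating a congruence from \<open>f\<close> and \<open>g\<close>,
    all morphisms that coequalize them are collected; the intersection of their kernels is the
    kernel of the coequalizer.\<close>
  define M where "M = {(W, k). W \<in> Ob K \<and> k \<in> Mor K Y W \<and> compose (Und K X) k f = compose (Und K X) k g}"
  obtain Q h where Q: "Q \<in> Ob K" and h: "h \<in> Mor K Y Q" "h ` Und K Y = Und K Q"
    and ker: "\<forall>x\<in>Und K Y. \<forall>y\<in>Und K Y. h x = h y \<longleftrightarrow> (\<forall>W k. (W, k) \<in> M \<longrightarrow> k x = k y)"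
  proof -
    have "\<exists>Q\<in>Ob K. \<exists>h\<in>Mor K Y Q. h ` Und K Y = Und K Q \<and>
        (\<forall>x\<in>Und K Y. \<forall>y\<in>Und K Y. h x = h y \<longleftrightarrow> (\<forall>W k. (W, k) \<in> M \<longrightarrow> k x = k y))"
      by (rule quotient_maps[OF ob(2)]) (simp add: M_def)
    then show ?thesis by (elim bexE conjE) (rule that)
  qed
  have "is_coequalizer K X Y f g Q h"
  proof (rule is_coequalizerI_surj[OF ob Q h])
    have "h (f x) = h (g x)" if x: "x \<in> Und K X" for x
    proof -
      have "k (f x) = k (g x)" if "(W, k) \<in> M" for W k
      proof -
        have "compose (Und K X) k f x = compose (Und K X) k g x" using that by (simp add: M_def)
        then show ?thesis using x by (simp add: compose_def)
      qed
      then show ?thesis using ker Mor_in[OF ob] f g x by blast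
    qed
    then show "compose (Und K X) h f = compose (Und K X) h g" by (auto simp: compose_def)
  next
    fix W k assume W: "W \<in> Ob K" "k \<in> Mor K Y W" and eq: "compose (Und K X) k f = compose (Und K X) k g"
    show "\<exists>m\<in>Mor K Q W. compose (Und K Y) m h = k"
    proof (rule factor_surj[OF ob(2) Q W(1) h W(2)])
      fix x y assume "x \<in> Und K Y" "y \<in> Und K Y" "h x = h y"
      moreover have "(W, k) \<in> M" using W eq by (simp add: M_def)
      ultimately show "k x = k y" using ker by blast
    qed
  qed
  then show "\<exists>Q h. is_coequalizer K X Y f g Q h" by blast
qed

text \<open>The quotient has the given relation as kernel; \<open>lift\<close> then turns the
  function into \<open>R\<close> that is available pointwise into a mediating morphism, and joint
  injectivity makes it unique.\<close>

lemma congruence_iff_concrete: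
  assumes ob: "R \<in> Ob K" "X \<in> Ob K" and p: "p \<in> Mor K R X" and q: "q \<in> Mor K R X"
  shows "congruence_relation K R X p q \<longleftrightarrow> concrete_congruence (Und K R) (Und K X) p q"
proof
  assume cong: "concrete_congruence (Und K R) (Und K X) p q"
  obtain Q h where Q: "Q \<in> Ob K" and h: "h \<in> Mor K X Q"
    and ker: "\<forall>x\<in>Und K X. \<forall>y\<in>Und K X. h x = h y \<longleftrightarrow> (\<exists>r\<in>Und K R. p r = x \<and> q r = y)"
    using quotient_congruence[OF ob p q cong] by (elim bexE conjE) (rule that)
  have inj: "inj_on (\<lambda>r. (p r, q r)) (Und K R)" using cong unfolding concrete_congruence_def by blast
  have "is_kernel_pair K R X Q h p q"
    unfolding is_kernel_pair_def
  proof (intro conjI ballI impI)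
    have "h (p r) = h (q r)" if "r \<in> Und K R" for r
      using ker[rule_format, OF Mor_in[OF ob p that] Mor_in[OF ob q that]] that by blast
    then show "compose (Und K R) h p = compose (Und K R) h q" by (auto simp: compose_def)
  next
    fix Z a b assume Z: "Z \<in> Ob K" and ab: "a \<in> Mor K Z X" "b \<in> Mor K Z X"
      and eq: "compose (Und K Z) h a = compose (Und K Z) h b"
    have "\<exists>r\<in>Und K R. p r = a z \<and> q r = b z" if z: "z \<in> Und K Z" for z
      using ker[rule_format, OF Mor_in[OF Z ob(2) ab(1) z] Mor_in[OF Z ob(2) ab(2) z]] fun_cong[OF eq, of z] z
      by (simp add: compose_def)
    from lift[OF ob Z p q inj ab this]
    obtain m where m: "m \<in> Mor K Z R" "compose (Und K Z) p m = a \<and> compose (Und K Z) q m = b"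
      by blast
    show "\<exists>!m. m \<in> Mor K Z R \<and> compose (Und K Z) p m = a \<and> compose (Und K Z) q m = b"
    proof (rule ex_ex1I)
      show "\<exists>m. m \<in> Mor K Z R \<and> compose (Und K Z) p m = a \<and> compose (Und K Z) q m = b" using m by blast
      fix m n assume *: "m \<in> Mor K Z R \<and> compose (Und K Z) p m = a \<and> compose (Und K Z) q m = b"
        "n \<in> Mor K Z R \<and> compose (Und K Z) p n = a \<and> compose (Und K Z) q n = b"
      then have "m \<in> Mor K Z R" "n \<in> Mor K Z R" by auto
      then show "m = n"
      proof (rule Mor_ext[OF Z ob(1)])
        fix z assume z: "z \<in> Und K Z"
        have "p (m z) = p (n z)" "q (m z) = q (n z)" using * z by (metis compose_eq)+
        then show "m z = n z" using inj_onD[OF inj] Mor_in[OF Z ob(1)] * z by blast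
      qed
    qed
  qed (use assms Q h in auto)
  then show "congruence_relation K R X p q" unfolding congruence_relation_def using Q h by blast
qed (use congruence_imp_concrete ob in blast)

end

text \<open>Covers \<open>Set\<close> and the classes of indiscrete, discrete and subsingleton
  spaces. Subsets of the square suffice for \<open>copies\<close>: kernel pairs are such subsets and
  quotients embed as sets of representatives. The proviso on \<open>A\<close> admits classes without
  an empty object, such as the one-point spaces.\<close>

locale full_concrete_cat =
  fixes K :: "('o, 'u) concrete_category"
  assumes small_obj: "X \<in> Ob K \<Longrightarrow> small (Und K X)"
    and Mor_full: "\<lbrakk>X \<in> Ob K; Y \<in> Ob K\<rbrakk> \<Longrightarrow> Mor K X Y = Und K X \<rightarrow>\<^sub>E Und K Y"
    and copies: "\<lbrakk>X \<in> Ob K; A \<subseteq> Und K X \<times> Und K X; A \<noteq> {} \<or> Und K X = {}\<rbrakk>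
      \<Longrightarrow> \<exists>R\<in>Ob K. \<exists>e. bij_betw e (Und K R) A"
begin

sublocale concrete_cat K
  by unfold_locales (auto simp: Mor_full small_obj compose_def PiE_iff extensional_def)

lemma quotient_equiv:
  assumes X: "X \<in> Ob K" and E: "equiv (Und K X) E"
  shows "\<exists>Q\<in>Ob K. \<exists>h\<in>Mor K X Q. h ` Und K X = Und K Q \<and>
     (\<forall>x\<in>Und K X. \<forall>y\<in>Und K X. h x = h y \<longleftrightarrow> (x, y) \<in> E)"
proof -
  define \<rho> where "\<rho> x = (SOME y. y \<in> E `` {x})" for x
  have \<rho>E: "(x, \<rho> x) \<in> E" if "x \<in> Und K X" for x
  proof -
    have "x \<in> E `` {x}" using equiv_class_self[OF E that] .
    from someI[of "\<lambda>y. y \<in> E `` {x}", OF this] show ?thesis by (simp add: \<rho>_def)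
  qed
  have sub: "E \<subseteq> Und K X \<times> Und K X" using E by (simp add: equiv_type)
  have \<rho>eq: "\<rho> x = \<rho> y \<longleftrightarrow> (x, y) \<in> E" if "x \<in> Und K X" "y \<in> Und K X" for x y
  proof
    assume "\<rho> x = \<rho> y"
    then show "(x, y) \<in> E" using \<rho>E[OF that(1)] \<rho>E[OF that(2)] E
      by (metis equivE symE transE)
  next
    assume "(x, y) \<in> E"
    then show "\<rho> x = \<rho> y" using equiv_class_eq[OF E] by (simp add: \<rho>_def)
  qed
  \<comment> \<open>The set of representatives is moved to the diagonal because
    \<open>copies\<close> speaks about subsets of the square.\<close>
  have "(\<lambda>x. (\<rho> x, \<rho> x)) ` Und K X \<subseteq> Und K X \<times> Und K X" using \<rho>E sub by auto
  then obtain Q e where Q: "Q \<in> Ob K" and e: "bij_betw e (Und K Q) ((\<lambda>x. (\<rho> x, \<rho> x)) ` Und K X)"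
    using copies[OF X, of "(\<lambda>x. (\<rho> x, \<rho> x)) ` Und K X"] by blast
  let ?g = "inv_into (Und K Q) e"
  have g: "bij_betw ?g ((\<lambda>x. (\<rho> x, \<rho> x)) ` Und K X) (Und K Q)" using bij_betw_inv_into[OF e] .
  let ?h = "\<lambda>x\<in>Und K X. ?g (\<rho> x, \<rho> x)"
  have "?h ` Und K X = Und K Q" using bij_betw_imp_surj_on[OF g] by (simp add: image_image)
  moreover from this have "?h \<in> Mor K X Q" using Mor_full[OF X Q] by auto
  moreover have "?h x = ?h y \<longleftrightarrow> (x, y) \<in> E" if "x \<in> Und K X" "y \<in> Und K X" for x y
    using inj_on_eq_iff[OF bij_betw_imp_inj_on[OF g]] that \<rho>eq[OF that] by auto
  ultimately show ?thesis using Q by blast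
qed

sublocale exact_cat K
proof unfold_locales
  fix X Y W h k
  assume ob: "X \<in> Ob K" "Y \<in> Ob K" "W \<in> Ob K" and h: "h \<in> Mor K X Y" "h ` Und K X = Und K Y"
    and k: "k \<in> Mor K X W" and ker: "\<And>x y. \<lbrakk>x \<in> Und K X; y \<in> Und K X; h x = h y\<rbrakk> \<Longrightarrow> k x = k y"
  let ?m = "\<lambda>y\<in>Und K Y. k (inv_into (Und K X) h y)"
  have "?m \<in> Mor K Y W" using Mor_full[OF ob(2,3)] Mor_in[OF ob(1,3) k] h(2) by (auto simp: inv_into_into)
  moreover have "compose (Und K X) ?m h = k"
  proof
    fix x show "compose (Und K X) ?m h x = k x"
    proof (cases "x \<in> Und K X")
      case True
      then have "k (inv_into (Und K X) h (h x)) = k x"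
        by (intro ker inv_into_into f_inv_into_f) auto
      then show ?thesis using True Mor_in[OF ob(1,2) h(1) True] by (simp add: compose_def)
    next
      case False
      then show ?thesis using PiE_arb[OF Mor_PiE[OF ob(1,3) k]] by (simp add: compose_def)
    qed
  qed
  ultimately show "\<exists>m\<in>Mor K Y W. compose (Und K X) m h = k" by blast
next
  fix X Y h assume ob: "X \<in> Ob K" "Y \<in> Ob K" and h: "h \<in> Mor K X Y"
  let ?A = "{(x, y) \<in> Und K X \<times> Und K X. h x = h y}"
  obtain R e where R: "R \<in> Ob K" and e: "bij_betw e (Und K R) ?A"
    using copies[OF ob(1), of ?A] by blast
  have im: "e ` Und K R = ?A" using e by (simp add: bij_betw_def)
  let ?p = "\<lambda>r\<in>Und K R. fst (e r)" and ?q = "\<lambda>r\<in>Und K R. snd (e r)"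
  have "(\<lambda>r. (?p r, ?q r)) ` Und K R = e ` Und K R" by (rule image_cong) auto
  moreover have "e r \<in> Und K X \<times> Und K X" if "r \<in> Und K R" for r
    using imageI[OF that, of e] unfolding im by auto
  then have "?p \<in> Mor K R X" "?q \<in> Mor K R X"
    using Mor_full[OF R ob(1)] by (auto simp: mem_Times_iff)
  ultimately show "\<exists>R\<in>Ob K. \<exists>p\<in>Mor K R X. \<exists>q\<in>Mor K R X. (\<lambda>r. (p r, q r)) ` Und K R = ?A"
    using R im by (intro bexI[of _ R] bexI[of _ ?p] bexI[of _ ?q]) simp_all
next
  fix R X Z p q a b
  assume ob: "R \<in> Ob K" "X \<in> Ob K" "Z \<in> Ob K" and a: "a \<in> Mor K Z X" and b: "b \<in> Mor K Z X"
    and "\<And>z. z \<in> Und K Z \<Longrightarrow> \<exists>r\<in>Und K R. p r = a z \<and> q r = b z"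
  then obtain m where m: "\<And>z. z \<in> Und K Z \<Longrightarrow> m z \<in> Und K R \<and> p (m z) = a z \<and> q (m z) = b z" by metis
  have "(\<lambda>z\<in>Und K Z. m z) \<in> Mor K Z R" using m Mor_full[OF ob(3,1)] by auto
  moreover have "compose (Und K Z) p (\<lambda>z\<in>Und K Z. m z) = a" "compose (Und K Z) q (\<lambda>z\<in>Und K Z. m z) = b"
    using m PiE_arb[OF Mor_PiE[OF ob(3,2) a]] PiE_arb[OF Mor_PiE[OF ob(3,2) b]]
    by (auto simp: compose_def fun_eq_iff)
  ultimately show "\<exists>m\<in>Mor K Z R. compose (Und K Z) p m = a \<and> compose (Und K Z) q m = b" by blast
next
  fix X and M :: "('o \<times> ('u \<Rightarrow> 'u)) set"
  assume "X \<in> Ob K"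
  moreover have "equiv (Und K X) {(x, y) \<in> Und K X \<times> Und K X. \<forall>W k. (W, k) \<in> M \<longrightarrow> k x = k y}"
    by (auto intro!: equivI refl_onI symI transI) metis+
  ultimately have "X \<in> Ob K" "equiv (Und K X) {(x, y) \<in> Und K X \<times> Und K X. \<forall>W k. (W, k) \<in> M \<longrightarrow> k x = k y}"
    by auto
  from quotient_equiv[OF this] show "\<exists>Q\<in>Ob K. \<exists>h\<in>Mor K X Q. h ` Und K X = Und K Q \<and>
            (\<forall>x\<in>Und K X. \<forall>y\<in>Und K X. h x = h y \<longleftrightarrow> (\<forall>W k. (W, k) \<in> M \<longrightarrow> k x = k y))"
    by simp
next
  fix R X p q assume "X \<in> Ob K" and cong: "concrete_congruence (Und K R) (Und K X) p q"
  have "(x, y) \<in> (\<lambda>r. (p r, q r)) ` Und K R \<longleftrightarrow> (\<exists>r\<in>Und K R. p r = x \<and> q r = y)" for x y by auto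
  with quotient_equiv[OF \<open>X \<in> Ob K\<close>, of "(\<lambda>r. (p r, q r)) ` Und K R"] cong
  show "\<exists>Q\<in>Ob K. \<exists>h\<in>Mor K X Q. h ` Und K X = Und K Q \<and>
            (\<forall>x\<in>Und K X. \<forall>y\<in>Und K X. h x = h y \<longleftrightarrow> (\<exists>r\<in>Und K R. p r = x \<and> q r = y))"
    unfolding concrete_congruence_def by simp
next
  fix X Y f g Q h assume ob: "X \<in> Ob K" "Y \<in> Ob K" and coeq: "is_coequalizer K X Y f g Q h"
  have Q: "Q \<in> Ob K" and h: "h \<in> Mor K Y Q" and fg: "compose (Und K X) h f = compose (Und K X) h g"
    and univ: "\<And>W k. \<lbrakk>W \<in> Ob K; k \<in> Mor K Y W; compose (Und K X) k f = compose (Und K X) k g\<rbrakk>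
      \<Longrightarrow> \<exists>!m. m \<in> Mor K Q W \<and> compose (Und K Y) m h = k"
    using coeq unfolding is_coequalizer_def by blast+
  \<comment> \<open>Collapsing the complement of the image needs a point of the image as target. If
    \<open>Y\<close> is empty there is none, but then an empty object exists and \<open>Q\<close>
    maps into it.\<close>
  have "Und K Q \<subseteq> h ` Und K Y"
  proof (cases "Und K Y = {}")
    case True
    obtain R e where R: "R \<in> Ob K" "bij_betw e (Und K R) ({} :: ('u \<times> 'u) set)"
      using copies[OF ob(2), of "{}"] True by blast
    then have "Und K R = {}" by (simp add: bij_betw_def)
    then have "(\<lambda>x. undefined) \<in> Mor K Y R" using Mor_full[OF ob(2) R(1)] True by simp
    moreover have "compose (Und K X) (\<lambda>x. undefined) f = compose (Und K X) (\<lambda>x. undefined) g"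
      by (simp add: compose_def)
    ultimately obtain m where "m \<in> Mor K Q R" using univ[OF R(1)] by blast
    then show ?thesis using Mor_in[OF Q R(1)] \<open>Und K R = {}\<close> by blast
  next
    case False
    then obtain y where y: "y \<in> Und K Y" by blast
    \<comment> \<open>Both \<open>?t\<close> and the identity factor \<open>h\<close> through
      itself, so they coincide and the image is everything.\<close>
    let ?t = "\<lambda>z\<in>Und K Q. if z \<in> h ` Und K Y then z else h y"
    have t: "?t \<in> Mor K Q Q" using Mor_full[OF Q Q] Mor_in[OF ob(2) Q h] y by auto
    have "compose (Und K Y) ?t h = h" "compose (Und K Y) (\<lambda>x\<in>Und K Q. x) h = h"
      using Mor_in[OF ob(2) Q h] PiE_arb[OF Mor_PiE[OF ob(2) Q h]]
      by (auto simp: compose_def fun_eq_iff)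
    then have eq: "?t = (\<lambda>x\<in>Und K Q. x)" using univ[OF Q h fg] t Mor_id[OF Q] by blast
    have "z = (if z \<in> h ` Und K Y then z else h y)" if "z \<in> Und K Q" for z
      using fun_cong[OF eq, of z] that by simp
    then show ?thesis using y by (metis imageI subsetI)
  qed
  then show "h ` Und K Y = Und K Q" using Mor_in[OF ob(2) Q h] by auto
qed

end

section \<open>Comparison with the category of sets\<close>

context inaccessible_universe
begin

lemma Set_full_concrete_cat: "full_concrete_cat (Set_cat :: ('u set, 'u) concrete_category)"
proof
  fix X :: "'u set" and A :: "('u \<times> 'u) set"
  assume "X \<in> Ob Set_cat" and A: "A \<subseteq> Und Set_cat X \<times> Und Set_cat X"
  then have "X \<times> X \<prec> (UNIV :: 'u set)" using small_Times[of X X] by (simp add: Set_cat_def small_def)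
  then have "A \<prec> (UNIV :: 'u set)"
    using small_lepoll[OF subset_imp_lepoll] A by (simp add: Set_cat_def)
  then obtain e :: "'u \<times> 'u \<Rightarrow> 'u" where e: "inj_on e A" "small (e ` A)" by (rule ex_encoding)
  have "bij_betw (inv_into A e) (e ` A) A"
    using bij_betw_inv_into inj_on_imp_bij_betw[OF e(1)] by blast
  then show "\<exists>R\<in>Ob (Set_cat :: ('u set, 'u) concrete_category). \<exists>e. bij_betw e (Und Set_cat R) A"
    using e(2) by (simp add: Set_cat_def) blast
qed (auto simp: Set_cat_def)

sublocale Set: full_concrete_cat "Set_cat :: ('u set, 'u) concrete_category"
  by (rule Set_full_concrete_cat)

lemma Set_regular_epi_iff:
  assumes "small A" "small (B :: 'u set)" "f \<in> A \<rightarrow>\<^sub>E B"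
  shows "regular_epi Set_cat A B f \<longleftrightarrow> f ` A = B"
  using Set.regular_epi_iff_surj[of A B f] assms by (simp add: Set_cat_def)

lemma Set_congruence_iff:
  assumes "small R" "small (X :: 'u set)" "p \<in> R \<rightarrow>\<^sub>E X" "q \<in> R \<rightarrow>\<^sub>E X"
  shows "congruence_relation Set_cat R X p q \<longleftrightarrow> concrete_congruence R X p q"
  using Set.congruence_iff_concrete[of R X p q] assms by (simp add: Set_cat_def)

text \<open>Both \<open>K\<close> and \<open>Set_cat\<close> are exact in the above sense, and there
  regular epimorphisms and congruences are characterized by underlying functions only, so the
  underlying functor preserves and reflects them.\<close>

lemma exact_cat_varietal:
  fixes K :: "('o, 'u) concrete_category"
  assumes "exact_cat K" and free: "\<And>S. small S \<Longrightarrow> \<exists>F e. universal_arrow K S F e"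
  shows "varietal K"
proof -
  interpret exact_cat K by fact
  have "regular_epi K X Y f \<longleftrightarrow> regular_epi Set_cat (Und K X) (Und K Y) f"
    if "X \<in> Ob K" "Y \<in> Ob K" "f \<in> Mor K X Y" for X Y f
    using that by (simp add: regular_epi_iff_surj Set_regular_epi_iff small_Und Mor_PiE)
  then have "preserves_regular_epis K" "reflects_regular_epis K"
    unfolding preserves_regular_epis_def reflects_regular_epis_def by simp_all
  moreover have "reflects_congruence_relations K"
    unfolding reflects_congruence_relations_def
    by (simp add: congruence_iff_concrete Set_congruence_iff small_Und Mor_PiE)
  moreover have "underlying_has_left_adjoint K"
    using free by (rule left_adjoint_of_universal_arrows)
  ultimately show ?thesis
    unfolding varietal_def algebraic_def using coequalizers by simp
qed

end


section \<open>Uniform spaces on carrier sets\<close>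

lemma unif_points: "is_uspace X \<Longrightarrow> eventually (\<lambda>z. z \<in> points X \<times> points X) (unif X)"
  unfolding is_uspace_def le_principal by blast

lemma unif_refl: "is_uspace X \<Longrightarrow> eventually E (unif X) \<Longrightarrow> x \<in> points X \<Longrightarrow> E (x, x)"
  unfolding is_uspace_def by blast

lemma unif_sym: "is_uspace X \<Longrightarrow> eventually E (unif X) \<Longrightarrow> eventually (\<lambda>(x, y). E (y, x)) (unif X)"
  unfolding is_uspace_def by blast

lemma unif_trans:
  assumes "is_uspace X" "eventually E (unif X)"
  shows "\<exists>D. eventually D (unif X) \<and> (\<forall>x y z. D (x, y) \<longrightarrow> D (y, z) \<longrightarrow> E (x, z))"
  using assms(1)[unfolded is_uspace_def, THEN conjunct2, THEN conjunct2, THEN conjunct2]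
    assms(2) by (elim allE impE)

lemma unif_symtrans:
  assumes X: "is_uspace X" and E: "eventually E (unif X)"
  shows "\<exists>D. eventually D (unif X) \<and> (\<forall>x y z. D (x, y) \<longrightarrow> D (y, z) \<longrightarrow> E (x, z)) \<and>
    (\<forall>x y. D (x, y) \<longrightarrow> D (y, x)) \<and> (\<forall>x y. D (x, y) \<longrightarrow> E (x, y))"
proof -
  obtain D where D: "eventually D (unif X)" "\<And>x y z. D (x, y) \<Longrightarrow> D (y, z) \<Longrightarrow> E (x, z)"
    using unif_trans[OF X E] by blast
  \<comment> \<open>Restricting to points of \<open>X\<close> makes the pairs \<open>(y, y)\<close>
    available, so that \<open>D\<close> being a half of \<open>E\<close> also gives inclusion in
    \<open>E\<close>.\<close>
  let ?D = "\<lambda>(x, y). D (x, y) \<and> D (y, x) \<and> x \<in> points X \<and> y \<in> points X"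
  have "eventually ?D (unif X)"
    using D(1) unif_sym[OF X D(1)] unif_points[OF X] by eventually_elim auto
  moreover have "E (x, y)" if "?D (x, y)" for x y
    using that D(2)[of x y y] unif_refl[OF X D(1), of y] by auto
  moreover have "E (x, z)" if "?D (x, y)" "?D (y, z)" for x y z using that D(2)[of x y z] by simp
  ultimately show ?thesis by (intro exI[of _ ?D]) auto
qed

lemma eventually_filtercomap_Pair:
  "eventually P (filtercomap (Pair x) F) \<longleftrightarrow> eventually (\<lambda>(x', y). x' = x \<longrightarrow> P y) F"
proof
  assume "eventually P (filtercomap (Pair x) F)"
  then obtain Q where "eventually Q F" "\<And>y. Q (x, y) \<Longrightarrow> P y"
    unfolding eventually_filtercomap by blast
  then show "eventually (\<lambda>(x', y). x' = x \<longrightarrow> P y) F" by (auto elim: eventually_mono)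
qed (auto simp: eventually_filtercomap)

text \<open>The topology is given by its open sets, so it takes an argument that slices of
  entourages are neighbourhoods: by halving an entourage, the set of points at which
  \<open>P\<close> holds on a slice is open.\<close>

lemma nhdsin_utopology:
  assumes X: "is_uspace X" and x: "x \<in> points X"
  shows "nhdsin (utopology X) x = filtercomap (Pair x) (unif X)"
proof (rule filter_eqI)
  fix P
  have "(\<exists>S. openin (utopology X) S \<and> x \<in> S \<and> (\<forall>x\<in>S. P x)) \<longleftrightarrow>
      eventually (\<lambda>(x', y). x' = x \<longrightarrow> P y) (unif X)"
  proof (rule iffI, elim exE conjE)
    fix S assume "openin (utopology X) S" "x \<in> S" "\<forall>x\<in>S. P x"
    then have "eventually (\<lambda>(x', y). x' = x \<longrightarrow> y \<in> S) (unif X)" by (simp add: openin_utopology)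
    then show "eventually (\<lambda>(x', y). x' = x \<longrightarrow> P y) (unif X)"
      by eventually_elim (use \<open>\<forall>x\<in>S. P x\<close> in auto)
  next
    assume P: "eventually (\<lambda>(x', y). x' = x \<longrightarrow> P y) (unif X)"
    let ?S = "{z \<in> points X. eventually (\<lambda>(x', y). x' = z \<longrightarrow> P y) (unif X)}"
    have "openin (utopology X) ?S"
      unfolding openin_utopology
    proof safe
      fix z assume z: "z \<in> points X" and ev: "eventually (\<lambda>(x', y). x' = z \<longrightarrow> P y) (unif X)"
      obtain D where D: "eventually D (unif X)"
        "\<And>a b c. D (a, b) \<Longrightarrow> D (b, c) \<Longrightarrow> (\<lambda>(x', y). x' = z \<longrightarrow> P y) (a, c)"
        using unif_trans[OF X ev] by blast
      show "eventually (\<lambda>(x', y). x' = z \<longrightarrow> y \<in> ?S) (unif X)"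
        using D(1) unif_points[OF X]
      proof eventually_elim
        case (elim w)
        obtain a b where w: "w = (a, b)" by force
        have "eventually (\<lambda>(x', y). x' = b \<longrightarrow> P y) (unif X)" if "a = z"
          using D(1) by eventually_elim (use D(2) elim(1) w that in auto)
        then show ?case using elim w by auto
      qed
    qed
    moreover have "P z" if "z \<in> ?S" for z
      using that unif_refl[OF X, of "\<lambda>(x', y). x' = z \<longrightarrow> P y" z] by auto
    moreover have "x \<in> ?S" using x P by simp
    ultimately show "\<exists>S. openin (utopology X) S \<and> x \<in> S \<and> (\<forall>x\<in>S. P x)"
      by (intro exI[of _ ?S] conjI ballI)
  qed
  then show "eventually P (nhdsin (utopology X) x) \<longleftrightarrow> eventually P (filtercomap (Pair x) (unif X))"
    unfolding eventually_filtercomap_Pair eventually_nhdsin topspace_utopology[OF X] using x by simp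
qed

lemma ex_open_nhd:
  assumes "is_uspace X" "x \<in> points X" "eventually E (unif X)"
  shows "\<exists>S. openin (utopology X) S \<and> x \<in> S \<and> (\<forall>y\<in>S. E (x, y))"
proof -
  have "eventually (\<lambda>y. E (x, y)) (nhdsin (utopology X) x)"
    unfolding nhdsin_utopology[OF assms(1,2)] eventually_filtercomap_Pair
    using assms(3) by eventually_elim auto
  then show ?thesis using assms(2) unfolding eventually_nhdsin topspace_utopology[OF assms(1)] by blast
qed

text \<open>Puts continuity in filter form, where it combines with the inverse image filters that
  describe initial uniformities.\<close>

lemma continuous_map_iff_nhdsin:
  "continuous_map T T' g \<longleftrightarrow>
     g \<in> topspace T \<rightarrow> topspace T' \<and> (\<forall>t\<in>topspace T. filterlim g (nhdsin T' (g t)) (nhdsin T t))"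
proof safe
  assume g: "continuous_map T T' g"
  fix t assume t: "t \<in> topspace T"
  show "filterlim g (nhdsin T' (g t)) (nhdsin T t)"
    unfolding filterlim_iff
  proof safe
    fix P assume "eventually P (nhdsin T' (g t))"
    then obtain S where S: "openin T' S" "g t \<in> S" "\<And>x. x \<in> S \<Longrightarrow> P x"
      using continuous_map_funspace[OF g] t unfolding eventually_nhdsin by blast
    then show "eventually (\<lambda>x. P (g x)) (nhdsin T t)"
      using openin_continuous_map_preimage[OF g S(1)] t unfolding eventually_nhdsin
      by (intro disjI2 exI[of _ "{x \<in> topspace T. g x \<in> S}"]) auto
  qed
next
  assume g: "g \<in> topspace T \<rightarrow> topspace T'"
    and lim: "\<forall>t\<in>topspace T. filterlim g (nhdsin T' (g t)) (nhdsin T t)"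
  show "continuous_map T T' g"
    unfolding continuous_map_def
  proof (intro conjI allI impI g)
    fix S assume S: "openin T' S"
    show "openin T {x \<in> topspace T. g x \<in> S}"
    proof (subst openin_subopen, safe)
      fix t assume t: "t \<in> topspace T" "g t \<in> S"
      have "eventually (\<lambda>x. x \<in> S) (nhdsin T' (g t))" unfolding eventually_nhdsin using S t by blast
      then have "eventually (\<lambda>x. g x \<in> S) (nhdsin T t)" using lim t(1) unfolding filterlim_iff by blast
      then obtain O' where "openin T O'" "t \<in> O'" "\<forall>x\<in>O'. g x \<in> S" unfolding eventually_nhdsin using t by blast
      then show "\<exists>O'. openin T O' \<and> t \<in> O' \<and> O' \<subseteq> {x \<in> topspace T. g x \<in> S}"
        using openin_subset by blast
    qed
  qed
qed (use continuous_map_funspace in blast)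

lemma ucont_mapsD:
  assumes "f \<in> ucont_maps X Y"
  shows "f \<in> points X \<rightarrow>\<^sub>E points Y" "filterlim (map_prod f f) (unif Y) (unif X)"
    "\<And>x. x \<in> points X \<Longrightarrow> f x \<in> points Y"
  using assms unfolding ucont_maps_def by auto

lemma ucont_eventually:
  "f \<in> ucont_maps X Y \<Longrightarrow> eventually E (unif Y) \<Longrightarrow> eventually (\<lambda>(x, y). E (f x, f y)) (unif X)"
  using ucont_mapsD(2) unfolding filterlim_iff by (fastforce elim: eventually_mono)

lemma ucont_continuous:
  assumes X: "is_uspace X" and Y: "is_uspace Y" and f: "f \<in> ucont_maps X Y"
  shows "continuous_map (utopology X) (utopology Y) f"
  unfolding continuous_map_iff_nhdsin topspace_utopology[OF X] topspace_utopology[OF Y]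
proof safe
  fix x assume x: "x \<in> points X"
  show "filterlim f (nhdsin (utopology Y) (f x)) (nhdsin (utopology X) x)"
    unfolding nhdsin_utopology[OF X x] nhdsin_utopology[OF Y ucont_mapsD(3)[OF f x]] filterlim_filtercomap_iff
    using filterlim_filtercomapI[OF ucont_mapsD(2)[OF f], of "Pair x"] by (simp add: comp_def)
qed (use ucont_mapsD(3)[OF f] in auto)

lemma filterlim_map_prod_cong:
  assumes X: "is_uspace X" and "\<And>x. x \<in> points X \<Longrightarrow> f x = g x"
  shows "filterlim (map_prod f f) F (unif X) \<longleftrightarrow> filterlim (map_prod g g) F (unif X)"
proof (rule filterlim_cong[OF refl refl])
  show "eventually (\<lambda>z. map_prod f f z = map_prod g g z) (unif X)"
    using unif_points[OF X] by eventually_elim (use assms(2) in auto)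
qed

lemma restrict_ucont_iff:
  assumes X: "is_uspace X"
  shows "(\<lambda>x\<in>points X. f x) \<in> ucont_maps X Y \<longleftrightarrow>
     f \<in> points X \<rightarrow> points Y \<and> filterlim (map_prod f f) (unif Y) (unif X)"
  using filterlim_map_prod_cong[OF X, of "\<lambda>x\<in>points X. f x" f]
  unfolding ucont_maps_def by auto

lemma ucont_id: "is_uspace X \<Longrightarrow> (\<lambda>x\<in>points X. x) \<in> ucont_maps X X"
  by (subst restrict_ucont_iff) (auto simp: prod.map_ident filterlim_ident map_prod_def)

lemma ucont_compose:
  assumes X: "is_uspace X" and f: "f \<in> ucont_maps X Y" and g: "g \<in> ucont_maps Y Z"
  shows "compose (points X) g f \<in> ucont_maps X Z"
  unfolding compose_def
proof (subst restrict_ucont_iff[OF X], intro conjI)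
  have "filterlim (map_prod g g \<circ> map_prod f f) (unif Z) (unif X)"
    using filterlim_compose[OF ucont_mapsD(2)[OF g] ucont_mapsD(2)[OF f]] by (simp add: comp_def)
  then show "filterlim (map_prod (\<lambda>x. g (f x)) (\<lambda>x. g (f x))) (unif Z) (unif X)"
    by (simp add: map_prod_compose[symmetric] comp_def map_prod_def case_prod_unfold)
qed (use ucont_mapsD(3)[OF f] ucont_mapsD(3)[OF g] in auto)

lemma ucont_const:
  assumes X: "is_uspace X" and Y: "is_uspace Y" and y: "y \<in> points Y"
  shows "(\<lambda>x\<in>points X. y) \<in> ucont_maps X Y"
  unfolding restrict_ucont_iff[OF X] filterlim_iff
proof (intro conjI allI impI)
  fix P assume "eventually P (unif Y)"
  then have "P (y, y)" using unif_refl[OF Y _ y] by blast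
  then show "eventually (\<lambda>z. P (map_prod (\<lambda>_. y) (\<lambda>_. y) z)) (unif X)"
    by (simp add: map_prod_def case_prod_unfold)
qed (use y in auto)

lemma Ob_UnifD: "X \<in> Ob_Unif \<Longrightarrow> is_uspace X" "X \<in> Ob_Unif \<Longrightarrow> small (points X)"
  by (simp_all add: Ob_Unif_def)

lemma full_subcat_simps [simp]:
  "Ob (full_subcat C) = C" "Und (full_subcat C) = points" "Mor (full_subcat C) = ucont_maps"
  by (simp_all add: full_subcat_def)

lemma concrete_cat_full_subcat:
  assumes "C \<subseteq> Ob_Unif"
  shows "concrete_cat (full_subcat C)"
proof
  fix X Y Z f g
  assume "X \<in> Ob (full_subcat C)"
  then have X: "X \<in> Ob_Unif" "is_uspace X" using assms Ob_UnifD by auto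
  then show "small (Und (full_subcat C) X)" by (simp add: Ob_UnifD)
  show "(\<lambda>x\<in>Und (full_subcat C) X. x) \<in> Mor (full_subcat C) X X" using ucont_id[OF X(2)] by simp
  assume "Y \<in> Ob (full_subcat C)"
  then have Y: "Y \<in> Ob_Unif" "is_uspace Y" using assms Ob_UnifD by auto
  { fix y assume "y \<in> Und (full_subcat C) Y"
    then show "(\<lambda>x\<in>Und (full_subcat C) X. y) \<in> Mor (full_subcat C) X Y"
      using ucont_const[OF X(2) Y(2)] by simp }
  assume f: "f \<in> Mor (full_subcat C) X Y"
  then show "f \<in> Und (full_subcat C) X \<rightarrow>\<^sub>E Und (full_subcat C) Y" using ucont_mapsD(1) by simp
  assume "g \<in> Mor (full_subcat C) Y Z"
  with f show "compose (Und (full_subcat C) X) g f \<in> Mor (full_subcat C) X Z"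
    using ucont_compose[OF X(2)] by simp
qed

lemma concrete_cat_Unif: "concrete_cat Unif"
  unfolding Unif_def by (rule concrete_cat_full_subcat) simp

lemma Unif_simps [simp]: "Ob Unif = Ob_Unif" "Und Unif = points" "Mor Unif = ucont_maps"
  by (simp_all add: Unif_def)

lemma isomorphic_UnifI:
  assumes "is_uspace X" "is_uspace Y" "f \<in> ucont_maps X Y" "g \<in> ucont_maps Y X"
    "\<And>x. x \<in> points X \<Longrightarrow> g (f x) = x" "\<And>y. y \<in> points Y \<Longrightarrow> f (g y) = y"
  shows "isomorphic Unif X Y"
  unfolding isomorphic_def
  using assms by (intro bexI[of _ f] bexI[of _ g]) (auto simp: compose_def fun_eq_iff)

lemma isomorphic_UnifD:
  assumes "isomorphic Unif X Y"
  shows "\<exists>f\<in>ucont_maps X Y. \<exists>g\<in>ucont_maps Y X.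
    (\<forall>x\<in>points X. g (f x) = x) \<and> (\<forall>y\<in>points Y. f (g y) = y)"
proof -
  obtain f g where fg: "f \<in> ucont_maps X Y" "g \<in> ucont_maps Y X"
    and 1: "compose (points X) g f = (\<lambda>x\<in>points X. x)" and 2: "compose (points Y) f g = (\<lambda>y\<in>points Y. y)"
    using assms unfolding isomorphic_def by auto
  have "g (f x) = x" if "x \<in> points X" for x using fun_cong[OF 1, of x] that by (simp add: compose_def)
  moreover have "f (g y) = y" if "y \<in> points Y" for y using fun_cong[OF 2, of y] that by (simp add: compose_def)
  ultimately show ?thesis using fg by blast
qed


section \<open>Initial uniformities\<close>

text \<open>One construction for products and for subspaces, so that uniform continuity and
  continuity into either of them are characterized once.\<close>

definition initial_uspace :: "'b set \<Rightarrow> 'i set \<Rightarrow> ('i \<Rightarrow> 'u uspace) \<Rightarrow> ('i \<Rightarrow> 'b \<Rightarrow> 'u) \<Rightarrow> 'b uspace" where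
  "initial_uspace A I X f = \<lparr>points = A,
     unif = inf (principal (A \<times> A)) (INF i\<in>I. filtercomap (map_prod (f i) (f i)) (unif (X i)))\<rparr>"

lemma points_initial [simp]: "points (initial_uspace A I X f) = A"
  by (simp add: initial_uspace_def)

lemma is_uspace_initial:
  fixes A :: "'b set"
  assumes X: "\<And>i. i \<in> I \<Longrightarrow> is_uspace (X i)" and f: "\<And>i. i \<in> I \<Longrightarrow> f i \<in> A \<rightarrow> points (X i)"
  shows "is_uspace (initial_uspace A I X f)"
proof -
  \<comment> \<open>The uniformity axioms apart from the bound by the carrier, isolated because they
    pass to inverse images and binary infima. An infinite infimum inherits them since each of its
    members already belongs to a finite one.\<close>
  define good where "good F \<longleftrightarrow> (\<forall>E. eventually E F \<longrightarrow> (\<forall>x\<in>A. E (x, x)) \<and>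
      eventually (\<lambda>(x, y). E (y, x)) F \<and>
      (\<exists>D. eventually D F \<and> (\<forall>x y z. D (x, y) \<longrightarrow> D (y, z) \<longrightarrow> E (x, z))))" for F :: "('b \<times> 'b) filter"
  have refl: "E (x, x)" if "good F" "eventually E F" "x \<in> A" for F E x
    using that(1)[unfolded good_def, THEN spec, THEN mp, OF that(2)] that(3) by (elim conjE bspec)
  have sym: "eventually (\<lambda>(x, y). E (y, x)) F" if "good F" "eventually E F" for F E
    using that(1)[unfolded good_def, THEN spec, THEN mp, OF that(2)] by (elim conjE)
  have trans: "\<exists>D. eventually D F \<and> (\<forall>x y z. D (x, y) \<longrightarrow> D (y, z) \<longrightarrow> E (x, z))"
    if "good F" "eventually E F" for F E
    using that(1)[unfolded good_def, THEN spec, THEN mp, OF that(2)] by (elim conjE)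
  have good_inf: "good (inf F G)" if F: "good F" and G: "good G" for F G
    unfolding good_def
  proof (intro allI impI)
    fix E assume "eventually E (inf F G)"
    then obtain P Q where P: "eventually P F" and Q: "eventually Q G" and PQ: "\<And>z. P z \<Longrightarrow> Q z \<Longrightarrow> E z"
      unfolding eventually_inf by blast
    obtain D1 where D1: "eventually D1 F" "\<And>x y z. D1 (x, y) \<Longrightarrow> D1 (y, z) \<Longrightarrow> P (x, z)"
      using trans[OF F P] by blast
    obtain D2 where D2: "eventually D2 G" "\<And>x y z. D2 (x, y) \<Longrightarrow> D2 (y, z) \<Longrightarrow> Q (x, z)"
      using trans[OF G Q] by blast
    have "\<forall>x\<in>A. E (x, x)" using refl[OF F P] refl[OF G Q] PQ by blast
    moreover have "eventually (\<lambda>(x, y). P (y, x)) F" "eventually (\<lambda>(x, y). Q (y, x)) G"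
      using sym[OF F P] sym[OF G Q] .
    then have "eventually (\<lambda>(x, y). E (y, x)) (inf F G)"
      unfolding eventually_inf by (rule_tac x="\<lambda>(x, y). P (y, x)" in exI, rule_tac x="\<lambda>(x, y). Q (y, x)" in exI)
        (auto intro: PQ)
    moreover have "eventually (\<lambda>z. D1 z \<and> D2 z) (inf F G)"
      unfolding eventually_inf using D1(1) D2(1) by blast
    ultimately show "(\<forall>x\<in>A. E (x, x)) \<and> eventually (\<lambda>(x, y). E (y, x)) (inf F G) \<and>
      (\<exists>D. eventually D (inf F G) \<and> (\<forall>x y z. D (x, y) \<longrightarrow> D (y, z) \<longrightarrow> E (x, z)))"
      using D1(2) D2(2) PQ by (intro conjI exI[of _ "\<lambda>z. D1 z \<and> D2 z"]) auto
  qed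
  have good_comap: "good (filtercomap (map_prod (f i) (f i)) (unif (X i)))" if i: "i \<in> I" for i
    unfolding good_def
  proof (intro allI impI)
    fix E assume "eventually E (filtercomap (map_prod (f i) (f i)) (unif (X i)))"
    then obtain P where P: "eventually P (unif (X i))" and PE: "\<And>z. P (map_prod (f i) (f i) z) \<Longrightarrow> E z"
      unfolding eventually_filtercomap by blast
    have sym: "eventually (\<lambda>(x, y). P (y, x)) (unif (X i))" using unif_sym[OF X[OF i] P] .
    obtain D where D: "eventually D (unif (X i))" "\<And>x y z. D (x, y) \<Longrightarrow> D (y, z) \<Longrightarrow> P (x, z)"
      using unif_trans[OF X[OF i] P] by blast
    have "\<forall>x\<in>A. E (x, x)" using unif_refl[OF X[OF i] P] f[OF i] by (intro ballI PE) auto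
    moreover have "eventually (\<lambda>(x, y). E (y, x)) (filtercomap (map_prod (f i) (f i)) (unif (X i)))"
      unfolding eventually_filtercomap using sym by (intro exI[of _ "\<lambda>(x, y). P (y, x)"]) (auto intro: PE)
    moreover have "eventually (\<lambda>z. D (map_prod (f i) (f i) z)) (filtercomap (map_prod (f i) (f i)) (unif (X i)))"
      using D(1) by (rule eventually_filtercomapI)
    ultimately show "(\<forall>x\<in>A. E (x, x)) \<and>
      eventually (\<lambda>(x, y). E (y, x)) (filtercomap (map_prod (f i) (f i)) (unif (X i))) \<and>
      (\<exists>D. eventually D (filtercomap (map_prod (f i) (f i)) (unif (X i))) \<and>
        (\<forall>x y z. D (x, y) \<longrightarrow> D (y, z) \<longrightarrow> E (x, z)))"
      using D(2) by (intro conjI exI[of _ "\<lambda>z. D (map_prod (f i) (f i) z)"]) (auto intro: PE)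
  qed
  have good_top: "good top" unfolding good_def eventually_top by auto
  have good_fin: "good (INF i\<in>J. filtercomap (map_prod (f i) (f i)) (unif (X i)))"
    if "finite J" "J \<subseteq> I" for J
    using that by (induction J rule: finite_induct) (auto simp: good_top good_inf good_comap)
  have good_INF: "good (INF i\<in>I. filtercomap (map_prod (f i) (f i)) (unif (X i)))" (is "good ?G")
    unfolding good_def
  proof (intro allI impI)
    fix E assume "eventually E ?G"
    then obtain J where J: "J \<subseteq> I" "finite J"
      and E: "eventually E (INF i\<in>J. filtercomap (map_prod (f i) (f i)) (unif (X i)))" (is "eventually E ?H")
      unfolding eventually_INF[of _ _ I] by blast
    have "?G \<le> ?H" using J by (intro INF_superset_mono) auto
    then have le: "eventually P ?H \<Longrightarrow> eventually P ?G" for P by (rule filter_leD)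
    note J' = good_fin[OF J(2,1)]
    obtain D where "eventually D ?H" "\<forall>x y z. D (x, y) \<longrightarrow> D (y, z) \<longrightarrow> E (x, z)"
      using trans[OF J' E] by (elim exE conjE)
    then have "\<exists>D. eventually D ?G \<and> (\<forall>x y z. D (x, y) \<longrightarrow> D (y, z) \<longrightarrow> E (x, z))"
      using le[of D] by (intro exI[of _ D] conjI)
    then show "(\<forall>x\<in>A. E (x, x)) \<and> eventually (\<lambda>(x, y). E (y, x)) ?G \<and>
      (\<exists>D. eventually D ?G \<and> (\<forall>x y z. D (x, y) \<longrightarrow> D (y, z) \<longrightarrow> E (x, z)))"
      using refl[OF J' E] le[OF sym[OF J' E]] by (intro conjI ballI)
  qed
  have "good (principal (A \<times> A))"
    unfolding good_def eventually_principal
  proof (intro allI impI)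
    fix E assume "\<forall>x\<in>A \<times> A. E x"
    then show "(\<forall>x\<in>A. E (x, x)) \<and> (\<forall>x\<in>A \<times> A. case x of (x, y) \<Rightarrow> E (y, x)) \<and>
      (\<exists>D. (\<forall>x\<in>A \<times> A. D x) \<and> (\<forall>x y z. D (x, y) \<longrightarrow> D (y, z) \<longrightarrow> E (x, z)))"
      by (intro conjI exI[of _ "\<lambda>z. z \<in> A \<times> A"]) auto
  qed
  from good_inf[OF this good_INF] have "good (unif (initial_uspace A I X f))"
    by (simp add: initial_uspace_def)
  moreover have "unif (initial_uspace A I X f) \<le> principal (A \<times> A)"
    by (simp add: initial_uspace_def)
  ultimately show ?thesis
    unfolding is_uspace_def points_initial
    using refl[of "unif (initial_uspace A I X f)"] sym[of "unif (initial_uspace A I X f)"]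
      trans[of "unif (initial_uspace A I X f)"]
    by (intro conjI allI impI ballI)
qed

lemma filterlim_initial:
  "filterlim (map_prod g g) (unif (initial_uspace A I X f)) F \<longleftrightarrow>
     eventually (\<lambda>(x, y). g x \<in> A \<and> g y \<in> A) F \<and>
     (\<forall>i\<in>I. filterlim (map_prod (\<lambda>x. f i (g x)) (\<lambda>x. f i (g x))) (unif (X i)) F)"
  by (simp add: initial_uspace_def filterlim_inf filterlim_INF filterlim_principal
      filterlim_filtercomap_iff comp_def map_prod_def case_prod_unfold)

lemma restrict_ucont_initial_iff:
  assumes Z: "is_uspace Z"
  shows "(\<lambda>z\<in>points Z. g z) \<in> ucont_maps Z (initial_uspace A I X f) \<longleftrightarrow>
     g \<in> points Z \<rightarrow> A \<and>
     (\<forall>i\<in>I. filterlim (map_prod (\<lambda>x. f i (g x)) (\<lambda>x. f i (g x))) (unif (X i)) (unif Z))"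
proof -
  have "eventually (\<lambda>(x, y). g x \<in> A \<and> g y \<in> A) (unif Z)" if "g \<in> points Z \<rightarrow> A"
    using unif_points[OF Z] by eventually_elim (use that in auto)
  then show ?thesis unfolding restrict_ucont_iff[OF Z] filterlim_initial points_initial by blast
qed

text \<open>The topology of an initial uniformity is the initial topology, because taking slices is
  an inverse image of filters and commutes with infima.\<close>

lemma continuous_map_initial_iff:
  assumes X: "\<And>i. i \<in> I \<Longrightarrow> is_uspace (X i)" and f: "\<And>i. i \<in> I \<Longrightarrow> f i \<in> A \<rightarrow> points (X i)"
  shows "continuous_map T (utopology (initial_uspace A I X f)) g \<longleftrightarrow>
     g \<in> topspace T \<rightarrow> A \<and> (\<forall>i\<in>I. continuous_map T (utopology (X i)) (\<lambda>t. f i (g t)))"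
proof -
  have U: "is_uspace (initial_uspace A I X f)" using is_uspace_initial[OF X f] .
  have *: "filterlim g (nhdsin (utopology (initial_uspace A I X f)) (g t)) (nhdsin T t) \<longleftrightarrow>
      (\<forall>i\<in>I. filterlim (\<lambda>t. f i (g t)) (nhdsin (utopology (X i)) (f i (g t))) (nhdsin T t))"
    if g: "g \<in> topspace T \<rightarrow> A" and t: "t \<in> topspace T" for t
  proof -
    have gt: "g t \<in> A" using g t by auto
    have "nhdsin (utopology (initial_uspace A I X f)) (g t) =
      inf (principal A) (INF i\<in>I. filtercomap (f i) (nhdsin (utopology (X i)) (f i (g t))))"
    proof -
      have "filtercomap (f i) (nhdsin (utopology (X i)) (f i (g t))) =
          filtercomap (Pair (g t)) (filtercomap (map_prod (f i) (f i)) (unif (X i)))" if "i \<in> I" for i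
        using f[OF that] gt by (subst nhdsin_utopology[OF X[OF that]]) (auto simp: filtercomap_filtercomap)
      moreover have "Pair (g t) -` (A \<times> A) = A" using gt by auto
      ultimately show ?thesis using gt
        by (subst nhdsin_utopology[OF U]) (simp_all add: initial_uspace_def filtercomap_inf filtercomap_INF)
    qed
    moreover have "eventually (\<lambda>x. g x \<in> A) (nhdsin T t)"
      unfolding eventually_nhdsin using g t by (intro disjI2 exI[of _ "topspace T"]) auto
    ultimately show ?thesis
      by (simp add: filterlim_inf filterlim_INF filterlim_principal filterlim_filtercomap_iff comp_def)
  qed
  have fU: "(\<lambda>t. f i (g t)) \<in> topspace T \<rightarrow> points (X i)" if "g \<in> topspace T \<rightarrow> A" "i \<in> I" for i
    using that f[OF that(2)] by auto
  show ?thesis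
  proof (cases "g \<in> topspace T \<rightarrow> A")
    case True
    have "continuous_map T (utopology (X i)) (\<lambda>t. f i (g t)) \<longleftrightarrow>
        (\<forall>t\<in>topspace T. filterlim (\<lambda>t. f i (g t)) (nhdsin (utopology (X i)) (f i (g t))) (nhdsin T t))"
      if "i \<in> I" for i
      using fU[OF True that] by (simp add: continuous_map_iff_nhdsin topspace_utopology[OF X[OF that]])
    moreover have "continuous_map T (utopology (initial_uspace A I X f)) g \<longleftrightarrow>
        (\<forall>t\<in>topspace T. \<forall>i\<in>I.
          filterlim (\<lambda>t. f i (g t)) (nhdsin (utopology (X i)) (f i (g t))) (nhdsin T t))"
      using True *[OF True] by (simp add: continuous_map_iff_nhdsin topspace_utopology[OF U])
    ultimately show ?thesis using True by simp blast
  next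
    case False
    then show ?thesis
      using continuous_map_funspace[of T "utopology (initial_uspace A I X f)" g]
      by (auto simp: topspace_utopology[OF U])
  qed
qed

lemma topology_eqI:
  assumes "continuous_map T T' (\<lambda>x. x)" "continuous_map T' T (\<lambda>x. x)"
  shows "T = T'"
proof (rule topology_eq[THEN iffD2], safe)
  have "openin T S" if S: "openin T' S" and "continuous_map T T' (\<lambda>x. x)" "continuous_map T' T (\<lambda>x. x)"
    for T T' :: "'a topology" and S
  proof -
    have "S \<subseteq> topspace T" using openin_subset[OF S] continuous_map_funspace[OF that(3)] by auto
    then have "{x \<in> topspace T. x \<in> S} = S" by blast
    then show ?thesis using openin_continuous_map_preimage[OF that(2) S] by simp
  qed
  from this[OF _ assms] this[OF _ assms(2,1)]
  show "\<And>S. openin T S \<Longrightarrow> openin T' S" "\<And>S. openin T' S \<Longrightarrow> openin T S" by blast+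
qed

lemma usubspace_initial: "usubspace X S = initial_uspace S {()} (\<lambda>_. X) (\<lambda>_ x. x)"
  by (simp add: usubspace_def initial_uspace_def inf_commute filtercomap_ident map_prod_def case_prod_unfold)

lemma points_usubspace [simp]: "points (usubspace X S) = S"
  by (simp add: usubspace_def)

lemma is_uspace_usubspace: "is_uspace X \<Longrightarrow> S \<subseteq> points X \<Longrightarrow> is_uspace (usubspace X S)"
  unfolding usubspace_initial by (rule is_uspace_initial) auto

lemma restrict_ucont_usubspace_iff:
  assumes Z: "is_uspace Z" and S: "S \<subseteq> points X"
  shows "(\<lambda>z\<in>points Z. g z) \<in> ucont_maps Z (usubspace X S) \<longleftrightarrow>
    g \<in> points Z \<rightarrow> S \<and> (\<lambda>z\<in>points Z. g z) \<in> ucont_maps Z X"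
  using restrict_ucont_initial_iff[OF Z, of g S "{()}" "\<lambda>_. X" "\<lambda>_ x. x"]
    restrict_ucont_iff[OF Z, of g X] S
  unfolding usubspace_initial[symmetric] by auto

lemma ucont_usubspace_iff:
  assumes Z: "is_uspace Z" and S: "S \<subseteq> points X"
  shows "g \<in> ucont_maps Z (usubspace X S) \<longleftrightarrow> g ` points Z \<subseteq> S \<and> g \<in> ucont_maps Z X"
proof -
  have "g \<in> extensional (points Z) \<Longrightarrow> (\<lambda>z\<in>points Z. g z) = g" by (rule extensional_restrict)
  moreover have "g \<in> extensional (points Z)" if "g \<in> ucont_maps Z Y" for Y
    using ucont_mapsD(1)[OF that] by (simp add: PiE_iff)
  ultimately show ?thesis
    using restrict_ucont_usubspace_iff[OF assms, of g] by (metis Pi_iff image_subset_iff)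
qed

lemma ucont_inclusion:
  assumes "is_uspace X" "S \<subseteq> points X"
  shows "(\<lambda>x\<in>S. x) \<in> ucont_maps (usubspace X S) X"
  using restrict_ucont_usubspace_iff[OF is_uspace_usubspace[OF assms] assms(2), of "\<lambda>x. x"]
    ucont_id[OF is_uspace_usubspace[OF assms]] by simp

lemma utopology_usubspace:
  assumes X: "is_uspace X" and S: "S \<subseteq> points X"
  shows "utopology (usubspace X S) = subtopology (utopology X) S"
proof (rule topology_eqI)
  have U: "is_uspace (usubspace X S)" using is_uspace_usubspace[OF assms] .
  have iff: "continuous_map T (utopology (usubspace X S)) (\<lambda>x. x) \<longleftrightarrow>
      topspace T \<subseteq> S \<and> continuous_map T (utopology X) (\<lambda>x. x)" for T
    unfolding usubspace_initial using X S by (subst continuous_map_initial_iff) auto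
  show "continuous_map (subtopology (utopology X) S) (utopology (usubspace X S)) (\<lambda>x. x)"
    unfolding iff by (auto simp: continuous_map_from_subtopology continuous_map_id[unfolded id_def])
  have "continuous_map (utopology (usubspace X S)) (utopology (usubspace X S)) (\<lambda>x. x)"
    using continuous_map_id[unfolded id_def] .
  then show "continuous_map (utopology (usubspace X S)) (subtopology (utopology X) S) (\<lambda>x. x)"
    using iff[of "utopology (usubspace X S)"] by (auto simp: continuous_map_in_subtopology topspace_utopology[OF U])
qed


section \<open>Products\<close>

lemma (in concrete_cat) product_unique:
  assumes P: "is_product K I X P p" and Q: "is_product K I X Q q"
  shows "isomorphic K P Q"
proof -
  have univ: "\<exists>!h. h \<in> Mor K Z A \<and> (\<forall>i\<in>I. compose (Und K Z) (a i) h = q i)"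
    if "is_product K I X A a" "Z \<in> Ob K" "\<forall>i\<in>I. q i \<in> Mor K Z (X i)" for A a Z q
    using that(1)[unfolded is_product_def, THEN conjunct2, THEN conjunct2, THEN bspec, OF that(2),
        THEN spec, THEN mp, OF that(3)] .
  have 1: "\<exists>m\<in>Mor K A B. \<forall>i\<in>I. compose (Und K A) (b i) m = a i"
    if A: "is_product K I X A a" and B: "is_product K I X B b" for A B a b
  proof -
    have "A \<in> Ob K" "\<forall>i\<in>I. a i \<in> Mor K A (X i)" using A unfolding is_product_def by simp_all
    from univ[OF B this] show ?thesis by blast
  qed
  have 2: "compose (Und K A) n m = (\<lambda>x\<in>Und K A. x)"
    if A: "is_product K I X A a" and B: "is_product K I X B b"
      and m: "m \<in> Mor K A B" "\<forall>i\<in>I. compose (Und K A) (b i) m = a i"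
      and n: "n \<in> Mor K B A" "\<forall>i\<in>I. compose (Und K B) (a i) n = b i" for A B a b m n
  proof -
    have ob: "A \<in> Ob K" "B \<in> Ob K" using A B unfolding is_product_def by simp_all
    have mor: "\<forall>i\<in>I. a i \<in> Mor K A (X i)" "\<forall>i\<in>I. X i \<in> Ob K"
      using A unfolding is_product_def by simp_all
    have ex1: "\<exists>!h. h \<in> Mor K A A \<and> (\<forall>i\<in>I. compose (Und K A) (a i) h = a i)"
      by (rule univ[OF A ob(1) mor(1)])
    have "compose (Und K A) (a i) (compose (Und K A) n m) = a i" if "i \<in> I" for i
    proof -
      have "compose (Und K A) (a i) (compose (Und K A) n m) = compose (Und K A) (compose (Und K B) (a i) n) m"
        using Mor_in[OF ob m(1)] by (intro compose_compose) auto
      then show ?thesis using m(2) n(2) that by simp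
    qed
    moreover have "compose (Und K A) (a i) (\<lambda>x\<in>Und K A. x) = a i" if "i \<in> I" for i
      using Mor_PiE[OF ob(1) mor(2)[rule_format, OF that] mor(1)[rule_format, OF that]]
      by (intro compose_Id) (auto simp: PiE_iff)
    ultimately show ?thesis
      using ex1 Mor_compose[OF ob ob(1) m(1) n(1)] Mor_id[OF ob(1)] by blast
  qed
  obtain m where m: "m \<in> Mor K P Q" "\<forall>i\<in>I. compose (Und K P) (q i) m = p i" using 1[OF P Q] by blast
  obtain n where n: "n \<in> Mor K Q P" "\<forall>i\<in>I. compose (Und K Q) (p i) n = q i" using 1[OF Q P] by blast
  show ?thesis
    unfolding isomorphic_def using m(1) n(1) 2[OF P Q m n] 2[OF Q P n m] by blast
qed

text \<open>Tuples are functions and not elements of \<open>'u\<close>, so the carrier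
  \<open>A\<close> consists of codes with decoding maps \<open>p i\<close>; the bijection says that
  each tuple has exactly one code.\<close>

definition concrete_product :: "'u set \<Rightarrow> ('u \<Rightarrow> 'u uspace) \<Rightarrow> 'u set \<Rightarrow> ('u \<Rightarrow> 'u \<Rightarrow> 'u) \<Rightarrow> bool" where
  "concrete_product I X A p \<longleftrightarrow>
     small A \<and> (\<forall>i\<in>I. X i \<in> Ob_Unif \<and> p i \<in> A \<rightarrow>\<^sub>E points (X i)) \<and>
     bij_betw (\<lambda>a. \<lambda>i\<in>I. p i a) A (\<Pi>\<^sub>E i\<in>I. points (X i))"

lemma (in inaccessible_universe) ex_concrete_product:
  fixes I :: "'u set"
  assumes I: "small I" and X: "\<And>i. i \<in> I \<Longrightarrow> X i \<in> Ob_Unif"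
  obtains A p where "concrete_product I X A p"
proof -
  let ?P = "\<Pi>\<^sub>E i\<in>I. points (X i)"
  have "?P \<prec> (UNIV :: 'u set)" using small_PiE[OF I Ob_UnifD(2)[OF X]] .
  then obtain e :: "('u \<Rightarrow> 'u) \<Rightarrow> 'u" where e: "inj_on e ?P" "small (e ` ?P)" by (rule ex_encoding)
  let ?g = "inv_into ?P e"
  let ?p = "\<lambda>i. \<lambda>a\<in>e ` ?P. ?g a i"
  have g: "bij_betw ?g (e ` ?P) ?P" using bij_betw_inv_into[OF inj_on_imp_bij_betw[OF e(1)]] .
  have gP: "?g a \<in> ?P" if "a \<in> e ` ?P" for a using g that by (rule bij_betw_apply)
  have "(\<lambda>i\<in>I. ?p i a) = ?g a" if "a \<in> e ` ?P" for a
    using gP[OF that] that by (auto simp: fun_eq_iff PiE_iff extensional_def)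
  then have "bij_betw (\<lambda>a. \<lambda>i\<in>I. ?p i a) (e ` ?P) ?P"
    using g bij_betw_cong[of "e ` ?P" "\<lambda>a. \<lambda>i\<in>I. ?p i a" ?g] by simp
  moreover have "?p i \<in> e ` ?P \<rightarrow>\<^sub>E points (X i)" if "i \<in> I" for i
    using PiE_mem[OF gP that] by auto
  ultimately have "concrete_product I X (e ` ?P) ?p"
    unfolding concrete_product_def using e(2) X by blast
  then show ?thesis by (rule that)
qed

lemma concrete_productD:
  assumes "concrete_product I X A p"
  shows "initial_uspace A I X p \<in> Ob_Unif"
    and "\<And>i. i \<in> I \<Longrightarrow> is_uspace (X i)"
    and "\<And>i. i \<in> I \<Longrightarrow> p i \<in> A \<rightarrow> points (X i)"
    and "\<And>i. i \<in> I \<Longrightarrow> p i \<in> ucont_maps (initial_uspace A I X p) (X i)"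
    and "inj_on (\<lambda>a. \<lambda>i\<in>I. p i a) A"
    and "\<And>x. (\<And>i. i \<in> I \<Longrightarrow> x i \<in> points (X i)) \<Longrightarrow> \<exists>a\<in>A. \<forall>i\<in>I. p i a = x i"
proof -
  let ?P = "initial_uspace A I X p"
  show X: "is_uspace (X i)" if "i \<in> I" for i
    using assms that Ob_UnifD(1) unfolding concrete_product_def by blast
  show p: "p i \<in> A \<rightarrow> points (X i)" if "i \<in> I" for i
    using assms that unfolding concrete_product_def by blast
  have U: "is_uspace ?P" using is_uspace_initial[OF X p] .
  then show "?P \<in> Ob_Unif"
    using assms unfolding concrete_product_def Ob_Unif_def by simp
  show "p i \<in> ucont_maps ?P (X i)" if i: "i \<in> I" for i
  proof -
    have "filterlim (map_prod (p i) (p i)) (unif (X i)) (unif ?P)"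
      using ucont_id[OF U] restrict_ucont_initial_iff[OF U, of "\<lambda>x. x" A I X p] i by simp
    moreover have "(\<lambda>x\<in>A. p i x) = p i"
      using assms i unfolding concrete_product_def by (simp add: extensional_restrict PiE_iff)
    ultimately show ?thesis using restrict_ucont_iff[OF U, of "p i" "X i"] p[OF i] by simp
  qed
  have bij: "bij_betw (\<lambda>a. \<lambda>i\<in>I. p i a) A (\<Pi>\<^sub>E i\<in>I. points (X i))"
    using assms unfolding concrete_product_def by blast
  then show "inj_on (\<lambda>a. \<lambda>i\<in>I. p i a) A" by (rule bij_betw_imp_inj_on)
  fix x assume "\<And>i. i \<in> I \<Longrightarrow> x i \<in> points (X i)"
  then have "(\<lambda>i\<in>I. x i) \<in> (\<lambda>a. \<lambda>i\<in>I. p i a) ` A"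
    unfolding bij_betw_imp_surj_on[OF bij] by auto
  then obtain a where a: "a \<in> A" "(\<lambda>i\<in>I. x i) = (\<lambda>i\<in>I. p i a)" by blast
  have "p i a = x i" if "i \<in> I" for i using fun_cong[OF a(2), of i] that by simp
  then show "\<exists>a\<in>A. \<forall>i\<in>I. p i a = x i" using a(1) by blast
qed

lemma concrete_product_pairing:
  assumes P: "concrete_product I X A p" and Z: "is_uspace Z"
    and q: "\<And>i. i \<in> I \<Longrightarrow> q i \<in> ucont_maps Z (X i)"
  obtains h where "h \<in> ucont_maps Z (initial_uspace A I X p)"
    "\<And>i. i \<in> I \<Longrightarrow> compose (points Z) (p i) h = q i"
proof -
  have "\<exists>a\<in>A. \<forall>i\<in>I. p i a = q i z" if "z \<in> points Z" for z
    using concrete_productD(6)[OF P, of "\<lambda>i. q i z"] ucont_mapsD(3)[OF q that] by simp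
  then obtain h where h: "\<And>z. z \<in> points Z \<Longrightarrow> h z \<in> A" "\<And>z i. z \<in> points Z \<Longrightarrow> i \<in> I \<Longrightarrow> p i (h z) = q i z"
    by metis
  have "filterlim (map_prod (\<lambda>x. p i (h x)) (\<lambda>x. p i (h x))) (unif (X i)) (unif Z)" if i: "i \<in> I" for i
    using filterlim_map_prod_cong[OF Z, of "\<lambda>x. p i (h x)" "q i"] h(2)[OF _ i] ucont_mapsD(2)[OF q[OF i]] by simp
  then have "(\<lambda>z\<in>points Z. h z) \<in> ucont_maps Z (initial_uspace A I X p)"
    using h(1) by (subst restrict_ucont_initial_iff[OF Z]) auto
  moreover have "compose (points Z) (p i) (\<lambda>z\<in>points Z. h z) = q i" if "i \<in> I" for i
    using h(2)[OF _ that] ucont_mapsD(1)[OF q[OF that]]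
    by (auto simp: compose_def fun_eq_iff PiE_iff extensional_def)
  ultimately show ?thesis by (rule that)
qed

lemma concrete_product_is_product:
  assumes P: "concrete_product I X A p"
  shows "is_product Unif I X (initial_uspace A I X p) p"
  unfolding is_product_def Unif_simps
proof (intro conjI ballI allI impI)
  let ?P = "initial_uspace A I X p"
  show "?P \<in> Ob_Unif" using concrete_productD(1)[OF P] .
  show "X i \<in> Ob_Unif" if "i \<in> I" for i using P that unfolding concrete_product_def by blast
  show "p i \<in> ucont_maps ?P (X i)" if "i \<in> I" for i using concrete_productD(4)[OF P that] .
  fix Z q assume "Z \<in> Ob_Unif" and q: "\<forall>i\<in>I. q i \<in> ucont_maps Z (X i)"
  then have Z: "is_uspace Z" by (simp add: Ob_UnifD)
  obtain h where h: "h \<in> ucont_maps Z ?P" "\<And>i. i \<in> I \<Longrightarrow> compose (points Z) (p i) h = q i"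
    by (rule concrete_product_pairing[OF P Z]) (use q in auto)
  show "\<exists>!h. h \<in> ucont_maps Z ?P \<and> (\<forall>i\<in>I. compose (points Z) (p i) h = q i)"
  proof (rule ex1I[of _ h], intro conjI ballI h(1))
    fix g assume g: "g \<in> ucont_maps Z ?P \<and> (\<forall>i\<in>I. compose (points Z) (p i) g = q i)"
    have "g z = h z" if z: "z \<in> points Z" for z
    proof -
      have "p i (g z) = p i (h z)" if i: "i \<in> I" for i
      proof -
        have "compose (points Z) (p i) g z = compose (points Z) (p i) h z" using g h(2)[OF i] i by simp
        then show ?thesis using z by (simp add: compose_def)
      qed
      then have "(\<lambda>i\<in>I. p i (g z)) = (\<lambda>i\<in>I. p i (h z))" by auto
      then show ?thesis
        using inj_onD[OF concrete_productD(5)[OF P], of "g z" "h z"] ucont_mapsD(3)[of _ Z ?P] g h(1) z by auto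
    qed
    then show "g = h" using ucont_mapsD(1)[of g Z ?P] ucont_mapsD(1)[OF h(1)] g by (blast intro: PiE_ext)
  qed (use h(2) in auto)
qed

text \<open>Lets Tychonoff's theorem and the Hausdorff property be transferred from the product
  topology to the coded product.\<close>

lemma concrete_product_homeomorphic:
  assumes P: "concrete_product I X A p"
  shows "homeomorphic_map (utopology (initial_uspace A I X p)) (product_topology (\<lambda>i. utopology (X i)) I)
           (\<lambda>a. \<lambda>i\<in>I. p i a)"
proof -
  let ?P = "initial_uspace A I X p" and ?e = "\<lambda>a. \<lambda>i\<in>I. p i a"
  have U: "is_uspace ?P" using concrete_productD(1)[OF P] Ob_UnifD by blast
  note X = concrete_productD(2)[OF P]
  have top: "topspace (product_topology (\<lambda>i. utopology (X i)) I) = (\<Pi>\<^sub>E i\<in>I. points (X i))"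
    by (simp add: topspace_utopology[OF X] cong: PiE_cong)
  have bij: "bij_betw ?e A (\<Pi>\<^sub>E i\<in>I. points (X i))"
    using P unfolding concrete_product_def by blast
  let ?g = "inv_into A ?e"
  have inv: "?g (?e a) = a" if "a \<in> A" for a using inv_into_f_f[OF bij_betw_imp_inj_on[OF bij] that] .
  have inv': "?e (?g x) = x" if "x \<in> (\<Pi>\<^sub>E i\<in>I. points (X i))" for x
    using f_inv_into_f[of x ?e A] that unfolding bij_betw_imp_surj_on[OF bij] .
  have "continuous_map (utopology ?P) (product_topology (\<lambda>i. utopology (X i)) I) ?e"
    unfolding continuous_map_componentwise
    using ucont_continuous[OF U X concrete_productD(4)[OF P]] by auto
  moreover have "continuous_map (product_topology (\<lambda>i. utopology (X i)) I) (utopology ?P) ?g"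
  proof (subst continuous_map_initial_iff)
    show "is_uspace (X i)" "p i \<in> A \<rightarrow> points (X i)" if "i \<in> I" for i
      using X[OF that] concrete_productD(3)[OF P that] by simp_all
    show "?g \<in> topspace (product_topology (\<lambda>i. utopology (X i)) I) \<rightarrow> A \<and>
        (\<forall>i\<in>I. continuous_map (product_topology (\<lambda>i. utopology (X i)) I) (utopology (X i)) (\<lambda>t. p i (?g t)))"
  proof (intro conjI ballI)
    show "?g \<in> topspace (product_topology (\<lambda>i. utopology (X i)) I) \<rightarrow> A"
      unfolding top using bij_betw_apply[OF bij_betw_inv_into[OF bij]] by auto
    fix i assume i: "i \<in> I"
    have "p i (?g x) = x i" if "x \<in> (\<Pi>\<^sub>E i\<in>I. points (X i))" for x
      using fun_cong[OF inv'[OF that], of i] i by simp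
    then show "continuous_map (product_topology (\<lambda>i. utopology (X i)) I) (utopology (X i)) (\<lambda>x. p i (?g x))"
      using continuous_map_product_projection[OF i, of "\<lambda>i. utopology (X i)"]
      by (rule_tac continuous_map_eq[where f = "\<lambda>x. x i"]) (simp_all only: top)
  qed
  qed
  ultimately have "homeomorphic_maps (utopology ?P) (product_topology (\<lambda>i. utopology (X i)) I) ?e ?g"
    unfolding homeomorphic_maps_def top topspace_utopology[OF U] points_initial using inv inv' by blast
  then show ?thesis unfolding homeomorphic_map_maps by blast
qed

text \<open>Closure refers to every product cone in \<open>Unif\<close>; as products are unique up
  to isomorphism, the coded ones suffice.\<close>

lemma (in inaccessible_universe) closed_under_productsI:
  fixes C :: "'u uspace set"
  assumes C: "subcategory_of_Unif C"
    and *: "\<And>I X A p. \<lbrakk>small I; \<And>i. i \<in> I \<Longrightarrow> X i \<in> C; concrete_product I X A p\<rbrakk>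
      \<Longrightarrow> initial_uspace A I X p \<in> C"
  shows "closed_under_products C"
  unfolding closed_under_products_def
proof (intro allI impI)
  fix I :: "'u set" and X P p
  assume asm: "small I \<and> (\<forall>i\<in>I. X i \<in> C) \<and> is_product Unif I X P p"
  have "X i \<in> Ob_Unif" if "i \<in> I" for i using asm that C unfolding subcategory_of_Unif_def by blast
  then obtain A q where A: "concrete_product I X A q"
    using ex_concrete_product[of I X] asm by blast
  interpret Unif: concrete_cat Unif by (rule concrete_cat_Unif)
  have "isomorphic Unif (initial_uspace A I X q) P"
    using Unif.product_unique[OF concrete_product_is_product[OF A]] asm by blast
  moreover have "initial_uspace A I X q \<in> C" using *[of I X A q] asm A by blast
  moreover have "P \<in> Ob_Unif" using asm unfolding is_product_def by simp
  ultimately show "P \<in> C" using C unfolding subcategory_of_Unif_def by blast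
qed

lemma closed_under_productsD:
  assumes "closed_under_products C" "small I" "\<And>i. i \<in> I \<Longrightarrow> X i \<in> C" "concrete_product I X A p"
  shows "initial_uspace A I X p \<in> C"
  using assms concrete_product_is_product[OF assms(4)] unfolding closed_under_products_def by blast

text \<open>The homeomorphism lets closed subsets of the product topology be read as closed
  subspaces of \<open>P\<close>; its injectivity also yields uniqueness of the mediating
  map.\<close>

definition binary_product :: "'u uspace \<Rightarrow> 'u uspace \<Rightarrow> 'u uspace \<Rightarrow> ('u \<Rightarrow> 'u) \<Rightarrow> ('u \<Rightarrow> 'u) \<Rightarrow> bool" where
  "binary_product X Y P p q \<longleftrightarrow> P \<in> Ob_Unif \<and> p \<in> ucont_maps P X \<and> q \<in> ucont_maps P Y \<and>
     homeomorphic_map (utopology P) (prod_topology (utopology X) (utopology Y)) (\<lambda>z. (p z, q z)) \<and>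
     (\<forall>Z a b. is_uspace Z \<longrightarrow> a \<in> ucont_maps Z X \<longrightarrow> b \<in> ucont_maps Z Y \<longrightarrow>
       (\<exists>m\<in>ucont_maps Z P. compose (points Z) p m = a \<and> compose (points Z) q m = b))"

lemma (in inaccessible_universe) ex_binary_product:
  fixes C :: "'u uspace set"
  assumes C: "C \<subseteq> Ob_Unif" "closed_under_products C" and X: "X \<in> C" and Y: "Y \<in> C"
  obtains P p q where "P \<in> C" "binary_product X Y P p q"
proof -
  obtain a b :: 'u where ab: "a \<noteq> b"
    using infinite_universe by (metis (full_types) ex_new_if_finite finite.emptyI finite_insert insertI1)
  let ?I = "{a, b}" and ?X = "\<lambda>i. if i = a then X else Y"
  have I: "small ?I" using small_finite[of ?I] by (simp add: small_def)
  have XC: "?X i \<in> C" for i using X Y by simp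
  then have "?X i \<in> Ob_Unif" for i using C(1) by blast
  then obtain A p where P: "concrete_product ?I ?X A p" using ex_concrete_product[OF I, of ?X] by blast
  let ?P = "initial_uspace A ?I ?X p"
  have PC: "?P \<in> C" using closed_under_productsD[OF C(2) I XC P] .
  have "binary_product X Y ?P (p a) (p b)"
    unfolding binary_product_def
  proof (intro conjI allI impI)
    show "?P \<in> Ob_Unif" using concrete_productD(1)[OF P] .
    then have U: "is_uspace ?P" by (rule Ob_UnifD)
    have uX: "is_uspace X" "is_uspace Y" using concrete_productD(2)[OF P, of a] concrete_productD(2)[OF P, of b] ab by auto
    show pa: "p a \<in> ucont_maps ?P X" using concrete_productD(4)[OF P, of a] by simp
    show pb: "p b \<in> ucont_maps ?P Y" using concrete_productD(4)[OF P, of b] ab by simp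
    have surj: "\<exists>z\<in>A. p a z = x \<and> p b z = y" if "x \<in> points X" "y \<in> points Y" for x y
      using concrete_productD(6)[OF P, of "\<lambda>i. if i = a then x else y"] that ab by auto
    have inj: "z = w" if "z \<in> A" "w \<in> A" "p a z = p a w" "p b z = p b w" for z w
      using inj_onD[OF concrete_productD(5)[OF P], of z w] that by (auto simp: fun_eq_iff)
    define g where "g xy = (SOME z. z \<in> A \<and> p a z = fst xy \<and> p b z = snd xy)" for xy
    have g: "g (x, y) \<in> A \<and> p a (g (x, y)) = x \<and> p b (g (x, y)) = y" if "x \<in> points X" "y \<in> points Y" for x y
    proof -
      have "\<exists>z. z \<in> A \<and> p a z = fst (x, y) \<and> p b z = snd (x, y)" using surj[OF that] by auto
      from someI_ex[OF this] show ?thesis unfolding g_def[symmetric] by simp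
    qed
    have pr: "p a z \<in> points X" "p b z \<in> points Y" if "z \<in> A" for z
      using ucont_mapsD(3)[OF pa] ucont_mapsD(3)[OF pb] that by auto
    have "continuous_map (utopology ?P) (prod_topology (utopology X) (utopology Y)) (\<lambda>z. (p a z, p b z))"
      using ucont_continuous[OF U uX(1) pa] ucont_continuous[OF U uX(2) pb] by (simp add: continuous_map_paired)
    moreover have "continuous_map (prod_topology (utopology X) (utopology Y)) (utopology ?P) g"
    proof (subst continuous_map_initial_iff)
      show "is_uspace (?X i)" "p i \<in> A \<rightarrow> points (?X i)" if "i \<in> ?I" for i
        using concrete_productD(2,3)[OF P that] by simp_all
      show "g \<in> topspace (prod_topology (utopology X) (utopology Y)) \<rightarrow> A \<and>
        (\<forall>i\<in>?I. continuous_map (prod_topology (utopology X) (utopology Y)) (utopology (?X i)) (\<lambda>t. p i (g t)))"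
    proof (intro conjI ballI)
      show "g \<in> topspace (prod_topology (utopology X) (utopology Y)) \<rightarrow> A"
        using g uX by (auto simp: topspace_utopology)
      fix i assume "i \<in> ?I"
      then consider "i = a" | "i = b" "i \<noteq> a" using ab by blast
      then show "continuous_map (prod_topology (utopology X) (utopology Y)) (utopology (?X i)) (\<lambda>t. p i (g t))"
      proof cases
        case 1
        have "continuous_map (prod_topology (utopology X) (utopology Y)) (utopology X) (\<lambda>t. p a (g t))"
          by (rule continuous_map_eq[OF continuous_map_fst]) (use g uX in \<open>auto simp: topspace_utopology\<close>)
        then show ?thesis using 1 by simp
      next
        case 2
        have "continuous_map (prod_topology (utopology X) (utopology Y)) (utopology Y) (\<lambda>t. p b (g t))"
          by (rule continuous_map_eq[OF continuous_map_snd]) (use g uX in \<open>auto simp: topspace_utopology\<close>)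
        then show ?thesis using 2 by simp
      qed
    qed
    qed
    moreover have "g (p a z, p b z) = z" if "z \<in> A" for z
      using inj[OF _ that] g[OF pr[OF that]] by blast
    ultimately have "homeomorphic_maps (utopology ?P) (prod_topology (utopology X) (utopology Y)) (\<lambda>z. (p a z, p b z)) g"
      unfolding homeomorphic_maps_def using g uX by (auto simp: topspace_utopology topspace_utopology[OF U])
    then show "homeomorphic_map (utopology ?P) (prod_topology (utopology X) (utopology Y)) (\<lambda>z. (p a z, p b z))"
      unfolding homeomorphic_map_maps by blast
    fix Z f h assume Z: "is_uspace Z" and f: "f \<in> ucont_maps Z X" and h: "h \<in> ucont_maps Z Y"
    obtain m where m: "m \<in> ucont_maps Z ?P" "\<And>i. i \<in> ?I \<Longrightarrow> compose (points Z) (p i) m = (if i = a then f else h)"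
      by (rule concrete_product_pairing[OF P Z, of "\<lambda>i. if i = a then f else h"]) (use f h in auto)
    then show "\<exists>m\<in>ucont_maps Z ?P. compose (points Z) (p a) m = f \<and> compose (points Z) (p b) m = h"
      using m(2)[of a] m(2)[of b] m(1) ab by (intro bexI[of _ m]) auto
  qed
  then show ?thesis using that PC by blast
qed


section \<open>Compact uniform spaces\<close>

text \<open>For a uniform topology, separating points by entourages already gives disjoint
  neighbourhoods: slices of a symmetric half of an entourage that omits \<open>(x, y)\<close> cannot
  meet.\<close>

lemma Hausdorff_utopology_iff:
  assumes X: "is_uspace X"
  shows "Hausdorff_space (utopology X) \<longleftrightarrow>
    (\<forall>x\<in>points X. \<forall>y\<in>points X. x \<noteq> y \<longrightarrow> (\<exists>E. eventually E (unif X) \<and> \<not> E (x, y)))"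
proof (intro iffI ballI impI)
  fix x y assume H: "Hausdorff_space (utopology X)" and x: "x \<in> points X" and y: "y \<in> points X" and "x \<noteq> y"
  then obtain S S' where S: "openin (utopology X) S" "x \<in> S" and "y \<in> S'" "disjnt S S'"
    unfolding Hausdorff_space_def topspace_utopology[OF X] by blast
  then have "y \<notin> S" by (auto simp: disjnt_iff)
  moreover have "eventually (\<lambda>(x', y). x' = x \<longrightarrow> y \<in> S) (unif X)"
    using S by (simp add: openin_utopology)
  ultimately show "\<exists>E. eventually E (unif X) \<and> \<not> E (x, y)"
    by (intro exI[of _ "\<lambda>(x', y). x' = x \<longrightarrow> y \<in> S"]) simp
next
  assume sep: "\<forall>x\<in>points X. \<forall>y\<in>points X. x \<noteq> y \<longrightarrow> (\<exists>E. eventually E (unif X) \<and> \<not> E (x, y))"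
  show "Hausdorff_space (utopology X)"
    unfolding Hausdorff_space_def topspace_utopology[OF X]
  proof (intro allI impI)
    fix x y assume "x \<in> points X \<and> y \<in> points X \<and> x \<noteq> y"
    then have x: "x \<in> points X" and y: "y \<in> points X" and "x \<noteq> y" by auto
    then obtain E where E: "eventually E (unif X)" "\<not> E (x, y)" using sep by blast
    obtain D where D: "eventually D (unif X)" "\<And>x y z. D (x, y) \<Longrightarrow> D (y, z) \<Longrightarrow> E (x, z)"
      "\<And>x y. D (x, y) \<Longrightarrow> D (y, x)" using unif_symtrans[OF X E(1)] by blast
    obtain S where S: "openin (utopology X) S" "x \<in> S" "\<And>z. z \<in> S \<Longrightarrow> D (x, z)"
      using ex_open_nhd[OF X x D(1)] by blast
    obtain T where T: "openin (utopology X) T" "y \<in> T" "\<And>z. z \<in> T \<Longrightarrow> D (y, z)"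
      using ex_open_nhd[OF X y D(1)] by blast
    have "z \<notin> T" if "z \<in> S" for z using D(2)[OF S(3)[OF that] D(3)[OF T(3)]] E(2) by blast
    then have "disjnt S T" by (auto simp: disjnt_iff)
    with S(1,2) T(1,2)
    show "\<exists>S T. openin (utopology X) S \<and> openin (utopology X) T \<and> x \<in> S \<and> y \<in> T \<and> disjnt S T" by blast
  qed
qed

text \<open>The Heine-Cantor theorem, with finitely many local entourages intersected.\<close>

lemma compact_continuous_ucont:
  assumes X: "is_uspace X" and Y: "is_uspace Y" and comp: "compact_space (utopology X)"
    and f: "continuous_map (utopology X) (utopology Y) f"
  shows "(\<lambda>x\<in>points X. f x) \<in> ucont_maps X Y"
proof (subst restrict_ucont_iff[OF X], intro conjI)
  show fXY: "f \<in> points X \<rightarrow> points Y"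
    using continuous_map_funspace[OF f] by (simp add: topspace_utopology[OF X] topspace_utopology[OF Y])
  show "filterlim (map_prod f f) (unif Y) (unif X)"
    unfolding filterlim_iff
  proof (intro allI impI)
    fix E assume E: "eventually E (unif Y)"
    obtain D where D: "eventually D (unif Y)" "\<And>x y z. D (x, y) \<Longrightarrow> D (y, z) \<Longrightarrow> E (x, z)"
      "\<And>x y. D (x, y) \<Longrightarrow> D (y, x)" using unif_symtrans[OF Y E] by blast
    \<comment> \<open>\<open>S\<close> is so small a neighbourhood of \<open>x\<close> that even the
      points \<open>W\<close>-close to a point of \<open>S\<close> have images
      \<open>D\<close>-close to \<open>f x\<close>.\<close>
    have "\<exists>W S. eventually W (unif X) \<and> openin (utopology X) S \<and> x \<in> S \<and>
        (\<forall>y z. y \<in> S \<longrightarrow> W (y, z) \<longrightarrow> D (f x, f y) \<and> D (f x, f z))" if x: "x \<in> points X" for x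
    proof -
      have fx: "f x \<in> points Y" using fXY x by auto
      have "eventually (\<lambda>w. D (f x, w)) (nhdsin (utopology Y) (f x))"
        unfolding nhdsin_utopology[OF Y fx] eventually_filtercomap_Pair
        using D(1) by eventually_elim auto
      then have "eventually (\<lambda>w. D (f x, f w)) (nhdsin (utopology X) x)"
        using f x unfolding continuous_map_iff_nhdsin topspace_utopology[OF X] filterlim_iff by blast
      then have V: "eventually (\<lambda>(x', y). x' = x \<longrightarrow> D (f x, f y)) (unif X)"
        unfolding nhdsin_utopology[OF X x] eventually_filtercomap_Pair .
      obtain W where W: "eventually W (unif X)"
        "\<And>a b c. W (a, b) \<Longrightarrow> W (b, c) \<Longrightarrow> case (a, c) of (x', y) \<Rightarrow> x' = x \<longrightarrow> D (f x, f y)"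
        "\<And>a b. W (a, b) \<Longrightarrow> case (a, b) of (x', y) \<Rightarrow> x' = x \<longrightarrow> D (f x, f y)"
        using unif_symtrans[OF X V] by blast
      obtain S where S: "openin (utopology X) S" "x \<in> S" "\<And>y. y \<in> S \<Longrightarrow> W (x, y)"
        using ex_open_nhd[OF X x W(1)] by blast
      have "D (f x, f y) \<and> D (f x, f z)" if "y \<in> S" "W (y, z)" for y z
        using W(3)[OF S(3)[OF that(1)]] W(2)[OF S(3)[OF that(1)] that(2)] by simp
      with W(1) S(1,2) show ?thesis by blast
    qed
    then obtain W S where WS: "\<And>x. x \<in> points X \<Longrightarrow> eventually (W x) (unif X)"
      "\<And>x. x \<in> points X \<Longrightarrow> openin (utopology X) (S x)" "\<And>x. x \<in> points X \<Longrightarrow> x \<in> S x"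
      "\<And>x y z. \<lbrakk>x \<in> points X; y \<in> S x; W x (y, z)\<rbrakk> \<Longrightarrow> D (f x, f y) \<and> D (f x, f z)"
      by metis
    have "(\<forall>U\<in>S ` points X. openin (utopology X) U) \<and> topspace (utopology X) \<subseteq> \<Union>(S ` points X)"
      using WS(2,3) by (auto simp: topspace_utopology[OF X])
    then obtain \<F> where "finite \<F>" "\<F> \<subseteq> S ` points X" "topspace (utopology X) \<subseteq> \<Union>\<F>"
      using comp[unfolded compact_space_alt, rule_format, of "S ` points X"] by blast
    then obtain F where F: "F \<subseteq> points X" "finite F" "points X \<subseteq> (\<Union>x\<in>F. S x)"
      by (metis finite_subset_image topspace_utopology[OF X])
    have "eventually (\<lambda>z. \<forall>x\<in>F. W x z) (unif X)"
      using F(1,2) WS(1) by (subst eventually_ball_finite_distrib) auto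
    then show "eventually (\<lambda>z. E (map_prod f f z)) (unif X)"
      using unif_points[OF X]
    proof eventually_elim
      case (elim p)
      obtain y z where p: "p = (y, z)" by force
      then obtain x where x: "x \<in> F" "y \<in> S x" using F(3) elim(2) by blast
      then have "D (f x, f y)" "D (f x, f z)" using WS(4)[of x y z] F(1) elim(1) p by auto
      then have "E (f y, f z)" using D(2)[OF D(3)] by blast
      then show ?case using p by simp
    qed
  qed
qed

text \<open>The only uniformity compatible with a compact Hausdorff topology.\<close>

definition diagonal_uspace :: "'a topology \<Rightarrow> 'a uspace" where
  "diagonal_uspace T = \<lparr>points = topspace T,
     unif = (INF W\<in>{W. openin (prod_topology T T) W \<and> (\<forall>x\<in>topspace T. (x, x) \<in> W)}. principal W)\<rparr>"

lemma points_diagonal [simp]: "points (diagonal_uspace T) = topspace T"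
  by (simp add: diagonal_uspace_def)

lemma eventually_diagonal:
  "eventually E (unif (diagonal_uspace T)) \<longleftrightarrow>
     (\<exists>W. openin (prod_topology T T) W \<and> (\<forall>x\<in>topspace T. (x, x) \<in> W) \<and> (\<forall>z\<in>W. E z))"
proof -
  let ?\<W> = "{W. openin (prod_topology T T) W \<and> (\<forall>x\<in>topspace T. (x, x) \<in> W)}"
  have "topspace T \<times> topspace T \<in> ?\<W>" by (simp add: openin_prod_Times_iff)
  then have ne: "?\<W> \<noteq> {}" by blast
  have "eventually E (INF W\<in>?\<W>. principal W) \<longleftrightarrow> (\<exists>W\<in>?\<W>. eventually E (principal W))"
  proof (rule eventually_INF_base[OF ne])
    fix A B assume "A \<in> ?\<W>" "B \<in> ?\<W>"
    then show "\<exists>W\<in>?\<W>. principal W \<le> inf (principal A) (principal B)"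
      by (intro bexI[of _ "A \<inter> B"]) auto
  qed
  then show ?thesis by (auto simp: diagonal_uspace_def eventually_principal)
qed

text \<open>Supplies the halving axiom for neighbourhoods of the diagonal. Squares inside
  \<open>W\<close> are shrunk by regularity to closed sets \<open>C x\<close> inside
  \<open>O' x\<close>; \<open>V\<close> forbids, for finitely many \<open>x\<close>, pairs with one
  entry in \<open>C x\<close> and the other outside \<open>O' x\<close>. A middle point
  \<open>y\<close> in some \<open>C a\<close> then forces both ends into
  \<open>O' a\<close>.\<close>

lemma compact_Hausdorff_diagonal_half:
  assumes comp: "compact_space T" and H: "Hausdorff_space T"
    and W: "openin (prod_topology T T) W" "\<forall>x\<in>topspace T. (x, x) \<in> W"
  shows "\<exists>V. openin (prod_topology T T) V \<and> (\<forall>x\<in>topspace T. (x, x) \<in> V) \<and>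
    (\<forall>x y z. (x, y) \<in> V \<longrightarrow> (y, z) \<in> V \<longrightarrow> (x, z) \<in> W)"
proof -
  have reg: "regular_space T" using comp H compact_Hausdorff_imp_regular_space by blast
  have "\<exists>O' N C. openin T O' \<and> O' \<times> O' \<subseteq> W \<and> openin T N \<and> x \<in> N \<and> closedin T C \<and> N \<subseteq> C \<and> C \<subseteq> O'"
    if x: "x \<in> topspace T" for x
  proof -
    obtain A B where AB: "openin T A" "openin T B" "x \<in> A" "x \<in> B" "A \<times> B \<subseteq> W"
      using W(1)[unfolded openin_prod_topology_alt, rule_format, of x x] W(2) x by blast
    then have "closedin T (topspace T - A \<inter> B)" "x \<in> topspace T - (topspace T - A \<inter> B)"
      using x by (auto intro: closedin_diff)
    then obtain N M where N: "openin T N" "openin T M" "x \<in> N" "topspace T - A \<inter> B \<subseteq> M" "disjnt N M"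
      using reg[unfolded regular_space_def, rule_format, of "topspace T - A \<inter> B" x] by blast
    have "openin T (A \<inter> B)" "closedin T (topspace T - M)" "N \<subseteq> topspace T - M" "topspace T - M \<subseteq> A \<inter> B"
      using AB(1,2) N(2,4,5) openin_subset[OF N(1)] by (auto simp: disjnt_iff intro: closedin_diff)
    moreover have "(A \<inter> B) \<times> (A \<inter> B) \<subseteq> W" using AB(5) by blast
    ultimately show ?thesis using N(1,3) by (intro exI[of _ "A \<inter> B"] exI[of _ N] exI[of _ "topspace T - M"]) simp
  qed
  then obtain O' N C where ONC: "\<And>x. x \<in> topspace T \<Longrightarrow> openin T (O' x) \<and> O' x \<times> O' x \<subseteq> W \<and>
      openin T (N x) \<and> x \<in> N x \<and> closedin T (C x) \<and> N x \<subseteq> C x \<and> C x \<subseteq> O' x"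
    by metis
  have "(\<forall>U\<in>N ` topspace T. openin T U) \<and> topspace T \<subseteq> \<Union>(N ` topspace T)"
    using ONC by blast
  then obtain \<F> where "finite \<F>" "\<F> \<subseteq> N ` topspace T" "topspace T \<subseteq> \<Union>\<F>"
    using comp[unfolded compact_space_alt, rule_format, of "N ` topspace T"] by blast
  then obtain F where F: "F \<subseteq> topspace T" "finite F" "topspace T \<subseteq> (\<Union>x\<in>F. N x)"
    by (metis finite_subset_image)
  define B where "B x = C x \<times> (topspace T - O' x) \<union> (topspace T - O' x) \<times> C x" for x
  define V where "V = topspace T \<times> topspace T - (\<Union>x\<in>F. B x)"
  have "closedin (prod_topology T T) (B x)" if "x \<in> F" for x
  proof -
    have "closedin T (C x)" and "openin T (O' x)" using ONC[of x] F(1) that by blast+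
    moreover have "closedin T (topspace T - O' x)"
      using closedin_diff[OF closedin_topspace \<open>openin T (O' x)\<close>] .
    ultimately show ?thesis unfolding B_def by (intro closedin_Un) (simp_all add: closedin_prod_Times_iff)
  qed
  then have "closedin (prod_topology T T) (\<Union>(B ` F))"
    using F(2) by (intro closedin_Union) auto
  then have "openin (prod_topology T T) V"
    unfolding V_def by (intro openin_diff) (auto simp: openin_prod_Times_iff)
  moreover have "\<forall>x\<in>topspace T. (x, x) \<in> V"
    using ONC F(1) unfolding V_def B_def by blast
  moreover have "(x, z) \<in> W" if xy: "(x, y) \<in> V" and yz: "(y, z) \<in> V" for x y z
  proof -
    have pts: "x \<in> topspace T" "y \<in> topspace T" "z \<in> topspace T" using xy yz unfolding V_def by auto
    then obtain a where a: "a \<in> F" "y \<in> N a" using F(3) by blast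
    then have ay: "y \<in> C a" using ONC[of a] F(1) by blast
    have "(x, y) \<notin> B a" "(y, z) \<notin> B a" using xy yz a(1) unfolding V_def by auto
    then have "x \<in> O' a" "z \<in> O' a" using ay pts unfolding B_def by auto
    then show ?thesis using ONC[of a] F(1) a(1) by blast
  qed
  ultimately show ?thesis by blast
qed

lemma is_uspace_diagonal:
  assumes comp: "compact_space T" and H: "Hausdorff_space T"
  shows "is_uspace (diagonal_uspace T)"
  unfolding is_uspace_def points_diagonal
proof (intro conjI allI impI)
  show "unif (diagonal_uspace T) \<le> principal (topspace T \<times> topspace T)"
    unfolding le_principal eventually_diagonal
    by (intro exI[of _ "topspace T \<times> topspace T"]) (auto simp: openin_prod_Times_iff)
next
  fix E assume "eventually E (unif (diagonal_uspace T))"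
  then obtain W where W: "openin (prod_topology T T) W" "\<forall>x\<in>topspace T. (x, x) \<in> W" "\<forall>z\<in>W. E z"
    unfolding eventually_diagonal by blast
  show "\<forall>x\<in>topspace T. E (x, x)" using W(2,3) by blast
  have "openin (prod_topology T T) {z \<in> topspace (prod_topology T T). prod.swap z \<in> W}"
    using openin_continuous_map_preimage[OF _ W(1), of "prod_topology T T" prod.swap]
    by (simp add: continuous_map_pairwise comp_def continuous_map_fst continuous_map_snd)
  then show "eventually (\<lambda>(x, y). E (y, x)) (unif (diagonal_uspace T))"
    unfolding eventually_diagonal using W(2,3)
    by (intro exI[of _ "{z \<in> topspace (prod_topology T T). prod.swap z \<in> W}"]) auto
  obtain V where V: "openin (prod_topology T T) V" "\<forall>x\<in>topspace T. (x, x) \<in> V"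
    "\<And>x y z. (x, y) \<in> V \<Longrightarrow> (y, z) \<in> V \<Longrightarrow> (x, z) \<in> W"
    using compact_Hausdorff_diagonal_half[OF comp H W(1,2)] by blast
  have "eventually (\<lambda>z. z \<in> V) (unif (diagonal_uspace T))"
    unfolding eventually_diagonal using V(1,2) by blast
  then show "\<exists>D. eventually D (unif (diagonal_uspace T)) \<and> (\<forall>x y z. D (x, y) \<longrightarrow> D (y, z) \<longrightarrow> E (x, z))"
    using V(3) W(3) by (intro exI[of _ "\<lambda>z. z \<in> V"]) auto
qed

lemma utopology_diagonal:
  assumes H: "Hausdorff_space T"
  shows "utopology (diagonal_uspace T) = T"
proof (rule topology_eq[THEN iffD2], intro allI iffI)
  fix S assume S: "openin T S"
  have sub: "S \<subseteq> topspace T" using openin_subset[OF S] .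
  have "eventually (\<lambda>(x', y). x' = x \<longrightarrow> y \<in> S) (unif (diagonal_uspace T))" if x: "x \<in> S" for x
  proof -
    \<comment> \<open>A neighbourhood of the diagonal whose slice at \<open>x\<close> is exactly
      \<open>S\<close>; it is open because points are closed.\<close>
    let ?W = "S \<times> S \<union> (topspace T - {x}) \<times> topspace T"
    have "openin T (topspace T - {x})"
      using Hausdorff_imp_t1_space[OF H] by (simp add: t1_space_openin_delete_alt)
    then have "openin (prod_topology T T) ?W"
      using S by (intro openin_Un) (auto simp: openin_prod_Times_iff)
    then show ?thesis unfolding eventually_diagonal using x sub by (intro exI[of _ ?W]) auto
  qed
  then show "openin (utopology (diagonal_uspace T)) S" unfolding openin_utopology using sub by simp
next
  fix S assume S: "openin (utopology (diagonal_uspace T)) S"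
  then have sub: "S \<subseteq> topspace T" unfolding openin_utopology by simp
  show "openin T S"
  proof (subst openin_subopen, intro ballI)
    fix x assume x: "x \<in> S"
    then obtain W where W: "openin (prod_topology T T) W" "\<forall>x\<in>topspace T. (x, x) \<in> W"
      "\<forall>z\<in>W. case z of (x', y) \<Rightarrow> x' = x \<longrightarrow> y \<in> S"
      using S unfolding openin_utopology eventually_diagonal by meson
    have "continuous_map T (prod_topology T T) (\<lambda>y. (x, y))"
      using x sub by (simp add: continuous_map_paired) (auto simp: continuous_map_const continuous_map_id[unfolded id_def])
    from openin_continuous_map_preimage[OF this W(1)]
    show "\<exists>O'. openin T O' \<and> x \<in> O' \<and> O' \<subseteq> S"
      using W(2,3) x sub by (intro exI[of _ "{y \<in> topspace T. (x, y) \<in> W}"]) auto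
  qed
qed

text \<open>A continuous surjection from a compact to a Hausdorff space is a quotient map, so the
  factor is continuous; its domain is compact as an image, and Heine-Cantor makes it uniformly
  continuous.\<close>

lemma compact_factor:
  assumes X: "is_uspace X" and Y: "is_uspace Y" and W: "is_uspace W"
    and comp: "compact_space (utopology X)" and H: "Hausdorff_space (utopology Y)"
    and h: "h \<in> ucont_maps X Y" "h ` points X = points Y" and k: "k \<in> ucont_maps X W"
    and ker: "\<And>x y. \<lbrakk>x \<in> points X; y \<in> points X; h x = h y\<rbrakk> \<Longrightarrow> k x = k y"
  shows "\<exists>m\<in>ucont_maps Y W. compose (points X) m h = k"
proof -
  note top = topspace_utopology[OF X] topspace_utopology[OF Y] topspace_utopology[OF W]
  have ch: "continuous_map (utopology X) (utopology Y) h" using ucont_continuous[OF X Y h(1)] .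
  have ck: "continuous_map (utopology X) (utopology W) k" using ucont_continuous[OF X W k] .
  have q: "quotient_map (utopology X) (utopology Y) h"
    using T1_Spaces.continuous_imp_quotient_map[OF ch comp H] h(2) by (simp add: top)
  have "\<exists>g. continuous_map (utopology Y) (utopology W) g \<and> (\<forall>x\<in>points X. g (h x) = k x)"
  proof (rule quotient_map_lift_exists[OF q ck])
    fix x y assume "x \<in> topspace (utopology X)" "y \<in> topspace (utopology X)" "h x = h y"
    then show "k x = k y" unfolding top by (rule ker)
  next
    fix g assume "continuous_map (utopology Y) (utopology W) g"
      "\<And>x. x \<in> topspace (utopology X) \<Longrightarrow> g (h x) = k x"
    then show ?thesis unfolding top by blast
  qed
  then obtain g where g: "continuous_map (utopology Y) (utopology W) g" "\<And>x. x \<in> points X \<Longrightarrow> g (h x) = k x"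
    by blast
  have "compactin (utopology Y) (h ` topspace (utopology X))"
    using image_compactin[OF _ ch] comp unfolding compact_space_def by blast
  then have "compact_space (utopology Y)" using h(2) by (simp add: top compact_space_def)
  then have "(\<lambda>y\<in>points Y. g y) \<in> ucont_maps Y W" using compact_continuous_ucont[OF Y W _ g(1)] by blast
  moreover have "compose (points X) (\<lambda>y\<in>points Y. g y) h = k"
    using g(2) ucont_mapsD(3)[OF h(1)] ucont_mapsD(1)[OF k]
    by (auto simp: compose_def fun_eq_iff PiE_iff extensional_def)
  ultimately show ?thesis by blast
qed

lemma compact_Hausdorff_iso:
  assumes X: "is_uspace X" and Y: "is_uspace Y"
    and comp: "compact_space (utopology X)" and H: "Hausdorff_space (utopology Y)"
    and h: "h \<in> ucont_maps X Y" "h ` points X = points Y" "inj_on h (points X)"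
  shows "isomorphic Unif X Y"
proof -
  have "\<exists>m\<in>ucont_maps Y X. compose (points X) m h = (\<lambda>x\<in>points X. x)"
  proof (rule compact_factor[OF X Y X comp H h(1,2) ucont_id[OF X]])
    fix x y assume "x \<in> points X" "y \<in> points X" "h x = h y"
    then show "(\<lambda>x\<in>points X. x) x = (\<lambda>x\<in>points X. x) y" using inj_onD[OF h(3)] by simp
  qed
  then obtain m where m: "m \<in> ucont_maps Y X" "compose (points X) m h = (\<lambda>x\<in>points X. x)"
    by blast
  have mh: "m (h x) = x" if "x \<in> points X" for x
    using fun_cong[OF m(2), of x] that by (simp add: compose_def)
  have hm: "h (m y) = y" if "y \<in> points Y" for y
  proof -
    have "y \<in> h ` points X" unfolding h(2) using that .
    then show ?thesis using mh by (metis imageE)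
  qed
  show ?thesis by (rule isomorphic_UnifI[OF X Y h(1) m(1) mh hm])
qed

text \<open>The quotient map is closed, so the quotient inherits the Hausdorff property from the
  normal space \<open>X\<close>; its unique compatible uniformity is then
  \<open>diagonal_uspace\<close>.\<close>

lemma (in inaccessible_universe) compact_quotient:
  fixes X :: "'u uspace"
  assumes X: "X \<in> Ob_Unif" "compact_T2 X" and E: "equiv (points X) E"
    and cl: "closedin (prod_topology (utopology X) (utopology X)) E"
  shows "\<exists>Q\<in>Ob_Unif. compact_T2 Q \<and> (\<exists>h\<in>ucont_maps X Q. h ` points X = points Q \<and>
    (\<forall>x\<in>points X. \<forall>y\<in>points X. h x = h y \<longleftrightarrow> (x, y) \<in> E))"
proof -
  let ?T = "utopology X"
  have U: "is_uspace X" using X(1) by (rule Ob_UnifD)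
  note top = topspace_utopology[OF U]
  have comp: "compact_space ?T" and H: "Hausdorff_space ?T" using X(2) unfolding compact_T2_def by auto
  define \<rho> where "\<rho> x = (SOME y. y \<in> E `` {x})" for x
  have sub: "E \<subseteq> points X \<times> points X" using E by (simp add: equiv_type)
  have \<rho>E: "(x, \<rho> x) \<in> E" if "x \<in> points X" for x
  proof -
    have "x \<in> E `` {x}" using equiv_class_self[OF E that] .
    from someI[of "\<lambda>y. y \<in> E `` {x}", OF this] show ?thesis by (simp add: \<rho>_def)
  qed
  have \<rho>eq: "\<rho> x = \<rho> y \<longleftrightarrow> (x, y) \<in> E" if "x \<in> points X" "y \<in> points X" for x y
  proof
    assume "\<rho> x = \<rho> y"
    then show "(x, y) \<in> E" using \<rho>E[OF that(1)] \<rho>E[OF that(2)] E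
      by (metis equivE symE transE)
  next
    assume "(x, y) \<in> E"
    then show "\<rho> x = \<rho> y" using equiv_class_eq[OF E] by (simp add: \<rho>_def)
  qed
  have \<rho>X: "\<rho> ` points X \<subseteq> points X" using \<rho>E sub by auto
  \<comment> \<open>The quotient topology, placed on the representatives so that the carrier remains
    a subset of \<open>points X\<close>.\<close>
  define op where "op S \<longleftrightarrow> S \<subseteq> \<rho> ` points X \<and> openin ?T {x \<in> points X. \<rho> x \<in> S}" for S
  have "istopology op"
    unfolding istopology_def
  proof (intro conjI allI impI)
    fix S S' assume "op S" "op S'"
    moreover have "{x \<in> points X. \<rho> x \<in> S \<inter> S'} = {x \<in> points X. \<rho> x \<in> S} \<inter> {x \<in> points X. \<rho> x \<in> S'}" by blast
    ultimately show "op (S \<inter> S')" unfolding op_def by auto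
  next
    fix \<K> assume "\<forall>S\<in>\<K>. op S"
    moreover have "{x \<in> points X. \<rho> x \<in> \<Union>\<K>} = (\<Union>S\<in>\<K>. {x \<in> points X. \<rho> x \<in> S})" by blast
    ultimately show "op (\<Union>\<K>)" unfolding op_def by auto
  qed
  then have openin_Q: "openin (topology op) S \<longleftrightarrow> op S" for S by (simp add: topology_inverse')
  let ?Q = "topology op"
  have "{x \<in> points X. \<rho> x \<in> \<rho> ` points X} = points X" by blast
  then have "op (\<rho> ` points X)" unfolding op_def using openin_topspace[of ?T] top by simp
  then have topQ: "topspace ?Q = \<rho> ` points X"
    using openin_subset[of ?Q "\<rho> ` points X"] openin_topspace[of ?Q] unfolding openin_Q op_def by blast
  have cont: "continuous_map ?T ?Q \<rho>"
    unfolding continuous_map_def topQ openin_Q top op_def by auto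
  have "closed_map ?T ?Q \<rho>"
    unfolding closed_map_def
  proof (intro allI impI)
    fix F assume F: "closedin ?T F"
    have FX: "F \<subseteq> points X" using closedin_subset[OF F] top by simp
    \<comment> \<open>The saturation of \<open>F\<close> is the projection of the part of
      \<open>E\<close> lying over \<open>F\<close>, and projection along a compact factor is a
      closed map.\<close>
    have "closedin (prod_topology ?T ?T) (F \<times> points X)"
      using F closedin_topspace[of ?T] by (simp add: closedin_prod_Times_iff top)
    then have "closedin (prod_topology ?T ?T) (E \<inter> F \<times> points X)" using cl by (intro closedin_Int)
    then have "closedin ?T (snd ` (E \<inter> F \<times> points X))"
      using Abstract_Topological_Spaces.closed_map_snd[OF comp] unfolding closed_map_def by blast
    moreover have "snd ` (E \<inter> F \<times> points X) = {x \<in> points X. \<rho> x \<in> \<rho> ` F}"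
    proof (intro set_eqI iffI)
      fix y assume "y \<in> snd ` (E \<inter> F \<times> points X)"
      then obtain x where "x \<in> F" "(x, y) \<in> E" "y \<in> points X" by auto
      then have "\<rho> x = \<rho> y" using \<rho>eq FX by blast
      then show "y \<in> {x \<in> points X. \<rho> x \<in> \<rho> ` F}" using \<open>x \<in> F\<close> \<open>y \<in> points X\<close> by (metis (mono_tags, lifting) imageI mem_Collect_eq)
    next
      fix y assume "y \<in> {x \<in> points X. \<rho> x \<in> \<rho> ` F}"
      then obtain x where x: "y \<in> points X" "x \<in> F" "\<rho> y = \<rho> x" by blast
      then have "(x, y) \<in> E" using \<rho>eq[of x y] FX by auto
      then show "y \<in> snd ` (E \<inter> F \<times> points X)" using x by force
    qed
    ultimately have "openin ?T (points X - {x \<in> points X. \<rho> x \<in> \<rho> ` F})"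
      by (metis openin_diff openin_topspace top)
    moreover have "points X - {x \<in> points X. \<rho> x \<in> \<rho> ` F} = {x \<in> points X. \<rho> x \<in> \<rho> ` points X - \<rho> ` F}" by blast
    ultimately have "openin ?Q (\<rho> ` points X - \<rho> ` F)" unfolding openin_Q op_def by auto
    moreover have "\<rho> ` F \<subseteq> topspace ?Q" using FX topQ by auto
    ultimately show "closedin ?Q (\<rho> ` F)" unfolding closedin_def topQ by blast
  qed
  moreover have surj: "\<rho> ` topspace ?T = topspace ?Q" by (simp add: topQ top)
  moreover have "normal_space ?T" using comp H compact_Hausdorff_or_regular_imp_normal_space by blast
  ultimately have HQ: "Hausdorff_space ?Q"
    using normal_Hausdorff_space_closed_continuous_map_image[of ?T ?Q \<rho>] H cont by blast
  have "compactin ?Q (\<rho> ` topspace ?T)"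
    using image_compactin[OF _ cont] comp unfolding compact_space_def by blast
  then have compQ: "compact_space ?Q" unfolding surj compact_space_def .
  let ?U = "diagonal_uspace ?Q"
  have UQ: "is_uspace ?U" using is_uspace_diagonal[OF compQ HQ] .
  have "(\<lambda>x\<in>points X. \<rho> x) \<in> ucont_maps X ?U"
    using compact_continuous_ucont[OF U UQ comp] cont unfolding utopology_diagonal[OF HQ] by blast
  moreover have "compact_T2 ?U" unfolding compact_T2_def utopology_diagonal[OF HQ] using compQ HQ by simp
  moreover have "small (\<rho> ` points X)"
    using small_subset[OF _ \<rho>X] X(1) by (simp add: Ob_Unif_def)
  then have "?U \<in> Ob_Unif" unfolding Ob_Unif_def using UQ by (simp add: topQ)
  moreover have "(\<lambda>x\<in>points X. \<rho> x) ` points X = points ?U" by (simp add: topQ)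
  moreover have "\<forall>x\<in>points X. \<forall>y\<in>points X.
      (\<lambda>x\<in>points X. \<rho> x) x = (\<lambda>x\<in>points X. \<rho> x) y \<longleftrightarrow> (x, y) \<in> E" using \<rho>eq by simp
  ultimately show ?thesis by (intro bexI[of _ ?U] conjI bexI[of _ "\<lambda>x\<in>points X. \<rho> x"])
qed


section \<open>The category of compact Hausdorff spaces\<close>

lemma closedin_graph_rel:
  assumes X: "is_uspace X" and W: "is_uspace W" "Hausdorff_space (utopology W)" and k: "k \<in> ucont_maps X W"
  shows "closedin (prod_topology (utopology X) (utopology X)) {(x, y) \<in> points X \<times> points X. k x = k y}"
proof -
  let ?P = "prod_topology (utopology X) (utopology X)"
  have c: "continuous_map (utopology X) (utopology W) k" using ucont_continuous[OF X W(1) k] .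
  have 1: "continuous_map ?P (utopology W) (\<lambda>z. k (fst z))"
    using continuous_map_compose[OF continuous_map_fst c] by (simp add: comp_def)
  have 2: "continuous_map ?P (utopology W) (\<lambda>z. k (snd z))"
    using continuous_map_compose[OF continuous_map_snd c] by (simp add: comp_def)
  have "{(x, y) \<in> points X \<times> points X. k x = k y} = {z \<in> topspace ?P. k (fst z) = k (snd z)}"
    by (auto simp: topspace_utopology[OF X])
  then show ?thesis using closedin_continuous_maps_eq[OF W(2) 1 2] by simp
qed

context inaccessible_universe
begin

abbreviation compact_spaces :: "'u uspace set" where
  "compact_spaces \<equiv> {X \<in> Ob_Unif. compact_T2 X}"

lemma closed_subspaceD:
  fixes C :: "'u uspace set"
  assumes "C \<subseteq> Ob_Unif" "closed_under_closed_subspaces C" "X \<in> C" "closedin (utopology X) S"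
  shows "usubspace X S \<in> C" "S \<subseteq> points X" "is_uspace (usubspace X S)"
    "utopology (usubspace X S) = subtopology (utopology X) S"
proof -
  have X: "is_uspace X" using assms Ob_UnifD by blast
  show "usubspace X S \<in> C" using assms unfolding closed_under_closed_subspaces_def by blast
  show S: "S \<subseteq> points X" using closedin_subset[OF assms(4)] topspace_utopology[OF X] by simp
  show "is_uspace (usubspace X S)" "utopology (usubspace X S) = subtopology (utopology X) S"
    using is_uspace_usubspace[OF X S] utopology_usubspace[OF X S] by blast+
qed

text \<open>The preimage of the relation in the coded square is a closed subspace. This provides
  kernel pairs both for compact spaces and for an arbitrary class with these two closure
  properties.\<close>

lemma closed_relation_object:
  fixes C :: "'u uspace set"
  assumes C: "C \<subseteq> Ob_Unif" "closed_under_products C" "closed_under_closed_subspaces C" and X: "X \<in> C"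
    and E: "closedin (prod_topology (utopology X) (utopology X)) E"
  shows "\<exists>R\<in>C. \<exists>p\<in>ucont_maps R X. \<exists>q\<in>ucont_maps R X.
    inj_on (\<lambda>r. (p r, q r)) (points R) \<and> (\<lambda>r. (p r, q r)) ` points R = E"
proof -
  obtain P p q where P: "P \<in> C" "binary_product X X P p q" by (rule ex_binary_product[OF C(1,2) X X])
  have UP: "is_uspace P" and UX: "is_uspace X" using P(1) X C(1) Ob_UnifD by blast+
  have p: "p \<in> ucont_maps P X" and q: "q \<in> ucont_maps P X"
    and hom: "homeomorphic_map (utopology P) (prod_topology (utopology X) (utopology X)) (\<lambda>z. (p z, q z))"
    using P(2) unfolding binary_product_def by simp_all
  let ?S = "{z \<in> points P. (p z, q z) \<in> E}"
  have S: "closedin (utopology P) ?S"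
    using closedin_continuous_map_preimage[OF homeomorphic_imp_continuous_map[OF hom] E]
    by (simp add: topspace_utopology[OF UP])
  note sub = closed_subspaceD[OF C(1,3) P(1) S]
  let ?R = "usubspace P ?S"
  have inc: "(\<lambda>x\<in>?S. x) \<in> ucont_maps ?R P" using ucont_inclusion[OF UP sub(2)] .
  have res: "compose ?S f (\<lambda>x\<in>?S. x) = (\<lambda>x\<in>?S. f x)" for f :: "'u \<Rightarrow> 'u" by (auto simp: compose_def)
  have pq: "(\<lambda>x\<in>?S. p x) \<in> ucont_maps ?R X" "(\<lambda>x\<in>?S. q x) \<in> ucont_maps ?R X"
    using ucont_compose[OF sub(3) inc p] ucont_compose[OF sub(3) inc q] unfolding points_usubspace res .
  have "inj_on (\<lambda>z. (p z, q z)) ?S"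
    using homeomorphic_imp_injective_map[OF hom] by (rule inj_on_subset) (auto simp: topspace_utopology[OF UP])
  then have inj: "inj_on (\<lambda>r. ((\<lambda>x\<in>?S. p x) r, (\<lambda>x\<in>?S. q x) r)) (points ?R)"
    by (subst inj_on_cong[of _ _ "\<lambda>z. (p z, q z)"]) simp_all
  have surj: "(\<lambda>z. (p z, q z)) ` points P = points X \<times> points X"
    using homeomorphic_imp_surjective_map[OF hom] by (simp add: topspace_utopology[OF UP] topspace_utopology[OF UX])
  have EX: "E \<subseteq> points X \<times> points X" using closedin_subset[OF E] by (simp add: topspace_utopology[OF UX])
  have "E \<subseteq> (\<lambda>z. (p z, q z)) ` ?S"
  proof
    fix e assume e: "e \<in> E"
    then have "e \<in> (\<lambda>z. (p z, q z)) ` points P" unfolding surj using EX by blast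
    then obtain z where "z \<in> points P" "e = (p z, q z)" by (rule imageE)
    then show "e \<in> (\<lambda>z. (p z, q z)) ` ?S" using e by (intro image_eqI[of _ _ z]) simp_all
  qed
  then have im: "(\<lambda>r. ((\<lambda>x\<in>?S. p x) r, (\<lambda>x\<in>?S. q x) r)) ` points ?R = E"
    by (subst image_cong[OF refl, of _ _ "\<lambda>z. (p z, q z)"]) auto
  show ?thesis
    using sub(1) pq inj im
    by (intro bexI[of _ ?R] bexI[of _ "\<lambda>x\<in>?S. p x"] bexI[of _ "\<lambda>x\<in>?S. q x"] conjI)
qed

lemma compact_spaces_products:
  assumes P: "concrete_product I X A p" and X: "\<And>i. i \<in> I \<Longrightarrow> X i \<in> compact_spaces"
  shows "initial_uspace A I X p \<in> compact_spaces"
proof -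
  have "compact_space (product_topology (\<lambda>i. utopology (X i)) I)"
    "Hausdorff_space (product_topology (\<lambda>i. utopology (X i)) I)"
    using X by (auto simp: compact_space_product_topology Hausdorff_space_product_topology compact_T2_def)
  moreover have "utopology (initial_uspace A I X p) homeomorphic_space product_topology (\<lambda>i. utopology (X i)) I"
    using homeomorphic_map_imp_homeomorphic_space[OF concrete_product_homeomorphic[OF P]] .
  ultimately have "compact_T2 (initial_uspace A I X p)"
    unfolding compact_T2_def by (simp add: homeomorphic_compact_space homeomorphic_Hausdorff_space)
  then show ?thesis using concrete_productD(1)[OF P] by simp
qed

lemma compact_spaces_closed_subspaces: "closed_under_closed_subspaces compact_spaces"
  unfolding closed_under_closed_subspaces_def
proof (intro ballI allI impI)
  fix X :: "'u uspace" and S assume X: "X \<in> compact_spaces" and S: "closedin (utopology X) S"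
  have U: "is_uspace X" using X Ob_UnifD by blast
  have sub: "S \<subseteq> points X" using closedin_subset[OF S] topspace_utopology[OF U] by simp
  have "compact_space (utopology X)" "Hausdorff_space (utopology X)" using X by (auto simp: compact_T2_def)
  then have "compact_T2 (usubspace X S)"
    unfolding compact_T2_def utopology_usubspace[OF U sub]
    using closedin_compact_space[OF _ S] compact_space_subtopology Hausdorff_space_subtopology by blast
  moreover have "usubspace X S \<in> Ob_Unif"
    using is_uspace_usubspace[OF U sub] small_subset[OF _ sub] X by (simp add: Ob_Unif_def)
  ultimately show "usubspace X S \<in> compact_spaces" by simp
qed

lemma compact_spaces_subcategory: "subcategory_of_Unif compact_spaces"
  unfolding subcategory_of_Unif_def
proof (intro conjI ballI impI)
  fix X Y :: "'u uspace"
  assume X: "X \<in> compact_spaces" and Y: "Y \<in> Ob_Unif" and XY: "isomorphic Unif X Y"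
  obtain f g where fg: "f \<in> ucont_maps X Y" "g \<in> ucont_maps Y X"
    "\<forall>x\<in>points X. g (f x) = x" "\<forall>y\<in>points Y. f (g y) = y"
    using isomorphic_UnifD[OF XY] by blast
  have UY: "is_uspace Y" using Y by (rule Ob_UnifD)
  have UX: "is_uspace X" using X Ob_UnifD(1) by blast
  have "homeomorphic_maps (utopology X) (utopology Y) f g"
    unfolding homeomorphic_maps_def topspace_utopology[OF UX] topspace_utopology[OF UY]
    using ucont_continuous[OF UX UY fg(1)] ucont_continuous[OF UY UX fg(2)] fg(3,4) by blast
  then have "utopology X homeomorphic_space utopology Y" unfolding homeomorphic_space_def by blast
  then have "compact_T2 Y"
    using X homeomorphic_compact_space homeomorphic_Hausdorff_space unfolding compact_T2_def by blast
  then show "Y \<in> compact_spaces" using Y by blast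
qed blast

lemma compact_spaces_exact: "exact_cat (full_subcat compact_spaces)"
proof -
  let ?C = "compact_spaces"
  let ?K = "full_subcat ?C"
  have CU: "?C \<subseteq> Ob_Unif" by blast
  interpret concrete_cat "full_subcat ?C" by (rule concrete_cat_full_subcat[OF CU])
  have u: "is_uspace X" and c: "compact_space (utopology X)" and H: "Hausdorff_space (utopology X)"
    if "X \<in> ?C" for X using that Ob_UnifD(1) by (auto simp: compact_T2_def)
  \<comment> \<open>Continuous maps from compact to Hausdorff spaces are closed, so relations given
    by pairs of morphisms are closed.\<close>
  have im: "closedin (prod_topology (utopology X) (utopology X)) ((\<lambda>r. (p r, q r)) ` F)"
    if R: "R \<in> ?C" and X: "X \<in> ?C" and p: "p \<in> ucont_maps R X" and q: "q \<in> ucont_maps R X"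
      and F: "closedin (utopology R) F" for R X p q F
  proof -
    have "continuous_map (utopology R) (prod_topology (utopology X) (utopology X)) (\<lambda>r. (p r, q r))"
      using ucont_continuous[OF u[OF R] u[OF X] p] ucont_continuous[OF u[OF R] u[OF X] q]
      by (simp add: continuous_map_paired)
    moreover have "Hausdorff_space (prod_topology (utopology X) (utopology X))"
      using H[OF X] by (simp add: Hausdorff_space_prod_topology)
    ultimately have "closed_map (utopology R) (prod_topology (utopology X) (utopology X)) (\<lambda>r. (p r, q r))"
      using T1_Spaces.continuous_imp_closed_map c[OF R] by blast
    then show ?thesis using F unfolding closed_map_def by blast
  qed
  have cP: "closed_under_products ?C"
    by (rule closed_under_productsI[OF compact_spaces_subcategory]) (rule compact_spaces_products)
  show ?thesis
  proof unfold_locales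
    fix X Y W h k
    assume "X \<in> Ob ?K" "Y \<in> Ob ?K" "W \<in> Ob ?K"
      and "h \<in> Mor ?K X Y" "h ` Und ?K X = Und ?K Y"
      and "k \<in> Mor ?K X W"
      and ker: "\<And>x y. \<lbrakk>x \<in> Und ?K X; y \<in> Und ?K X; h x = h y\<rbrakk> \<Longrightarrow> k x = k y"
    then have X: "X \<in> ?C" and Y: "Y \<in> ?C" and W: "W \<in> ?C" and h: "h \<in> ucont_maps X Y" "h ` points X = points Y"
      and k: "k \<in> ucont_maps X W" unfolding full_subcat_simps by blast+
    show "\<exists>m\<in>Mor ?K Y W. compose (Und ?K X) m h = k"
      using compact_factor[OF u[OF X] u[OF Y] u[OF W] c[OF X] H[OF Y] h k ker[unfolded full_subcat_simps]]
      unfolding full_subcat_simps .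
  next
    fix X Y h
    assume "X \<in> Ob ?K" "Y \<in> Ob ?K" "h \<in> Mor ?K X Y"
    then have X: "X \<in> ?C" and Y: "Y \<in> ?C" and h: "h \<in> ucont_maps X Y" unfolding full_subcat_simps by blast+
    from closed_relation_object[OF CU cP compact_spaces_closed_subspaces X closedin_graph_rel[OF u[OF X] u[OF Y] H[OF Y] h]]
    show "\<exists>R\<in>Ob ?K. \<exists>p\<in>Mor ?K R X. \<exists>q\<in>Mor ?K R X.
            (\<lambda>r. (p r, q r)) ` Und ?K R =
            {(x, y) \<in> Und ?K X \<times> Und ?K X. h x = h y}"
      unfolding full_subcat_simps by (elim bexE conjE) (rule bexI, rule bexI, rule bexI)
  next
    fix R X Z p q a b
    assume "R \<in> Ob ?K" "X \<in> Ob ?K" "Z \<in> Ob ?K"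
      "p \<in> Mor ?K R X" "q \<in> Mor ?K R X"
      "inj_on (\<lambda>r. (p r, q r)) (Und ?K R)"
      "a \<in> Mor ?K Z X" "b \<in> Mor ?K Z X"
      and "\<And>z. z \<in> Und ?K Z \<Longrightarrow> \<exists>r\<in>Und ?K R. p r = a z \<and> q r = b z"
    note asm = this[unfolded full_subcat_simps]
    note R = asm(1) and X = asm(2) and Z = asm(3) and p = asm(4) and q = asm(5) and inj = asm(6)
      and a = asm(7) and b = asm(8)
    obtain m where m: "\<And>z. z \<in> points Z \<Longrightarrow> m z \<in> points R \<and> p (m z) = a z \<and> q (m z) = b z"
      using asm(9) by metis
    \<comment> \<open>By joint injectivity of \<open>p\<close> and \<open>q\<close>, the preimage of
      \<open>F\<close> under \<open>m\<close> is the preimage, under the pair of \<open>a\<close>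
      and \<open>b\<close>, of the closed image of \<open>F\<close> under the pair of
      \<open>p\<close> and \<open>q\<close>.\<close>
    have "continuous_map (utopology Z) (utopology R) m"
      unfolding continuous_map_closedin topspace_utopology[OF u[OF Z]] topspace_utopology[OF u[OF R]]
    proof (intro conjI allI impI)
      show "m \<in> points Z \<rightarrow> points R" using m by blast
      fix F assume F: "closedin (utopology R) F"
      have FR: "F \<subseteq> points R" using closedin_subset[OF F] by (simp add: topspace_utopology[OF u[OF R]])
      have "continuous_map (utopology Z) (prod_topology (utopology X) (utopology X)) (\<lambda>z. (a z, b z))"
        using ucont_continuous[OF u[OF Z] u[OF X] a] ucont_continuous[OF u[OF Z] u[OF X] b]
        by (simp add: continuous_map_paired)
      from closedin_continuous_map_preimage[OF this im[OF R X p q F]]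
      have "closedin (utopology Z) {z \<in> points Z. (a z, b z) \<in> (\<lambda>r. (p r, q r)) ` F}"
        by (simp add: topspace_utopology[OF u[OF Z]])
      moreover have "(a z, b z) \<in> (\<lambda>r. (p r, q r)) ` F \<longleftrightarrow> m z \<in> F" if z: "z \<in> points Z" for z
      proof
        assume "(a z, b z) \<in> (\<lambda>r. (p r, q r)) ` F"
        then obtain r where r: "r \<in> F" "a z = p r" "b z = q r" by blast
        then have "m z = r" using inj_onD[OF inj, of "m z" r] m[OF z] FR by auto
        then show "m z \<in> F" using r(1) by simp
      next
        assume "m z \<in> F"
        then show "(a z, b z) \<in> (\<lambda>r. (p r, q r)) ` F" using m[OF z] by (intro image_eqI[of _ _ "m z"]) auto
      qed
      ultimately show "closedin (utopology Z) {z \<in> points Z. m z \<in> F}" by (simp cong: conj_cong)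
    qed
    then have "(\<lambda>z\<in>points Z. m z) \<in> ucont_maps Z R"
      using compact_continuous_ucont[OF u[OF Z] u[OF R] c[OF Z]] by blast
    moreover have "compose (points Z) p (\<lambda>z\<in>points Z. m z) = a" "compose (points Z) q (\<lambda>z\<in>points Z. m z) = b"
      using m ucont_mapsD(1)[OF a] ucont_mapsD(1)[OF b]
      by (auto simp: compose_def fun_eq_iff PiE_iff extensional_def)
    ultimately show "\<exists>m\<in>Mor ?K Z R. compose (Und ?K Z) p m = a \<and>
        compose (Und ?K Z) q m = b"
      unfolding full_subcat_simps by blast
  next
    fix X :: "'u uspace" and M :: "('u uspace \<times> ('u \<Rightarrow> 'u)) set"
    assume "X \<in> Ob ?K"
      and "\<And>W k. (W, k) \<in> M \<Longrightarrow> W \<in> Ob ?K \<and> k \<in> Mor ?K X W"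
    then have X: "X \<in> ?C" and M: "\<And>W k. (W, k) \<in> M \<Longrightarrow> W \<in> ?C \<and> k \<in> ucont_maps X W"
      unfolding full_subcat_simps by blast+
    let ?k = "\<lambda>Wk. {(x, y) \<in> points X \<times> points X. snd Wk x = snd Wk y}"
    \<comment> \<open>The full relation is inserted so that an empty \<open>M\<close> does not give
      the intersection of no sets.\<close>
    let ?E = "\<Inter>(insert (points X \<times> points X) (?k ` M))"
    have E: "(x, y) \<in> ?E \<longleftrightarrow> x \<in> points X \<and> y \<in> points X \<and> (\<forall>W k. (W, k) \<in> M \<longrightarrow> k x = k y)" for x y
      by force
    have "equiv (points X) ?E"
    proof (rule equivI)
      show "?E \<subseteq> points X \<times> points X" by blast
      show "refl_on (points X) ?E" by (rule refl_onI) (use E in auto)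
      show "sym ?E" by (rule symI) (unfold E, metis)
      show "trans ?E" by (rule transI) (unfold E, metis)
    qed
    moreover have "closedin (prod_topology (utopology X) (utopology X)) ?E"
    proof (rule closedin_Inter)
      fix S assume "S \<in> insert (points X \<times> points X) (?k ` M)"
      then consider "S = points X \<times> points X" | Wk where "Wk \<in> M" "S = ?k Wk" by blast
      then show "closedin (prod_topology (utopology X) (utopology X)) S"
      proof cases
        case 1
        have "closedin (utopology X) (points X)"
          using closedin_topspace[of "utopology X"] topspace_utopology[OF u[OF X]] by simp
        then show ?thesis using 1 by (simp add: closedin_prod_Times_iff)
      next
        case 2
        have "fst Wk \<in> ?C" "snd Wk \<in> ucont_maps X (fst Wk)"
          using M[of "fst Wk" "snd Wk"] 2(1) by simp_all
        then show ?thesis unfolding 2(2) using closedin_graph_rel[OF u[OF X] u H] by blast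
      qed
    qed blast
    ultimately obtain Q h where "Q \<in> ?C" "h \<in> ucont_maps X Q" "h ` points X = points Q"
      and "\<forall>x\<in>points X. \<forall>y\<in>points X. h x = h y \<longleftrightarrow> (x, y) \<in> ?E"
      using compact_quotient[of X ?E] X by blast
    then show "\<exists>Q\<in>Ob ?K. \<exists>h\<in>Mor ?K X Q. h ` Und ?K X = Und ?K Q \<and>
      (\<forall>x\<in>Und ?K X. \<forall>y\<in>Und ?K X. h x = h y \<longleftrightarrow> (\<forall>W k. (W, k) \<in> M \<longrightarrow> k x = k y))"
      unfolding full_subcat_simps E by (intro bexI[of _ Q] bexI[of _ h] conjI) simp_all
  next
    fix R X p q
    assume "R \<in> Ob ?K" "X \<in> Ob ?K"
      "p \<in> Mor ?K R X" "q \<in> Mor ?K R X"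
      "concrete_congruence (Und ?K R) (Und ?K X) p q"
    note asm = this[unfolded full_subcat_simps concrete_congruence_def]
    let ?E = "(\<lambda>r. (p r, q r)) ` points R"
    have "closedin (utopology R) (points R)"
      using closedin_topspace[of "utopology R"] topspace_utopology[OF u[OF asm(1)]] by simp
    then have "closedin (prod_topology (utopology X) (utopology X)) ?E" by (rule im[OF asm(1-4)])
    moreover have "X \<in> Ob_Unif" "compact_T2 X" "equiv (points X) ?E" using asm(2,5) by blast+
    ultimately obtain Q h where "Q \<in> ?C" "h \<in> ucont_maps X Q" "h ` points X = points Q"
      and "\<forall>x\<in>points X. \<forall>y\<in>points X. h x = h y \<longleftrightarrow> (x, y) \<in> ?E"
      using compact_quotient[of X ?E] by blast
    moreover have "(x, y) \<in> ?E \<longleftrightarrow> (\<exists>r\<in>points R. p r = x \<and> q r = y)" for x y by auto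
    ultimately show "\<exists>Q\<in>Ob ?K. \<exists>h\<in>Mor ?K X Q. h ` Und ?K X = Und ?K Q \<and>
      (\<forall>x\<in>Und ?K X. \<forall>y\<in>Und ?K X. h x = h y \<longleftrightarrow> (\<exists>r\<in>Und ?K R. p r = x \<and> q r = y))"
      unfolding full_subcat_simps by (intro bexI[of _ Q] bexI[of _ h] conjI) simp_all
  next
    fix X Y f g Q h
    assume "X \<in> Ob ?K" and Y': "Y \<in> Ob ?K"
      and coeq: "is_coequalizer ?K X Y f g Q h"
    have Y: "Y \<in> ?C" using Y' unfolding full_subcat_simps .
    have Q: "Q \<in> ?C" and h: "h \<in> ucont_maps Y Q"
      using coeq unfolding is_coequalizer_def full_subcat_simps by simp_all
    have ch: "continuous_map (utopology Y) (utopology Q) h" using ucont_continuous[OF u[OF Y] u[OF Q] h] .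
    let ?S = "h ` points Y"
    \<comment> \<open>The image is closed and hence an object, through which the coequalizer must
      factor.\<close>
    have S: "closedin (utopology Q) ?S"
      using T1_Spaces.continuous_imp_closed_map[OF ch c[OF Y] H[OF Q]] closedin_topspace[of "utopology Y"]
      unfolding closed_map_def topspace_utopology[OF u[OF Y]] by blast
    note sub = closed_subspaceD[OF CU compact_spaces_closed_subspaces Q S]
    have "h \<in> ucont_maps Y (usubspace Q ?S)"
      using h by (subst ucont_usubspace_iff[OF u[OF Y] sub(2)]) simp
    moreover have "(\<lambda>x\<in>?S. x) \<in> ucont_maps (usubspace Q ?S) Q" using ucont_inclusion[OF u[OF Q] sub(2)] .
    ultimately show "h ` Und ?K Y = Und ?K Q"
      using coequalizer_surj[OF Y' _ coeq, of "usubspace Q ?S"] sub(1) by simp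
  qed
qed

end


section \<open>Two-point spaces and free compact Hausdorff spaces\<close>

lemma finite_Hausdorff_discrete:
  assumes "is_uspace X" "finite (points X)" "Hausdorff_space (utopology X)"
  shows "utopology X = discrete_topology (points X)"
  using finite_t1_space_imp_discrete_topology[OF topspace_utopology[OF assms(1)] assms(2)]
    Hausdorff_imp_t1_space[OF assms(3)] .

definition two_point :: "'u uspace \<Rightarrow> 'u \<Rightarrow> 'u \<Rightarrow> bool" where
  "two_point D c d \<longleftrightarrow> D \<in> Ob_Unif \<and> Hausdorff_space (utopology D) \<and> points D = {c, d} \<and> c \<noteq> d"

lemma two_pointD:
  assumes "two_point D c d"
  shows "D \<in> Ob_Unif" "is_uspace D" "Hausdorff_space (utopology D)" "points D = {c, d}" "c \<noteq> d"
    "utopology D = discrete_topology {c, d}" "compact_T2 D"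
proof -
  show 1: "D \<in> Ob_Unif" "Hausdorff_space (utopology D)" "points D = {c, d}" "c \<noteq> d"
    using assms unfolding two_point_def by simp_all
  show 2: "is_uspace D" using 1(1) by (rule Ob_UnifD)
  show 3: "utopology D = discrete_topology {c, d}" using finite_Hausdorff_discrete[OF 2 _ 1(2)] 1(3) by simp
  show "compact_T2 D" unfolding compact_T2_def using 1(2) 3 by (simp add: compact_space_discrete_topology)
qed

lemma small_points: "X \<in> Ob_Unif \<Longrightarrow> small (points X)"
  by (rule Ob_UnifD)

context inaccessible_universe
begin

lemma ex_two_point: "\<exists>(D :: 'u uspace) c d. two_point D c d"
proof -
  obtain c d :: 'u where cd: "c \<noteq> d"
    using infinite_universe by (metis (full_types) ex_new_if_finite finite.emptyI finite_insert insertI1)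
  let ?T = "discrete_topology {c, d}"
  have T: "compact_space ?T" "Hausdorff_space ?T" by (simp_all add: compact_space_discrete_topology)
  have "small {c, d}" using small_finite[of "{c, d}"] by (simp add: small_def)
  then have "two_point (diagonal_uspace ?T) c d"
    unfolding two_point_def Ob_Unif_def using is_uspace_diagonal[OF T] utopology_diagonal[OF T(2)] T(2) cd by simp
  then show ?thesis by blast
qed

text \<open>The free compact Hausdorff space on \<open>S\<close> is the closure of \<open>S\<close> in the power of the two-point space indexed
  by the subsets of \<open>S\<close>. The extension of a map from \<open>S\<close> to \<open>X\<close> is obtained from the closure of its graph.\<close>

lemma universal_arrow_compact:
  fixes D :: "'u uspace" and S :: "'u set"
  assumes D: "two_point D c d" and code: "inj_on code (Pow S)"
    and P: "concrete_product (code ` Pow S) (\<lambda>_. D) A p"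
  defines "K \<equiv> initial_uspace A (code ` Pow S) (\<lambda>_. D) p"
  shows "\<exists>F e. closedin (utopology K) F \<and> universal_arrow (full_subcat compact_spaces) S (usubspace K F) e"
proof -
  let ?C = compact_spaces and ?I = "code ` Pow S"
  note D' = two_pointD[OF D]
  have CU: "?C \<subseteq> Ob_Unif" by blast
  have KC: "K \<in> ?C" unfolding K_def by (rule compact_spaces_products[OF P]) (use D' in simp)
  have UK: "is_uspace K" using KC Ob_UnifD(1) by blast
  have KH: "Hausdorff_space (utopology K)" and Kc: "compact_space (utopology K)" using KC by (auto simp: compact_T2_def)
  have ptsK: "points K = A" by (simp add: K_def)
  have pK: "p i \<in> ucont_maps K D" if "i \<in> ?I" for i using concrete_productD(4)[OF P that] unfolding K_def .
  \<comment> \<open>The point \<open>t\<close> is represented by its principal ultrafilter, written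
    as a two-valued function on \<open>Pow S\<close> with \<open>d\<close> for membership.\<close>
  have "\<exists>a\<in>A. \<forall>T\<in>Pow S. p (code T) a = (if t \<in> T then d else c)" for t
  proof -
    have "\<exists>a\<in>A. \<forall>i\<in>?I. p i a = (if t \<in> inv_into (Pow S) code i then d else c)"
      by (rule concrete_productD(6)[OF P]) (simp add: D')
    then obtain a where a: "a \<in> A" "\<forall>i\<in>?I. p i a = (if t \<in> inv_into (Pow S) code i then d else c)" by blast
    have "p (code T) a = (if t \<in> T then d else c)" if "T \<in> Pow S" for T
      using a(2)[rule_format, OF imageI[OF that, of code]] inv_into_f_f[OF code that] by simp
    then show ?thesis using a(1) by blast
  qed
  then obtain e where e: "\<And>t. e t \<in> A" "\<And>t T. T \<in> Pow S \<Longrightarrow> p (code T) (e t) = (if t \<in> T then d else c)"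
    by metis
  let ?F = "utopology K closure_of (e ` S)"
  have eS: "e ` S \<subseteq> topspace (utopology K)" using e(1) by (auto simp: topspace_utopology[OF UK] ptsK)
  have F: "closedin (utopology K) ?F" by (rule closedin_closure_of)
  have eF: "e ` S \<subseteq> ?F" by (rule closure_of_subset[OF eS])
  note sub = closed_subspaceD[OF CU compact_spaces_closed_subspaces KC F]
  let ?B = "usubspace K ?F"
  have BH: "Hausdorff_space (utopology ?B)" using sub(1) by (simp add: compact_T2_def)
  have topB: "topspace (utopology ?B) = ?F" using topspace_utopology[OF sub(3)] by simp
  have dense: "utopology ?B closure_of (e ` S) = ?F"
    unfolding sub(4) closure_of_subtopology_open using eF
    by (simp add: closure_of_subtopology inf.absorb2 inf.absorb1)
  have ext: "\<exists>m\<in>ucont_maps ?B X. \<forall>t\<in>S. m (e t) = s t" if X: "X \<in> ?C" and s: "s \<in> S \<rightarrow> points X" for X s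
  proof -
    have UX: "is_uspace X" using X Ob_UnifD(1) by blast
    have XH: "Hausdorff_space (utopology X)" using X by (auto simp: compact_T2_def)
    have cP: "closed_under_products ?C"
    proof (rule closed_under_productsI[OF compact_spaces_subcategory])
      fix I X A p assume "\<And>i. i \<in> I \<Longrightarrow> X i \<in> ?C" "concrete_product I X A p"
      then show "initial_uspace A I X p \<in> ?C" by (intro compact_spaces_products)
    qed
    obtain Q q r where Q: "Q \<in> ?C" "binary_product K X Q q r" by (rule ex_binary_product[OF CU cP KC X])
    have UQ: "is_uspace Q" using Q(1) Ob_UnifD(1) by blast
    have Qc: "compact_space (utopology Q)" using Q(1) by (auto simp: compact_T2_def)
    have q: "q \<in> ucont_maps Q K" and r: "r \<in> ucont_maps Q X"
      and hom: "homeomorphic_map (utopology Q) (prod_topology (utopology K) (utopology X)) (\<lambda>z. (q z, r z))"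
      using Q(2) unfolding binary_product_def by simp_all
    have cq: "continuous_map (utopology Q) (utopology K) q" using ucont_continuous[OF UQ UK q] .
    have cr: "continuous_map (utopology Q) (utopology X) r" using ucont_continuous[OF UQ UX r] .
    have surj: "(\<lambda>z. (q z, r z)) ` points Q = points K \<times> points X"
      using homeomorphic_imp_surjective_map[OF hom]
      by (simp add: topspace_utopology[OF UQ] topspace_utopology[OF UX] topspace_utopology[OF UK])
    have "\<exists>z\<in>points Q. q z = e t \<and> r z = s t" if t: "t \<in> S" for t
    proof -
      have "(e t, s t) \<in> (\<lambda>z. (q z, r z)) ` points Q" unfolding surj using e(1) s t by (auto simp: ptsK)
      then show ?thesis by auto
    qed
    then obtain g where g: "\<And>t. t \<in> S \<Longrightarrow> g t \<in> points Q" "\<And>t. t \<in> S \<Longrightarrow> q (g t) = e t" "\<And>t. t \<in> S \<Longrightarrow> r (g t) = s t"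
      by metis
    \<comment> \<open>Compactness makes the projection of \<open>?G\<close> to \<open>?F\<close>
      onto; what remains is that \<open>?G\<close> is single-valued over \<open>?F\<close>.\<close>
    let ?G = "utopology Q closure_of (g ` S)"
    have gS: "g ` S \<subseteq> topspace (utopology Q)" using g(1) by (auto simp: topspace_utopology[OF UQ])
    have G: "closedin (utopology Q) ?G" by (rule closedin_closure_of)
    have gG: "g ` S \<subseteq> ?G" by (rule closure_of_subset[OF gS])
    note subG = closed_subspaceD[OF CU compact_spaces_closed_subspaces Q(1) G]
    let ?H = "usubspace Q ?G"
    have Hc: "compact_space (utopology ?H)" using subG(1) by (auto simp: compact_T2_def)
    have inc: "(\<lambda>z\<in>?G. z) \<in> ucont_maps ?H Q" using ucont_inclusion[OF UQ subG(2)] .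
    have res: "compose ?G f (\<lambda>x\<in>?G. x) = (\<lambda>x\<in>?G. f x)" for f :: "'u \<Rightarrow> 'u" by (auto simp: compose_def)
    have qH: "(\<lambda>z\<in>?G. q z) \<in> ucont_maps ?H K" and rH: "(\<lambda>z\<in>?G. r z) \<in> ucont_maps ?H X"
      using ucont_compose[OF subG(3) inc q] ucont_compose[OF subG(3) inc r] unfolding points_usubspace res .
    have qgS: "q ` g ` S = e ` S" using g(2) by (simp add: image_image)
    have "q ` ?G \<subseteq> ?F" using continuous_map_image_closure_subset[OF cq, of "g ` S"] unfolding qgS .
    moreover have "?F \<subseteq> q ` ?G"
    proof (rule closure_of_minimal)
      show "e ` S \<subseteq> q ` ?G" unfolding qgS[symmetric] using gG by (rule image_mono)
      show "closedin (utopology K) (q ` ?G)"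
        using T1_Spaces.continuous_imp_closed_map[OF cq Qc KH] G unfolding closed_map_def by blast
    qed
    ultimately have qG: "q ` ?G = ?F" by blast
    have qB: "(\<lambda>z\<in>?G. q z) \<in> ucont_maps ?H ?B"
      using qH qG by (subst ucont_usubspace_iff[OF subG(3) sub(2)]) simp
    \<comment> \<open>Disjoint neighbourhoods of two values give a subset of \<open>S\<close>, the
      preimage of one of them under \<open>s\<close>. The coordinate of this subset is locally
      constant on \<open>Q\<close> and depends only on \<open>q\<close>, but density of the graph
      forces it to be \<open>d\<close> at \<open>z\<close> and \<open>c\<close> at
      \<open>z'\<close>.\<close>
    have inj: "r z = r z'" if z: "z \<in> ?G" and z': "z' \<in> ?G" and eq: "q z = q z'" for z z'
    proof (rule ccontr)
      assume "r z \<noteq> r z'"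
      moreover have zQ: "z \<in> points Q" "z' \<in> points Q" using z z' subG(2) by blast+
      then have "r z \<in> points X" "r z' \<in> points X" using ucont_mapsD(3)[OF r] by blast+
      ultimately obtain O1 O2 where O12: "openin (utopology X) O1" "openin (utopology X) O2"
        "r z \<in> O1" "r z' \<in> O2" "disjnt O1 O2"
        using XH unfolding Hausdorff_space_def topspace_utopology[OF UX] by blast
      let ?T = "{t \<in> S. s t \<in> O1}"
      have T: "?T \<in> Pow S" by blast
      have i: "code ?T \<in> ?I" using T by (rule imageI)
      let ?h = "\<lambda>w. p (code ?T) (q w)"
      have ch: "continuous_map (utopology Q) (utopology D) ?h"
        using continuous_map_compose[OF cq ucont_continuous[OF UK D'(2) pK[OF i]]] by (simp add: comp_def)
      have mem: "\<exists>t\<in>S. ?h (g t) = ?h w \<and> r (g t) \<in> O'" if w: "w \<in> ?G" and O': "openin (utopology X) O'" "r w \<in> O'" for w O'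
      proof -
        have wQ: "w \<in> points Q" using w subG(2) by blast
        have "?h w \<in> {c, d}"
          using continuous_map_funspace[OF ch] wQ
          by (auto simp: topspace_utopology[OF UQ] topspace_utopology[OF D'(2)] D'(4))
        then have "openin (utopology D) {?h w}" unfolding D'(6) by simp
        from openin_continuous_map_preimage[OF ch this] openin_continuous_map_preimage[OF cr O'(1)]
        have oN: "openin (utopology Q) ({x \<in> topspace (utopology Q). ?h x \<in> {?h w}} \<inter> {x \<in> topspace (utopology Q). r x \<in> O'})"
          by (rule openin_Int)
        have wN: "w \<in> {x \<in> topspace (utopology Q). ?h x \<in> {?h w}} \<inter> {x \<in> topspace (utopology Q). r x \<in> O'}"
          using wQ O'(2) by (simp add: topspace_utopology[OF UQ])
        obtain y where y: "y \<in> g ` S"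
          "y \<in> {x \<in> topspace (utopology Q). ?h x \<in> {?h w}} \<inter> {x \<in> topspace (utopology Q). r x \<in> O'}"
          using w[unfolded in_closure_of, THEN conjunct2, THEN spec, THEN mp, OF conjI[OF wN oN]] by (elim exE conjE)
        then obtain t where "t \<in> S" "y = g t" by blast
        then show ?thesis using y(2) by (intro bexI[of _ t]) simp_all
      qed
      obtain t where t: "t \<in> S" "?h (g t) = ?h z" "r (g t) \<in> O1" using mem[OF z O12(1,3)] by blast
      obtain t' where t': "t' \<in> S" "?h (g t') = ?h z'" "r (g t') \<in> O2" using mem[OF z' O12(2,4)] by blast
      have "?h (g t) = d" using g(2,3)[OF t(1)] e(2)[OF T, of t] t by simp
      moreover have "?h (g t') = c"
      proof -
        have "s t' \<notin> O1" using g(3)[OF t'(1)] t'(3) O12(5) by (auto simp: disjnt_iff)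
        then show ?thesis using g(2)[OF t'(1)] e(2)[OF T, of t'] by simp
      qed
      ultimately show False using t(2) t'(2) eq D'(5) by simp
    qed
    have "\<exists>m\<in>ucont_maps ?B X. compose (points ?H) m (\<lambda>z\<in>?G. q z) = (\<lambda>z\<in>?G. r z)"
    proof (rule compact_factor[OF subG(3) sub(3) UX Hc BH qB _ rH])
      show "(\<lambda>z\<in>?G. q z) ` points ?H = points ?B" using qG by simp
      fix x y assume xy: "x \<in> points ?H" "y \<in> points ?H" and eq: "(\<lambda>z\<in>?G. q z) x = (\<lambda>z\<in>?G. q z) y"
      have "r x = r y" using inj[of x y] xy eq by simp
      then show "(\<lambda>z\<in>?G. r z) x = (\<lambda>z\<in>?G. r z) y" using xy by simp
    qed
    then obtain m where m: "m \<in> ucont_maps ?B X" "compose (points ?H) m (\<lambda>z\<in>?G. q z) = (\<lambda>z\<in>?G. r z)" by blast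
    have "m (e t) = s t" if t: "t \<in> S" for t
    proof -
      have "g t \<in> ?G" using gG t by blast
      then have "m (q (g t)) = r (g t)" using fun_cong[OF m(2), of "g t"] by (simp add: compose_def)
      then show ?thesis using g(2,3)[OF t] by simp
    qed
    then show ?thesis using m(1) by blast
  qed
  have "universal_arrow (full_subcat ?C) S ?B (\<lambda>t\<in>S. e t)"
    unfolding universal_arrow_def full_subcat_simps
  proof (intro conjI ballI)
    show "?B \<in> ?C" by (rule sub(1))
    show "(\<lambda>t\<in>S. e t) \<in> S \<rightarrow>\<^sub>E points ?B" using eF by auto
    fix X s assume X: "X \<in> ?C" and s: "s \<in> S \<rightarrow>\<^sub>E points X"
    have UX: "is_uspace X" using X Ob_UnifD(1) by blast
    have XH: "Hausdorff_space (utopology X)" using X by (auto simp: compact_T2_def)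
    have "s \<in> S \<rightarrow> points X" using s by auto
    from ext[OF X this] obtain m where m: "m \<in> ucont_maps ?B X" "\<forall>t\<in>S. m (e t) = s t" by blast
    show "\<exists>!m. m \<in> ucont_maps ?B X \<and> compose S m (\<lambda>t\<in>S. e t) = s"
    proof (rule ex1I[of _ m], intro conjI m(1))
      show "compose S m (\<lambda>t\<in>S. e t) = s"
        using m(2) s by (auto simp: compose_def fun_eq_iff PiE_iff extensional_def)
      fix n assume n: "n \<in> ucont_maps ?B X \<and> compose S n (\<lambda>t\<in>S. e t) = s"
      have ne: "n (e t) = m (e t)" if "t \<in> S" for t
      proof -
        have "compose S n (\<lambda>t\<in>S. e t) t = s t" using n by simp
        then show ?thesis using that m(2) by (simp add: compose_def)
      qed
      have "n z = m z" if z: "z \<in> ?F" for z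
      proof (rule forall_in_closure_of_eq[of z "utopology ?B" "e ` S" "utopology X" n m])
        show "z \<in> utopology ?B closure_of (e ` S)" unfolding dense using z .
        show "continuous_map (utopology ?B) (utopology X) n" using ucont_continuous[OF sub(3) UX] n by blast
        show "continuous_map (utopology ?B) (utopology X) m" using ucont_continuous[OF sub(3) UX m(1)] .
        show "n x = m x" if "x \<in> e ` S" for x using that ne by auto
      qed (rule XH)
      then show "n = m"
        using ucont_mapsD(1)[of n ?B X] ucont_mapsD(1)[OF m(1)] n PiE_ext[of n ?F "\<lambda>_. points X" m] by simp
    qed
  qed
  then show ?thesis using F by blast
qed

lemma compact_spaces_varietal: "varietal (full_subcat compact_spaces)"
proof (rule exact_cat_varietal[OF compact_spaces_exact])
  fix S :: "'u set" assume S: "small S"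
  obtain D :: "'u uspace" and c d where D: "two_point D c d" using ex_two_point by blast
  have "Pow S \<prec> (UNIV :: 'u set)" using small_Pow[of S] S by (simp add: small_def)
  then obtain code :: "'u set \<Rightarrow> 'u" where code: "inj_on code (Pow S)" "small (code ` Pow S)" by (rule ex_encoding)
  obtain A p where P: "concrete_product (code ` Pow S) (\<lambda>_. D) A p"
    using ex_concrete_product[OF code(2), of "\<lambda>_. D"] two_pointD(1)[OF D] by blast
  show "\<exists>F e. universal_arrow (full_subcat compact_spaces) S F e"
    using universal_arrow_compact[OF D code(1) P] by blast
qed

end


section \<open>Full subcategories isomorphic to subcategories of \<open>Set\<close>\<close>

lemma is_uspace_indiscrete: "is_uspace \<lparr>points = B, unif = principal (B \<times> B)\<rparr>"
  unfolding is_uspace_def uspace.simps eventually_principal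
proof (intro conjI allI impI)
  fix E assume E: "\<forall>x\<in>B \<times> B. E x"
  then show "\<exists>D. (\<forall>x\<in>B \<times> B. D x) \<and> (\<forall>x y z. D (x, y) \<longrightarrow> D (y, z) \<longrightarrow> E (x, z))"
    by (intro exI[of _ "\<lambda>z. z \<in> B \<times> B"]) auto
qed auto

lemma is_uspace_discrete: "is_uspace \<lparr>points = B, unif = principal (Id_on B)\<rparr>"
  unfolding is_uspace_def uspace.simps eventually_principal
proof (intro conjI allI impI)
  fix E assume E: "\<forall>x\<in>Id_on B. E x"
  then show "\<exists>D. (\<forall>x\<in>Id_on B. D x) \<and> (\<forall>x y z. D (x, y) \<longrightarrow> D (y, z) \<longrightarrow> E (x, z))"
    by (intro exI[of _ "\<lambda>z. z \<in> Id_on B"]) auto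
qed auto

lemma ucont_to_indiscrete:
  assumes X: "is_uspace X" and Y: "indiscrete Y"
  shows "ucont_maps X Y = points X \<rightarrow>\<^sub>E points Y"
proof -
  have "filterlim (map_prod f f) (unif Y) (unif X)" if "f \<in> points X \<rightarrow>\<^sub>E points Y" for f
    using Y unif_points[OF X] that unfolding indiscrete_def
    by (auto simp: filterlim_principal elim!: eventually_mono)
  then show ?thesis unfolding ucont_maps_def by blast
qed

definition discrete_uspace :: "'u uspace \<Rightarrow> bool" where
  "discrete_uspace X \<longleftrightarrow> eventually (\<lambda>(x, y). x = y) (unif X)"

lemma ucont_from_discrete:
  assumes X: "is_uspace X" and D: "discrete_uspace X" and Y: "is_uspace Y"
  shows "ucont_maps X Y = points X \<rightarrow>\<^sub>E points Y"
proof -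
  have "filterlim (map_prod f f) (unif Y) (unif X)" if f: "f \<in> points X \<rightarrow>\<^sub>E points Y" for f
    unfolding filterlim_iff
  proof (intro allI impI)
    fix E assume E: "eventually E (unif Y)"
    show "eventually (\<lambda>z. E (map_prod f f z)) (unif X)"
      using D[unfolded discrete_uspace_def] unif_points[OF X]
      by eventually_elim (use unif_refl[OF Y E] f in \<open>auto simp: PiE_iff\<close>)
  qed
  then show ?thesis unfolding ucont_maps_def by blast
qed

lemma indiscrete_if_subsingleton:
  assumes X: "is_uspace X" and sub: "\<And>x y. x \<in> points X \<Longrightarrow> y \<in> points X \<Longrightarrow> x = y"
  shows "indiscrete X"
  unfolding indiscrete_def
proof (rule antisym)
  show "unif X \<le> principal (points X \<times> points X)" using X unfolding is_uspace_def by blast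
  show "principal (points X \<times> points X) \<le> unif X"
  proof (rule filter_leI)
    fix E assume E: "eventually E (unif X)"
    have "E (x, y)" if "x \<in> points X" "y \<in> points X" for x y
      using sub[OF that] unif_refl[OF X E that(1)] by simp
    then show "eventually E (principal (points X \<times> points X))" by (simp add: eventually_principal)
  qed
qed

lemma card_le_1_iff: "finite A \<and> card A \<le> 1 \<longleftrightarrow> (\<forall>x\<in>A. \<forall>y\<in>A. x = y)"
proof (cases "finite A")
  case True
  then show ?thesis by (simp add: card_le_Suc0_iff_eq)
next
  case False
  then have "A \<noteq> {}" by auto
  then obtain x where x: "x \<in> A" by blast
  have "\<not> A \<subseteq> {x}" using False finite_subset[of A "{x}"] by blast
  then show ?thesis using False x by blast
qed

lemma initial_indiscrete:
  assumes "\<And>i. i \<in> I \<Longrightarrow> indiscrete (X i)" and p: "\<And>i. i \<in> I \<Longrightarrow> p i \<in> A \<rightarrow> points (X i)"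
  shows "indiscrete (initial_uspace A I X p)"
proof -
  have "principal (A \<times> A) \<le> filtercomap (map_prod (p i) (p i)) (unif (X i))" if i: "i \<in> I" for i
    using assms(1)[OF i] p[OF i] unfolding indiscrete_def by auto
  then have "principal (A \<times> A) \<le> (INF i\<in>I. filtercomap (map_prod (p i) (p i)) (unif (X i)))"
    by (rule INF_greatest)
  then show ?thesis by (simp add: indiscrete_def initial_uspace_def inf_absorb1)
qed

lemma indiscrete_usubspace:
  assumes "indiscrete X" "S \<subseteq> points X"
  shows "indiscrete (usubspace X S)"
  using assms unfolding indiscrete_def usubspace_def by (simp add: inf_absorb2 Sigma_mono)

context inaccessible_universe
begin

text \<open>Only sets that embed in the square of a given object are demanded, which keeps the rule
  applicable to classes of subsingletons.\<close>

lemma full_concrete_catI: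
  fixes C :: "'u uspace set"
  assumes C: "C \<subseteq> Ob_Unif"
    and full: "\<And>X Y. \<lbrakk>X \<in> C; Y \<in> C\<rbrakk> \<Longrightarrow> ucont_maps X Y = points X \<rightarrow>\<^sub>E points Y"
    and copy: "\<And>X B. \<lbrakk>X \<in> C; small B; B \<lesssim> points X \<times> points X; B \<noteq> {} \<or> points X = {}\<rbrakk>
      \<Longrightarrow> \<exists>R\<in>C. points R = B"
  shows "full_concrete_cat (full_subcat C)"
proof
  fix X and A :: "('u \<times> 'u) set"
  assume "X \<in> Ob (full_subcat C)" and A: "A \<subseteq> Und (full_subcat C) X \<times> Und (full_subcat C) X"
    and ne: "A \<noteq> {} \<or> Und (full_subcat C) X = {}"
  then have X: "X \<in> C" unfolding full_subcat_simps by blast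
  then have "small (points X)" using C small_points by blast
  then have "points X \<times> points X \<prec> (UNIV :: 'u set)" using small_Times[of "points X" "points X"] by (simp add: small_def)
  then have "A \<prec> (UNIV :: 'u set)" using small_lepoll[OF subset_imp_lepoll] A by simp
  then obtain e :: "'u \<times> 'u \<Rightarrow> 'u" where e: "inj_on e A" "small (e ` A)" by (rule ex_encoding)
  have bij: "bij_betw (inv_into A e) (e ` A) A"
    using bij_betw_inv_into inj_on_imp_bij_betw[OF e(1)] by blast
  have "e ` A \<lesssim> points X \<times> points X"
    using lepoll_trans[OF image_lepoll[of e A] subset_imp_lepoll] A by simp
  moreover have "e ` A \<noteq> {} \<or> points X = {}" using ne by simp
  ultimately obtain R where "R \<in> C" "points R = e ` A" using copy[OF X e(2)] by blast
  then show "\<exists>R\<in>Ob (full_subcat C). \<exists>e. bij_betw e (Und (full_subcat C) R) A"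
    using bij by (intro bexI[of _ R] exI[of _ "inv_into A e"]) simp_all
next
  fix X assume "X \<in> Ob (full_subcat C)"
  then show "small (Und (full_subcat C) X)" using C small_points by auto
qed (simp add: full)

text \<open>When all functions are morphisms, every object is free on its own points, so finding
  free objects reduces to finding objects with a prescribed carrier.\<close>

lemma universal_arrow_id:
  fixes C :: "'u uspace set"
  assumes full: "\<And>X Y. \<lbrakk>X \<in> C; Y \<in> C\<rbrakk> \<Longrightarrow> ucont_maps X Y = points X \<rightarrow>\<^sub>E points Y" and F: "F \<in> C"
  shows "universal_arrow (full_subcat C) (points F) F (\<lambda>x\<in>points F. x)"
  unfolding universal_arrow_def full_subcat_simps
proof (intro conjI ballI F)
  fix X s assume X: "X \<in> C" and s: "s \<in> points F \<rightarrow>\<^sub>E points X"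
  have "compose (points F) m (\<lambda>x\<in>points F. x) = m" if "m \<in> points F \<rightarrow>\<^sub>E points X" for m
    using that by (intro compose_Id) (auto simp: PiE_iff)
  then show "\<exists>!m. m \<in> ucont_maps F X \<and> compose (points F) m (\<lambda>x\<in>points F. x) = s"
    unfolding full[OF F X] using s by (intro ex1I[of _ s]) auto
qed auto

lemma indiscrete_spaces_varietal: "varietal (full_subcat {X :: 'u uspace. X \<in> Ob_Unif \<and> indiscrete X})"
proof -
  let ?C = "{X :: 'u uspace. X \<in> Ob_Unif \<and> indiscrete X}"
  have full: "ucont_maps X Y = points X \<rightarrow>\<^sub>E points Y" if "X \<in> ?C" "Y \<in> ?C" for X Y
    using that ucont_to_indiscrete Ob_UnifD(1) by blast
  have mk: "\<exists>R\<in>?C. points R = B" if "small B" for B :: "'u set"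
    using that is_uspace_indiscrete[of B]
    by (intro bexI[of _ "\<lparr>points = B, unif = principal (B \<times> B)\<rparr>"]) (simp_all add: Ob_Unif_def indiscrete_def)
  have "full_concrete_cat (full_subcat ?C)"
    by (rule full_concrete_catI[OF _ full]) (use mk in auto)
  then interpret full_concrete_cat "full_subcat ?C" .
  have "exact_cat (full_subcat ?C)" ..
  then show ?thesis
  proof (rule exact_cat_varietal)
    fix S :: "'u set" assume "small S"
    then obtain F where F: "F \<in> ?C" "points F = S" using mk by blast
    show "\<exists>F e. universal_arrow (full_subcat ?C) S F e"
      using universal_arrow_id[of ?C F, OF full F(1)] unfolding F(2) by blast
  qed
qed

lemma discrete_spaces_varietal: "varietal (full_subcat {X :: 'u uspace. X \<in> Ob_Unif \<and> discrete_uspace X})"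
proof -
  let ?C = "{X :: 'u uspace. X \<in> Ob_Unif \<and> discrete_uspace X}"
  have full: "ucont_maps X Y = points X \<rightarrow>\<^sub>E points Y" if "X \<in> ?C" "Y \<in> ?C" for X Y
    using that ucont_from_discrete Ob_UnifD(1) by blast
  have mk: "\<exists>R\<in>?C. points R = B" if "small B" for B :: "'u set"
    using that is_uspace_discrete[of B]
    by (intro bexI[of _ "\<lparr>points = B, unif = principal (Id_on B)\<rparr>"])
      (auto simp: Ob_Unif_def discrete_uspace_def eventually_principal)
  have "full_concrete_cat (full_subcat ?C)"
    by (rule full_concrete_catI[OF _ full]) (use mk in auto)
  then interpret full_concrete_cat "full_subcat ?C" .
  have "exact_cat (full_subcat ?C)" ..
  then show ?thesis
  proof (rule exact_cat_varietal)
    fix S :: "'u set" assume "small S"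
    then obtain F where F: "F \<in> ?C" "points F = S" using mk by blast
    show "\<exists>F e. universal_arrow (full_subcat ?C) S F e"
      using universal_arrow_id[of ?C F, OF full F(1)] unfolding F(2) by blast
  qed
qed

text \<open>Both \<open>{X. |X| \<le> 1}\<close> and \<open>{X. |X| = 1}\<close> are of the following form.\<close>

lemma subsingletons_varietal:
  fixes C :: "'u uspace set"
  assumes C: "C \<subseteq> {X \<in> Ob_Unif. finite (points X) \<and> card (points X) \<le> 1}"
    and sing: "{X \<in> Ob_Unif. is_singleton (points X)} \<subseteq> C"
    and empty: "\<And>X. X \<in> C \<Longrightarrow> points X = {} \<Longrightarrow> {X \<in> Ob_Unif. points X = {}} \<subseteq> C"
  shows "varietal (full_subcat C)"
proof -
  have eq: "x = y" if "X \<in> C" "x \<in> points X" "y \<in> points X" for X x y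
    using that C card_le_1_iff[of "points X"] by blast
  have CU: "C \<subseteq> Ob_Unif" using C by blast
  have ind: "indiscrete X" if "X \<in> C" for X
    by (rule indiscrete_if_subsingleton[OF Ob_UnifD(1)[OF subsetD[OF CU that]] eq[OF that]])
  have full: "ucont_maps X Y = points X \<rightarrow>\<^sub>E points Y" if "X \<in> C" "Y \<in> C" for X Y
    by (rule ucont_to_indiscrete[OF Ob_UnifD(1)[OF subsetD[OF CU that(1)]] ind[OF that(2)]])
  have mk: "\<exists>R\<in>Ob_Unif. points R = B" if "small B" for B :: "'u set"
    using that is_uspace_indiscrete[of B]
    by (intro bexI[of _ "\<lparr>points = B, unif = principal (B \<times> B)\<rparr>"]) (simp_all add: Ob_Unif_def)
  have small1: "small {x :: 'u}" "small ({} :: 'u set)" for x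
    using small_finite[of "{x}"] small_finite[of "{} :: 'u set"] by (simp_all add: small_def)
  have "full_concrete_cat (full_subcat C)"
  proof (rule full_concrete_catI[OF CU full])
    fix X and B :: "'u set"
    assume X: "X \<in> C" and B: "small B" "B \<lesssim> points X \<times> points X" "B \<noteq> {} \<or> points X = {}"
    obtain R :: "'u uspace" where R: "R \<in> Ob_Unif" "points R = B" using mk[OF B(1)] by blast
    obtain f where f: "inj_on f B" "f ` B \<subseteq> points X \<times> points X" using B(2) unfolding lepoll_def by blast
    have Beq: "x = y" if "x \<in> B" "y \<in> B" for x y
    proof (rule inj_onD[OF f(1) _ that])
      have "f x \<in> points X \<times> points X" "f y \<in> points X \<times> points X" using f(2) that by blast+
      then show "f x = f y" using eq[OF X, of "fst (f x)" "fst (f y)"] eq[OF X, of "snd (f x)" "snd (f y)"]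
        by (simp add: mem_Times_iff prod_eq_iff)
    qed
    show "\<exists>R\<in>C. points R = B"
    proof (cases "B = {}")
      case True
      then have "points X = {} \<or> False" using B(3) by simp
      then show ?thesis using empty[OF X] R True by blast
    next
      case False
      then obtain b where "b \<in> B" by blast
      then have "B = {b}" using Beq by blast
      then show ?thesis using sing R by (intro bexI[of _ R]) auto
    qed
  qed
  then interpret full_concrete_cat "full_subcat C" .
  have "exact_cat (full_subcat C)" ..
  then show ?thesis
  proof (rule exact_cat_varietal)
    fix S :: "'u set" assume "small S"
    have ua: "universal_arrow (full_subcat C) S F (\<lambda>t\<in>S. a)"
      if F: "F \<in> C" and a: "S = {} \<or> a \<in> points F"
        and ex: "\<And>X. X \<in> C \<Longrightarrow> points X = {} \<Longrightarrow> S = {} \<Longrightarrow> points F = {}" for F a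
      unfolding universal_arrow_def full_subcat_simps
    proof (intro conjI ballI F)
      show "(\<lambda>t\<in>S. a) \<in> S \<rightarrow>\<^sub>E points F" using a by auto
      fix X s assume X: "X \<in> C" and s: "s \<in> S \<rightarrow>\<^sub>E points X"
      have "\<exists>m. m \<in> points F \<rightarrow>\<^sub>E points X"
      proof (cases "points X = {}")
        case True
        then have "S = {}" using s by auto
        then have "points F = {}" using ex[OF X True] by blast
        then show ?thesis by auto
      next
        case False
        then obtain x where "x \<in> points X" by blast
        then have "(\<lambda>_\<in>points F. x) \<in> points F \<rightarrow>\<^sub>E points X" by auto
        then show ?thesis by blast
      qed
      then obtain m where m: "m \<in> points F \<rightarrow>\<^sub>E points X" by blast
      have fun_eq: "f = g" if "f \<in> A \<rightarrow>\<^sub>E points X" "g \<in> A \<rightarrow>\<^sub>E points X" for f g and A :: "'u set"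
      proof (rule PiE_ext[OF that])
        fix x assume x: "x \<in> A"
        show "f x = g x" by (rule eq[OF X PiE_mem[OF that(1) x] PiE_mem[OF that(2) x]])
      qed
      have cmp: "compose S n (\<lambda>t\<in>S. a) \<in> S \<rightarrow>\<^sub>E points X" if "n \<in> points F \<rightarrow>\<^sub>E points X" for n
        using that a by (auto simp: compose_def PiE_iff)
      show "\<exists>!m. m \<in> ucont_maps F X \<and> compose S m (\<lambda>t\<in>S. a) = s"
        unfolding full[OF F X]
      proof (rule ex1I[of _ m], intro conjI m)
        show "compose S m (\<lambda>t\<in>S. a) = s" by (rule fun_eq[OF cmp[OF m] s])
        fix n assume "n \<in> points F \<rightarrow>\<^sub>E points X \<and> compose S n (\<lambda>t\<in>S. a) = s"
        then show "n = m" by (intro fun_eq[OF _ m]) (rule conjunct1)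
      qed
    qed
    show "\<exists>F e. universal_arrow (full_subcat C) S F e"
    \<comment> \<open>The free object on the empty set is initial: an empty object if the class has
      one, and a one-point object otherwise. Every nonempty set generates a one-point
      object.\<close>
    proof (cases "S = {} \<and> (\<exists>X\<in>C. points X = {})")
      case True
      then obtain X where X: "X \<in> C" "points X = {}" by blast
      have "universal_arrow (full_subcat C) S X (\<lambda>t\<in>S. undefined)"
        by (rule ua[OF X(1)]) (use True X(2) in simp_all)
      then show ?thesis by blast
    next
      case False
      obtain R :: "'u uspace" where R: "R \<in> Ob_Unif" "points R = {undefined}" using mk[OF small1(1)] by blast
      then have RC: "R \<in> C" using sing by (auto simp: is_singleton_def)
      have "universal_arrow (full_subcat C) S R (\<lambda>t\<in>S. undefined)"
        by (rule ua[OF RC]) (use False R(2) in auto)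
      then show ?thesis by blast
    qed
  qed
qed


section \<open>The three classes\<close>

lemma subsingletons_closed:
  "closed_under_closed_subspaces {X :: 'u uspace. X \<in> Ob_Unif \<and> finite (points X) \<and> card (points X) \<le> 1}"
  unfolding closed_under_closed_subspaces_def card_le_1_iff
proof (intro ballI allI impI)
  fix X :: "'u uspace" and S
  assume X: "X \<in> {X. X \<in> Ob_Unif \<and> (\<forall>x\<in>points X. \<forall>y\<in>points X. x = y)}" and S: "closedin (utopology X) S"
  have U: "is_uspace X" and sm: "small (points X)" using X Ob_UnifD by blast+
  have sub: "S \<subseteq> points X" using closedin_subset[OF S] topspace_utopology[OF U] by simp
  then have "usubspace X S \<in> Ob_Unif"
    using is_uspace_usubspace[OF U sub] small_subset[OF sm sub] by (simp add: Ob_Unif_def)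
  moreover have "\<forall>x\<in>S. \<forall>y\<in>S. x = y" using X sub by blast
  ultimately show "usubspace X S \<in> {X. X \<in> Ob_Unif \<and> (\<forall>x\<in>points X. \<forall>y\<in>points X. x = y)}" by simp
qed

lemma subsingleton_product:
  assumes P: "concrete_product I X A p"
    and X: "\<And>i x y. i \<in> I \<Longrightarrow> x \<in> points (X i) \<Longrightarrow> y \<in> points (X i) \<Longrightarrow> x = y"
    and z: "z \<in> A" "w \<in> A"
  shows "z = w"
proof (rule inj_onD[OF concrete_productD(5)[OF P] _ z])
  show "(\<lambda>i\<in>I. p i z) = (\<lambda>i\<in>I. p i w)"
  proof
    fix i show "(\<lambda>i\<in>I. p i z) i = (\<lambda>i\<in>I. p i w) i"
    proof (cases "i \<in> I")
      case True
      have "p i z \<in> points (X i)" "p i w \<in> points (X i)" using concrete_productD(3)[OF P True] z by auto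
      from X[OF True this] show ?thesis using True by simp
    qed simp
  qed
qed

theorem three_classes:
  fixes C :: "'u uspace set"
  assumes C: "subcategory_of_Unif C" and "trivial_or_indiscrete_or_compact_T2 C"
  shows "closed_under_products C \<and> closed_under_closed_subspaces C \<and> varietal (full_subcat C)"
  using assms(2) unfolding trivial_or_indiscrete_or_compact_T2_def
proof (elim disjE)
  assume eq: "C = {X \<in> Ob_Unif. finite (points X) \<and> card (points X) \<le> 1}"
  have "closed_under_products C"
  proof (rule closed_under_productsI[OF C])
    fix I X A p assume X: "\<And>i. i \<in> I \<Longrightarrow> X i \<in> C" and P: "concrete_product I X A p"
    have eqX: "x = y" if "i \<in> I" "x \<in> points (X i)" "y \<in> points (X i)" for i x y
      using X[OF that(1)] that(2,3) unfolding eq card_le_1_iff by blast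
    have "z = w" if "z \<in> A" "w \<in> A" for z w
      by (rule subsingleton_product[OF P _ that]) (rule eqX)
    then have "\<forall>z\<in>A. \<forall>w\<in>A. z = w" by blast
    then show "initial_uspace A I X p \<in> C"
      unfolding eq card_le_1_iff using concrete_productD(1)[OF P] by simp
  qed
  moreover have "varietal (full_subcat C)"
    by (rule subsingletons_varietal) (auto simp: eq is_singleton_def)
  ultimately show ?thesis using subsingletons_closed unfolding eq by blast
next
  assume eq: "C = {X \<in> Ob_Unif. indiscrete X}"
  have "closed_under_products C"
  proof (rule closed_under_productsI[OF C])
    fix I X A p assume X: "\<And>i. i \<in> I \<Longrightarrow> X i \<in> C" and P: "concrete_product I X A p"
    have "indiscrete (initial_uspace A I X p)"
      using X by (intro initial_indiscrete concrete_productD(3)[OF P]) (auto simp: eq)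
    then show "initial_uspace A I X p \<in> C"
      unfolding eq using concrete_productD(1)[OF P] by simp
  qed
  moreover have "closed_under_closed_subspaces C"
    unfolding closed_under_closed_subspaces_def
  proof (intro ballI allI impI)
    fix X S assume X: "X \<in> C" and S: "closedin (utopology X) S"
    have U: "is_uspace X" "small (points X)" "indiscrete X" using X Ob_UnifD unfolding eq by blast+
    have sub: "S \<subseteq> points X" using closedin_subset[OF S] topspace_utopology[OF U(1)] by simp
    then show "usubspace X S \<in> C"
      unfolding eq using is_uspace_usubspace[OF U(1) sub] small_subset[OF U(2) sub] indiscrete_usubspace[OF U(3) sub]
      by (simp add: Ob_Unif_def)
  qed
  ultimately show ?thesis using indiscrete_spaces_varietal unfolding eq by blast
next
  assume eq: "C = compact_spaces"
  have "closed_under_products C"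
    unfolding eq by (rule closed_under_productsI[OF compact_spaces_subcategory]) (rule compact_spaces_products)
  then show ?thesis using compact_spaces_closed_subspaces compact_spaces_varietal unfolding eq by blast
qed


section \<open>Independence of the three conditions\<close>

lemma ex_infinite_discrete: "\<exists>D :: 'u uspace. D \<in> Ob_Unif \<and> infinite (points D) \<and> discrete_uspace D"
proof -
  obtain A :: "'u set" where A: "infinite A" "small A"
    using inaccessible unfolding inaccessible_type_def by blast
  then show ?thesis using is_uspace_discrete[of A]
    by (intro exI[of _ "\<lparr>points = A, unif = principal (Id_on A)\<rparr>"])
      (auto simp: Ob_Unif_def discrete_uspace_def eventually_principal)
qed

text \<open>An infinite discrete space lies in none of the three classes. This disposes of the class
  of discrete spaces and of all of \<open>Unif\<close> at once.\<close>

lemma infinite_discrete_not_three: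
  fixes C :: "'u uspace set"
  assumes "{X \<in> Ob_Unif. discrete_uspace X} \<subseteq> C"
  shows "\<not> trivial_or_indiscrete_or_compact_T2 C"
proof
  assume three: "trivial_or_indiscrete_or_compact_T2 C"
  obtain D :: "'u uspace" where D: "D \<in> Ob_Unif" "infinite (points D)" "discrete_uspace D"
    using ex_infinite_discrete by blast
  then have DC: "D \<in> C" using assms by blast
  have U: "is_uspace D" using D(1) by (rule Ob_UnifD)
  have "\<not> indiscrete D"
  proof
    assume "indiscrete D"
    then have "\<forall>x\<in>points D. \<forall>y\<in>points D. x = y"
      using D(3) by (auto simp: indiscrete_def discrete_uspace_def eventually_principal)
    then show False using D(2) card_le_1_iff by blast
  qed
  moreover have "\<not> compact_T2 D"
  proof
    assume "compact_T2 D"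
    then have c: "compact_space (utopology D)" unfolding compact_T2_def by blast
    have "openin (utopology D) S \<longleftrightarrow> S \<subseteq> points D" for S
    proof -
      have "eventually (\<lambda>(x', y). x' = x \<longrightarrow> y \<in> S) (unif D)" if "x \<in> S" for x
        using D(3)[unfolded discrete_uspace_def] by eventually_elim (use that in auto)
      then show ?thesis unfolding openin_utopology by blast
    qed
    then have "utopology D = discrete_topology (points D)" by (simp add: topology_eq)
    then show False using c D(2) by (simp add: compact_space_discrete_topology)
  qed
  ultimately show False
    using three DC D(2) unfolding trivial_or_indiscrete_or_compact_T2_def by blast
qed

lemma products_needed:
  "\<exists>C :: 'u uspace set. subcategory_of_Unif C \<and> closed_under_closed_subspaces C \<and>
     varietal (full_subcat C) \<and> \<not> trivial_or_indiscrete_or_compact_T2 C"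
proof -
  let ?C = "{X :: 'u uspace. X \<in> Ob_Unif \<and> discrete_uspace X}"
  have "subcategory_of_Unif ?C"
    unfolding subcategory_of_Unif_def
  proof (intro conjI ballI impI)
    fix X Y :: "'u uspace" assume X: "X \<in> ?C" and Y: "Y \<in> Ob_Unif" and XY: "isomorphic Unif X Y"
    obtain f g where g: "g \<in> ucont_maps Y X" "\<forall>y\<in>points Y. f (g y) = y"
      using isomorphic_UnifD[OF XY] by blast
    have "eventually (\<lambda>(x, y). x = y) (unif X)" using X unfolding discrete_uspace_def by blast
    from ucont_eventually[OF g(1) this] have "eventually (\<lambda>(x, y). g x = g y) (unif Y)" by simp
    then have "discrete_uspace Y" unfolding discrete_uspace_def
      using unif_points[OF Ob_UnifD(1)[OF Y]]
    proof eventually_elim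
      case (elim z)
      obtain a b where z: "z = (a, b)" by force
      have ab: "a \<in> points Y" "b \<in> points Y" "g a = g b" using elim z by simp_all
      from arg_cong[OF ab(3), of f] have "a = b"
        unfolding g(2)[rule_format, OF ab(1)] g(2)[rule_format, OF ab(2)] .
      then show ?case using z by simp
    qed
    then show "Y \<in> ?C" using Y by blast
  qed blast
  moreover have "closed_under_closed_subspaces ?C"
    unfolding closed_under_closed_subspaces_def
  proof (intro ballI allI impI)
    fix X :: "'u uspace" and S assume X: "X \<in> ?C" and S: "closedin (utopology X) S"
    have U: "is_uspace X" "small (points X)" using X Ob_UnifD by blast+
    have sub: "S \<subseteq> points X" using closedin_subset[OF S] topspace_utopology[OF U(1)] by simp
    have "eventually (\<lambda>(x, y). x = y) (unif X)" using X unfolding discrete_uspace_def by blast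
    then have "discrete_uspace (usubspace X S)"
      unfolding discrete_uspace_def usubspace_def using filter_leD[OF inf_le1] by simp
    then show "usubspace X S \<in> ?C"
      using is_uspace_usubspace[OF U(1) sub] small_subset[OF U(2) sub] by (simp add: Ob_Unif_def)
  qed
  ultimately show ?thesis
    using discrete_spaces_varietal infinite_discrete_not_three[of ?C] by blast
qed

lemma closed_subspaces_needed:
  "\<exists>C :: 'u uspace set. subcategory_of_Unif C \<and> closed_under_products C \<and>
     varietal (full_subcat C) \<and> \<not> trivial_or_indiscrete_or_compact_T2 C"
proof -
  let ?C = "{X :: 'u uspace. X \<in> Ob_Unif \<and> is_singleton (points X)}"
  have sub: "subcategory_of_Unif ?C"
    unfolding subcategory_of_Unif_def
  proof (intro conjI ballI impI)
    fix X Y :: "'u uspace" assume X: "X \<in> ?C" and Y: "Y \<in> Ob_Unif" and XY: "isomorphic Unif X Y"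
    obtain f g where f: "f \<in> ucont_maps X Y" and g: "g \<in> ucont_maps Y X" "\<forall>y\<in>points Y. f (g y) = y"
      using isomorphic_UnifD[OF XY] by blast
    obtain x where x: "points X = {x}" using X by (auto simp: is_singleton_def)
    have "points Y = {f x}"
      using ucont_mapsD(3)[OF f, of x] ucont_mapsD(3)[OF g(1)] g(2) x by fastforce
    then show "Y \<in> ?C" using Y by simp
  qed blast
  moreover have "closed_under_products ?C"
  proof (rule closed_under_productsI[OF sub])
    fix I X A p assume X: "\<And>i. i \<in> I \<Longrightarrow> X i \<in> ?C" and P: "concrete_product I X A p"
    have "\<exists>x. points (X i) = {x}" if "i \<in> I" for i using X[OF that] by (auto simp: is_singleton_def)
    then obtain x where x: "\<And>i. i \<in> I \<Longrightarrow> points (X i) = {x i}" by metis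
    obtain a where a: "a \<in> A" using concrete_productD(6)[OF P, of x] x by auto
    have "b = a" if "b \<in> A" for b
      by (rule subsingleton_product[OF P _ that a]) (simp add: x)
    then have "A = {a}" using a by blast
    then show "initial_uspace A I X p \<in> ?C" using concrete_productD(1)[OF P] by simp
  qed
  moreover have "varietal (full_subcat ?C)"
    by (rule subsingletons_varietal) (auto simp: is_singleton_def)
  moreover have "\<not> trivial_or_indiscrete_or_compact_T2 ?C"
  proof
    assume "trivial_or_indiscrete_or_compact_T2 ?C"
    \<comment> \<open>All three classes are closed under closed subspaces, so no comparison with
      each of them separately is required.\<close>
    from three_classes[OF sub this] have cl: "closed_under_closed_subspaces ?C" by blast
    let ?X = "\<lparr>points = {undefined :: 'u}, unif = principal ({undefined} \<times> {undefined})\<rparr>"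
    have "small {undefined :: 'u}" using small_finite[of "{undefined :: 'u}"] by (simp add: small_def)
    then have "?X \<in> ?C" using is_uspace_indiscrete[of "{undefined}"] by (simp add: Ob_Unif_def)
    then have "usubspace ?X {} \<in> ?C"
      using cl closedin_empty[of "utopology ?X"] unfolding closed_under_closed_subspaces_def by blast
    then show False by (simp add: is_singleton_def)
  qed
  ultimately show ?thesis by blast
qed

lemma varietal_needed:
  "\<exists>C :: 'u uspace set. subcategory_of_Unif C \<and> closed_under_products C \<and>
     closed_under_closed_subspaces C \<and> \<not> trivial_or_indiscrete_or_compact_T2 C"
proof -
  let ?C = "Ob_Unif :: 'u uspace set"
  have "subcategory_of_Unif ?C" unfolding subcategory_of_Unif_def by blast
  moreover have "closed_under_products ?C"
    unfolding closed_under_products_def is_product_def by simp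
  moreover have "closed_under_closed_subspaces ?C"
    unfolding closed_under_closed_subspaces_def
  proof (intro ballI allI impI)
    fix X :: "'u uspace" and S assume X: "X \<in> ?C" and S: "closedin (utopology X) S"
    have U: "is_uspace X" "small (points X)" using X Ob_UnifD by blast+
    have sub: "S \<subseteq> points X" using closedin_subset[OF S] topspace_utopology[OF U(1)] by simp
    then show "usubspace X S \<in> ?C"
      using is_uspace_usubspace[OF U(1) sub] small_subset[OF U(2) sub] by (simp add: Ob_Unif_def)
  qed
  moreover have "\<not> trivial_or_indiscrete_or_compact_T2 ?C"
    by (rule infinite_discrete_not_three) blast
  ultimately show ?thesis by blast
qed

end


section \<open>Varietal subcategories closed under products and closed subspaces\<close>

lemma isomorphic_sym: "isomorphic K X Y \<Longrightarrow> isomorphic K Y X"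
  unfolding isomorphic_def by blast

lemma isomorphic_indiscrete:
  assumes X: "is_uspace X" "indiscrete X" and Y: "is_uspace Y" "indiscrete Y"
    and f: "bij_betw f (points X) (points Y)"
  shows "isomorphic Unif X Y"
proof (rule isomorphic_UnifI[OF X(1) Y(1)])
  let ?g = "inv_into (points X) f"
  have g: "bij_betw ?g (points Y) (points X)" using bij_betw_inv_into[OF f] .
  show "(\<lambda>x\<in>points X. f x) \<in> ucont_maps X Y"
    unfolding ucont_to_indiscrete[OF X(1) Y(2)] using bij_betw_apply[OF f] by auto
  show "(\<lambda>y\<in>points Y. ?g y) \<in> ucont_maps Y X"
    unfolding ucont_to_indiscrete[OF Y(1) X(2)] using bij_betw_apply[OF g] by auto
  show "(\<lambda>y\<in>points Y. ?g y) ((\<lambda>x\<in>points X. f x) x) = x" if "x \<in> points X" for x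
    using that bij_betw_apply[OF f that] inv_into_f_f[OF bij_betw_imp_inj_on[OF f] that] by simp
  show "(\<lambda>x\<in>points X. f x) ((\<lambda>y\<in>points Y. ?g y) y) = y" if "y \<in> points Y" for y
    using that bij_betw_apply[OF g that] f_inv_into_f[of y f "points X"] bij_betw_imp_surj_on[OF f] by simp
qed

lemma binary_productD:
  assumes P: "binary_product X Y P p q" and X: "is_uspace X" and Y: "is_uspace Y"
  shows "is_uspace P" "p \<in> ucont_maps P X" "q \<in> ucont_maps P Y"
    "\<And>x y. x \<in> points X \<Longrightarrow> y \<in> points Y \<Longrightarrow> \<exists>z\<in>points P. p z = x \<and> q z = y"
    "\<And>z w. z \<in> points P \<Longrightarrow> w \<in> points P \<Longrightarrow> p z = p w \<Longrightarrow> q z = q w \<Longrightarrow> z = w"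
    "\<And>Z a b. is_uspace Z \<Longrightarrow> a \<in> ucont_maps Z X \<Longrightarrow> b \<in> ucont_maps Z Y \<Longrightarrow>
       \<exists>m\<in>ucont_maps Z P. \<forall>z\<in>points Z. p (m z) = a z \<and> q (m z) = b z"
proof -
  have "P \<in> Ob_Unif" using P unfolding binary_product_def by blast
  then show U: "is_uspace P" by (rule Ob_UnifD)
  show "p \<in> ucont_maps P X" and "q \<in> ucont_maps P Y"
    using P unfolding binary_product_def by blast+
  have hom: "homeomorphic_map (utopology P) (prod_topology (utopology X) (utopology Y)) (\<lambda>z. (p z, q z))"
    using P unfolding binary_product_def by simp
  have surj: "(\<lambda>z. (p z, q z)) ` points P = points X \<times> points Y"
    using homeomorphic_imp_surjective_map[OF hom]
    by (simp add: topspace_utopology[OF U] topspace_utopology[OF X] topspace_utopology[OF Y])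
  show "\<exists>z\<in>points P. p z = x \<and> q z = y" if "x \<in> points X" "y \<in> points Y" for x y
  proof -
    have "(x, y) \<in> (\<lambda>z. (p z, q z)) ` points P" unfolding surj using that by simp
    then show ?thesis by auto
  qed
  have inj: "inj_on (\<lambda>z. (p z, q z)) (points P)"
    using homeomorphic_imp_injective_map[OF hom] by (simp add: topspace_utopology[OF U])
  show "z = w" if "z \<in> points P" "w \<in> points P" "p z = p w" "q z = q w" for z w
    using inj_onD[OF inj _ that(1,2)] that(3,4) by simp
  fix Z a b assume Z: "is_uspace Z" "a \<in> ucont_maps Z X" "b \<in> ucont_maps Z Y"
  obtain m where m: "m \<in> ucont_maps Z P" "compose (points Z) p m = a" "compose (points Z) q m = b"
    using P Z unfolding binary_product_def by blast
  have "p (m z) = a z \<and> q (m z) = b z" if "z \<in> points Z" for z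
    using fun_cong[OF m(2), of z] fun_cong[OF m(3), of z] that by (simp add: compose_def)
  then show "\<exists>m\<in>ucont_maps Z P. \<forall>z\<in>points Z. p (m z) = a z \<and> q (m z) = b z" using m(1) by blast
qed

section \<open>Pointwise consequences of being varietal\<close>

locale varietal_subcategory = inaccessible_universe U for U :: "'u itself" +
  fixes C :: "'u uspace set"
  assumes subcat: "subcategory_of_Unif C"
    and products: "closed_under_products C"
    and closed_subspaces: "closed_under_closed_subspaces C"
    and varietal: "varietal (full_subcat C)"
begin

lemma C_subset: "C \<subseteq> Ob_Unif"
  using subcat unfolding subcategory_of_Unif_def by blast

lemma mem_uspace: "X \<in> C \<Longrightarrow> is_uspace X"
  using C_subset Ob_UnifD(1) by blast

lemma iso_closed: "X \<in> C \<Longrightarrow> Y \<in> Ob_Unif \<Longrightarrow> isomorphic Unif X Y \<Longrightarrow> Y \<in> C"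
  using subcat unfolding subcategory_of_Unif_def by blast

sublocale concrete_cat "full_subcat C"
  by (rule concrete_cat_full_subcat[OF C_subset])

text \<open>A bijection is a regular epimorphism in \<open>Set\<close>; reflection makes it one in
  \<open>C\<close>, and an injective regular epimorphism has an inverse.\<close>

lemma bijective_inverse:
  assumes X: "X \<in> C" and Y: "Y \<in> C" and h: "h \<in> ucont_maps X Y" "h ` points X = points Y" "inj_on h (points X)"
  shows "\<exists>g\<in>ucont_maps Y X. \<forall>x\<in>points X. g (h x) = x"
proof -
  have "regular_epi Set_cat (points X) (points Y) h"
    using Set_regular_epi_iff[of "points X" "points Y" h] small_points C_subset X Y ucont_mapsD(1)[OF h(1)] h(2) by blast
  moreover have "reflects_regular_epis (full_subcat C)"
    using varietal unfolding varietal_def algebraic_def by blast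
  ultimately have reg: "regular_epi (full_subcat C) X Y h"
    using X Y h(1) unfolding reflects_regular_epis_def full_subcat_simps by blast
  show ?thesis
  proof (rule regular_epi_inj_iso[of X Y h])
    fix g assume "g \<in> Mor (full_subcat C) Y X" "\<And>x. x \<in> Und (full_subcat C) X \<Longrightarrow> g (h x) = x"
    then show ?thesis unfolding full_subcat_simps by blast
  qed (use X Y h reg in simp_all)
qed

text \<open>Only the kernel of \<open>h\<close> is under control: nothing is said about surjectivity
  of \<open>h\<close> or about a quotient uniformity on \<open>Y\<close>. Later arguments use
  \<open>Y\<close> just as an object of \<open>C\<close>.\<close>

lemma congruence_quotient:
  assumes R: "R \<in> C" and X: "X \<in> C" and p: "p \<in> ucont_maps R X" and q: "q \<in> ucont_maps R X"
    and cong: "concrete_congruence (points R) (points X) p q"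
  shows "\<exists>Y\<in>C. \<exists>h\<in>ucont_maps X Y. \<forall>x\<in>points X. \<forall>y\<in>points X.
    h x = h y \<longleftrightarrow> (\<exists>r\<in>points R. p r = x \<and> q r = y)"
proof -
  have "congruence_relation Set_cat (points R) (points X) p q"
    using Set_congruence_iff[of "points R" "points X" p q] small_points C_subset R X
      ucont_mapsD(1)[OF p] ucont_mapsD(1)[OF q] cong by blast
  moreover have "reflects_congruence_relations (full_subcat C)"
    using varietal unfolding varietal_def by blast
  ultimately have "congruence_relation (full_subcat C) R X p q"
    using R X p q unfolding reflects_congruence_relations_def full_subcat_simps by blast
  then obtain Y h where Y: "Y \<in> C" and h: "h \<in> ucont_maps X Y" and ker: "is_kernel_pair (full_subcat C) R X Y h p q"
    unfolding congruence_relation_def full_subcat_simps by blast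
  have "h x = h y \<longleftrightarrow> (\<exists>r\<in>points R. p r = x \<and> q r = y)" if "x \<in> points X" "y \<in> points X" for x y
    using kernel_pair_imp_concrete(2)[of R X Y h p q x y] R X Y h ker that by simp
  then show ?thesis using Y h by blast
qed

text \<open>Surjectivity of the coequalizer is where preservation of regular epimorphisms
  enters.\<close>

lemma ex_coequalizer:
  assumes X: "X \<in> C" and Y: "Y \<in> C" and f: "f \<in> ucont_maps X Y" and g: "g \<in> ucont_maps X Y"
  shows "\<exists>Q\<in>C. \<exists>h\<in>ucont_maps Y Q. h ` points Y = points Q \<and> (\<forall>x\<in>points X. h (f x) = h (g x)) \<and>
    (\<forall>W\<in>C. \<forall>k\<in>ucont_maps Y W. (\<forall>x\<in>points X. k (f x) = k (g x)) \<longrightarrow>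
      (\<exists>m\<in>ucont_maps Q W. \<forall>y\<in>points Y. m (h y) = k y))"
proof -
  have "has_coequalizers (full_subcat C)" and pres: "preserves_regular_epis (full_subcat C)"
    using varietal unfolding varietal_def algebraic_def by blast+
  then obtain Q h where coeq: "is_coequalizer (full_subcat C) X Y f g Q h"
    using X Y f g unfolding has_coequalizers_def full_subcat_simps by blast
  have Q: "Q \<in> C" and h: "h \<in> ucont_maps Y Q" and eq: "compose (points X) h f = compose (points X) h g"
    and univ: "\<And>W k. W \<in> C \<Longrightarrow> k \<in> ucont_maps Y W \<Longrightarrow> compose (points X) k f = compose (points X) k g \<Longrightarrow>
      \<exists>!m. m \<in> ucont_maps Q W \<and> compose (points Y) m h = k"
    using coeq unfolding is_coequalizer_def full_subcat_simps by blast+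
  have "regular_epi (full_subcat C) Y Q h"
    unfolding regular_epi_def full_subcat_simps using X f g coeq by blast
  then have "regular_epi Set_cat (points Y) (points Q) h"
    using pres Y Q h unfolding preserves_regular_epis_def full_subcat_simps by blast
  then have surj: "h ` points Y = points Q"
    using Set_regular_epi_iff[of "points Y" "points Q" h] small_points C_subset Y Q ucont_mapsD(1)[OF h] by blast
  have hfg: "h (f x) = h (g x)" if "x \<in> points X" for x
    using fun_cong[OF eq, of x] that by (simp add: compose_def)
  have "\<exists>m\<in>ucont_maps Q W. \<forall>y\<in>points Y. m (h y) = k y"
    if W: "W \<in> C" and k: "k \<in> ucont_maps Y W" and kfg: "\<forall>x\<in>points X. k (f x) = k (g x)" for W k
  proof -
    have "compose (points X) k f = compose (points X) k g" using kfg by (auto simp: compose_def)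
    from univ[OF W k this] obtain m where m: "m \<in> ucont_maps Q W" "compose (points Y) m h = k" by blast
    have "m (h y) = k y" if "y \<in> points Y" for y
      using fun_cong[OF m(2), of y] that by (simp add: compose_def)
    then show ?thesis using m(1) by blast
  qed
  then have "h ` points Y = points Q \<and> (\<forall>x\<in>points X. h (f x) = h (g x)) \<and>
    (\<forall>W\<in>C. \<forall>k\<in>ucont_maps Y W. (\<forall>x\<in>points X. k (f x) = k (g x)) \<longrightarrow>
      (\<exists>m\<in>ucont_maps Q W. \<forall>y\<in>points Y. m (h y) = k y))"
    using surj hfg by (intro conjI ballI impI)
  then show ?thesis by (rule_tac bexI[OF _ Q], rule_tac bexI[OF _ h])
qed

text \<open>The empty product has one point, and one-point spaces are indiscrete, hence isomorphic
  to each other.\<close>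

lemma singleton_mem:
  assumes Y: "Y \<in> Ob_Unif" "is_singleton (points Y)"
  shows "Y \<in> C"
proof -
  have "small ({} :: 'u set)" using small_finite[of "{} :: 'u set"] by (simp add: small_def)
  then obtain A p where P: "concrete_product {} (\<lambda>_. undefined :: 'u uspace) A p"
    using ex_concrete_product[of "{}" "\<lambda>_. undefined :: 'u uspace"] by blast
  let ?T = "initial_uspace A {} (\<lambda>_. undefined :: 'u uspace) p"
  have T: "?T \<in> C" by (rule closed_under_productsD[OF products \<open>small {}\<close> _ P]) simp
  obtain t where t: "t \<in> A" using concrete_productD(6)[OF P] by blast
  have "z = t" if "z \<in> A" for z by (rule subsingleton_product[OF P _ that t]) simp
  then have A: "A = {t}" using t by blast
  obtain y where y: "points Y = {y}" using Y(2) by (auto simp: is_singleton_def)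
  have iT: "indiscrete ?T" by (rule indiscrete_if_subsingleton[OF mem_uspace[OF T]]) (simp add: A)
  have iY: "indiscrete Y" by (rule indiscrete_if_subsingleton[OF Ob_UnifD(1)[OF Y(1)]]) (simp add: y)
  have "bij_betw (\<lambda>_. y) (points ?T) (points Y)" by (simp add: A y bij_betw_def)
  then show ?thesis
    by (rule iso_closed[OF T Y(1) isomorphic_indiscrete[OF mem_uspace[OF T] iT Ob_UnifD(1)[OF Y(1)] iY]])
qed

lemma empty_mem:
  assumes Y: "Y \<in> Ob_Unif" "points Y = {}"
  shows "Y \<in> C"
proof -
  let ?T = "\<lparr>points = {undefined :: 'u}, unif = principal ({undefined} \<times> {undefined})\<rparr>"
  have "small {undefined :: 'u}" using small_finite[of "{undefined :: 'u}"] by (simp add: small_def)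
  then have "?T \<in> C" using is_uspace_indiscrete[of "{undefined :: 'u}"]
    by (intro singleton_mem) (simp_all add: Ob_Unif_def)
  then have E: "usubspace ?T {} \<in> C"
    using closed_subspaces closedin_empty[of "utopology ?T"] unfolding closed_under_closed_subspaces_def by blast
  have iE: "indiscrete (usubspace ?T {})" by (rule indiscrete_if_subsingleton[OF mem_uspace[OF E]]) simp
  have iY: "indiscrete Y" by (rule indiscrete_if_subsingleton[OF Ob_UnifD(1)[OF Y(1)]]) (simp add: Y(2))
  have "bij_betw (\<lambda>x. x) (points (usubspace ?T {})) (points Y)" by (simp add: Y(2) bij_betw_def)
  then show ?thesis
    by (rule iso_closed[OF E Y(1) isomorphic_indiscrete[OF mem_uspace[OF E] iE Ob_UnifD(1)[OF Y(1)] iY]])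
qed

lemma subsingleton_case:
  assumes "\<And>X x y. X \<in> C \<Longrightarrow> x \<in> points X \<Longrightarrow> y \<in> points X \<Longrightarrow> x = y"
  shows "C = {X \<in> Ob_Unif. finite (points X) \<and> card (points X) \<le> 1}"
  unfolding card_le_1_iff
proof (intro set_eqI iffI)
  fix X assume X: "X \<in> C"
  show "X \<in> {X \<in> Ob_Unif. \<forall>x\<in>points X. \<forall>y\<in>points X. x = y}"
    using subsetD[OF C_subset X] assms[OF X] by simp
next
  fix X :: "'u uspace" assume "X \<in> {X \<in> Ob_Unif. \<forall>x\<in>points X. \<forall>y\<in>points X. x = y}"
  then have X: "X \<in> Ob_Unif" and eq: "\<forall>x\<in>points X. \<forall>y\<in>points X. x = y" by blast+
  show "X \<in> C"
  proof (cases "points X = {}")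
    case True
    then show ?thesis using empty_mem X by blast
  next
    case False
    then obtain x where "x \<in> points X" by blast
    then have "points X = {x}" using eq by blast
    then show ?thesis using singleton_mem[OF X] by (simp add: is_singleton_def)
  qed
qed

section \<open>The case of an object that is not Hausdorff\<close>

lemma indiscrete_subspace:
  assumes X: "X \<in> C" and nH: "\<not> Hausdorff_space (utopology X)"
  shows "\<exists>J\<in>C. indiscrete J \<and> (\<exists>x\<in>points J. \<exists>y\<in>points J. x \<noteq> y)"
proof -
  note UX = mem_uspace[OF X]
  obtain x y where x: "x \<in> points X" and y: "y \<in> points X" and xy: "x \<noteq> y"
    and ins: "\<And>E. eventually E (unif X) \<Longrightarrow> E (x, y)"
    using nH unfolding Hausdorff_utopology_iff[OF UX] by blast
  \<comment> \<open>The closure of \<open>x\<close>: the points that no entourage separates from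
    \<open>x\<close>. By symmetry and halving, no entourage separates any two of them.\<close>
  let ?N = "{z \<in> points X. \<forall>E. eventually E (unif X) \<longrightarrow> E (x, z)}"
  have sub: "?N \<subseteq> points X" by blast
  have "openin (utopology X) (points X - ?N)"
    unfolding openin_utopology
  proof (intro conjI ballI)
    fix z assume z: "z \<in> points X - ?N"
    then obtain E where E: "eventually E (unif X)" "\<not> E (x, z)" by blast
    obtain D where D: "eventually D (unif X)" "\<forall>x y z. D (x, y) \<longrightarrow> D (y, z) \<longrightarrow> E (x, z)"
      "\<forall>x y. D (x, y) \<longrightarrow> D (y, x)" using unif_symtrans[OF UX E(1)] by blast
    have "w \<notin> ?N" if "D (z, w)" for w using D that E(2) by blast
    moreover have "eventually (\<lambda>p. D p \<and> p \<in> points X \<times> points X) (unif X)"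
      using D(1) unif_points[OF UX] by (rule eventually_conj)
    ultimately show "eventually (\<lambda>(x', y). x' = z \<longrightarrow> y \<in> points X - ?N) (unif X)"
      by (auto elim!: eventually_mono)
  qed blast
  then have N: "closedin (utopology X) ?N"
    unfolding closedin_def topspace_utopology[OF UX] using sub by blast
  have "principal (?N \<times> ?N) \<le> unif X"
  proof (rule filter_leI)
    fix E assume E: "eventually E (unif X)"
    obtain D where D: "eventually D (unif X)" "\<forall>x y z. D (x, y) \<longrightarrow> D (y, z) \<longrightarrow> E (x, z)"
      "\<forall>x y. D (x, y) \<longrightarrow> D (y, x)" using unif_symtrans[OF UX E] by blast
    have EN: "E (v, w)" if v: "v \<in> ?N" and w: "w \<in> ?N" for v w
    proof -
      have "D (x, v)" "D (x, w)" using v w D(1) by blast+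
      then show ?thesis using D(2,3) by blast
    qed
    have "E z" if "z \<in> ?N \<times> ?N" for z
      using that
    proof (rule SigmaE)
      fix v w assume vw: "v \<in> ?N" "w \<in> ?N" and z: "z = (v, w)"
      show "E z" unfolding z by (rule EN[OF vw])
    qed
    then show "eventually E (principal (?N \<times> ?N))" unfolding eventually_principal by blast
  qed
  then have "indiscrete (usubspace X ?N)" unfolding indiscrete_def usubspace_def by (simp add: inf_absorb2)
  moreover have "x \<in> ?N" using x unif_refl[OF UX _ x] by blast
  moreover have "y \<in> ?N" using y ins by blast
  ultimately show ?thesis
    using closed_subspaceD(1)[OF C_subset closed_subspaces X N] xy by (intro bexI[of _ "usubspace X ?N"] conjI) auto
qed

text \<open>An indiscrete power has only trivial closed subsets, so a subset of given size cannot be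
  cut out as a closed subspace. It appears instead as the image of a retraction, which is a morphism
  because every function into an indiscrete space is one.\<close>

lemma indiscrete_all_sizes:
  fixes B :: "'u set"
  assumes J: "J \<in> C" "indiscrete J" and x: "x \<in> points J" and y: "y \<in> points J" and xy: "x \<noteq> y"
    and B: "small B" "B \<noteq> {}"
  shows "\<exists>Q\<in>C. indiscrete Q \<and> (\<exists>f. bij_betw f B (points Q))"
proof -
  obtain A p where P: "concrete_product B (\<lambda>_. J) A p"
    using ex_concrete_product[OF B(1), of "\<lambda>_. J"] J(1) C_subset by blast
  let ?P = "initial_uspace A B (\<lambda>_. J) p"
  have PC: "?P \<in> C" by (rule closed_under_productsD[OF products B(1) J(1) P])
  have iP: "indiscrete ?P" by (rule initial_indiscrete[OF J(2) concrete_productD(3)[OF P]])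
  have "\<exists>a\<in>A. \<forall>i\<in>B. p i a = (if i = b then y else x)" for b
    by (rule concrete_productD(6)[OF P]) (simp add: x y)
  \<comment> \<open>A copy of \<open>B\<close> in the power: \<open>j b\<close> is the indicator
    function of \<open>b\<close>, with values \<open>y\<close> and \<open>x\<close>.\<close>
  then obtain j where j: "\<And>b. j b \<in> A" "\<And>b i. i \<in> B \<Longrightarrow> p i (j b) = (if i = b then y else x)" by metis
  have inj: "b = b'" if "b \<in> B" "j b = j b'" for b b'
    using j(2)[OF that(1), of b] j(2)[OF that(1), of b'] that(2) xy by (auto split: if_splits)
  obtain b0 where b0: "b0 \<in> B" using B(2) by blast
  let ?r = "\<lambda>a\<in>A. if a \<in> j ` B then a else j b0"
  have r: "?r \<in> ucont_maps ?P ?P"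
    unfolding ucont_to_indiscrete[OF mem_uspace[OF PC] iP] using j(1) by auto
  have id: "(\<lambda>a\<in>A. a) \<in> ucont_maps ?P ?P" using ucont_id[OF mem_uspace[OF PC]] by simp
  obtain Q h where Q: "Q \<in> C" and h: "h \<in> ucont_maps ?P Q" "h ` A = points Q"
    and hr: "\<forall>a\<in>A. h (?r a) = h ((\<lambda>a\<in>A. a) a)"
    and univ: "\<forall>W\<in>C. \<forall>k\<in>ucont_maps ?P W. (\<forall>a\<in>A. k (?r a) = k ((\<lambda>a\<in>A. a) a)) \<longrightarrow>
      (\<exists>m\<in>ucont_maps Q W. \<forall>a\<in>A. m (h a) = k a)"
    using ex_coequalizer[OF PC PC r id] unfolding points_initial by (elim bexE conjE) (rule that)
  have rr: "\<forall>a\<in>A. ?r (?r a) = ?r ((\<lambda>a\<in>A. a) a)" using j(1) b0 by simp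
  obtain m where m: "\<forall>a\<in>A. m (h a) = ?r a"
    using univ[rule_format, OF PC r] rr by blast
  have "bij_betw (\<lambda>b. h (j b)) B (points Q)"
    unfolding bij_betw_def
  proof
    show "inj_on (\<lambda>b. h (j b)) B"
    proof (rule inj_onI)
      fix b b' assume b: "b \<in> B" "b' \<in> B" and eq: "h (j b) = h (j b')"
      have mj: "m (h (j b)) = j b" "m (h (j b')) = j b'" using m[rule_format, OF j(1)] b j(1) by simp_all
      from arg_cong[OF eq, of m] have "j b = j b'" unfolding mj .
      then show "b = b'" by (rule inj[OF b(1)])
    qed
    show "(\<lambda>b. h (j b)) ` B = points Q"
    proof (intro set_eqI iffI)
      fix z assume "z \<in> (\<lambda>b. h (j b)) ` B"
      then show "z \<in> points Q" using h(2) j(1) by blast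
    next
      fix z assume "z \<in> points Q"
      then have "z \<in> h ` A" unfolding h(2) .
      then obtain a where a: "a \<in> A" "z = h a" by blast
      have "h (?r a) = z" using hr[rule_format, OF a(1)] a by simp
      moreover have "?r a \<in> j ` B" using a(1) b0 by simp
      then obtain b where "b \<in> B" "?r a = j b" by blast
      ultimately show "z \<in> (\<lambda>b. h (j b)) ` B" by (intro image_eqI[of _ _ b]) simp_all
    qed
  qed
  moreover have "indiscrete Q"
    unfolding indiscrete_def
  proof (rule antisym)
    show "unif Q \<le> principal (points Q \<times> points Q)" using mem_uspace[OF Q] unfolding is_uspace_def by blast
    show "principal (points Q \<times> points Q) \<le> unif Q"
    proof (rule filter_leI)
      fix E assume "eventually E (unif Q)"
      from ucont_eventually[OF h(1) this] have "\<forall>a\<in>A. \<forall>a'\<in>A. E (h a, h a')"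
        using iP by (simp add: indiscrete_def eventually_principal)
      then have "\<forall>z\<in>h ` A. \<forall>z'\<in>h ` A. E (z, z')" by blast
      then show "eventually E (principal (points Q \<times> points Q))"
        unfolding h(2) by (simp add: eventually_principal)
    qed
  qed
  ultimately show ?thesis using Q by blast
qed

lemma non_Hausdorff_case:
  assumes X: "X \<in> C" and nH: "\<not> Hausdorff_space (utopology X)"
  shows "C = {X \<in> Ob_Unif. indiscrete X}"
proof -
  obtain J x y where J: "J \<in> C" "indiscrete J" "x \<in> points J" "y \<in> points J" "x \<noteq> y"
    using indiscrete_subspace[OF X nH] by blast
  have sup: "Y \<in> C" if Y: "Y \<in> Ob_Unif" "indiscrete Y" for Y :: "'u uspace"
  proof (cases "points Y = {}")
    case True
    then show ?thesis by (rule empty_mem[OF Y(1)])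
  next
    case False
    obtain Q f where Q: "Q \<in> C" "indiscrete Q" and f: "bij_betw f (points Y) (points Q)"
      using indiscrete_all_sizes[OF J Ob_UnifD(2)[OF Y(1)] False] by blast
    have YQ: "isomorphic Unif Y Q"
      by (rule isomorphic_indiscrete[OF Ob_UnifD(1)[OF Y(1)] Y(2) mem_uspace[OF Q(1)] Q(2) f])
    show ?thesis by (rule iso_closed[OF Q(1) Y(1) isomorphic_sym[OF YQ]])
  qed
  have sub: "indiscrete Y" if Y: "Y \<in> C" for Y
  proof -
    \<comment> \<open>The indiscrete modification of \<open>Y\<close> is already known to be in
      \<open>C\<close>. The identity into it is bijective, so its inverse is uniformly continuous
      and \<open>Y\<close> is indiscrete too.\<close>
    let ?Y = "\<lparr>points = points Y, unif = principal (points Y \<times> points Y)\<rparr>"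
    have "?Y \<in> Ob_Unif" unfolding Ob_Unif_def
      using is_uspace_indiscrete[of "points Y"] Ob_UnifD(2)[OF subsetD[OF C_subset Y]] by simp
    moreover have iY: "indiscrete ?Y" by (simp add: indiscrete_def)
    ultimately have YC: "?Y \<in> C" by (rule sup)
    have id: "(\<lambda>x\<in>points Y. x) \<in> ucont_maps Y ?Y"
      unfolding ucont_to_indiscrete[OF mem_uspace[OF Y] iY] by simp
    have "(\<lambda>x\<in>points Y. x) ` points Y = points ?Y" by simp
    moreover have "inj_on (\<lambda>x\<in>points Y. x) (points Y)" by (simp add: inj_on_def)
    ultimately obtain g where g: "g \<in> ucont_maps ?Y Y" "\<forall>x\<in>points Y. g ((\<lambda>x\<in>points Y. x) x) = x"
      using bijective_inverse[OF Y YC id] by blast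
    show ?thesis
      unfolding indiscrete_def
    proof (rule antisym)
      show "unif Y \<le> principal (points Y \<times> points Y)" using mem_uspace[OF Y] unfolding is_uspace_def by blast
      show "principal (points Y \<times> points Y) \<le> unif Y"
      proof (rule filter_leI)
        fix E assume "eventually E (unif Y)"
        from ucont_eventually[OF g(1) this] have "\<forall>a\<in>points Y. \<forall>a'\<in>points Y. E (g a, g a')"
          by (simp add: eventually_principal)
        then show "eventually E (principal (points Y \<times> points Y))"
          using g(2) by (simp add: eventually_principal)
      qed
    qed
  qed
  show ?thesis
  proof (intro set_eqI iffI)
    fix Y assume "Y \<in> C"
    then show "Y \<in> {X \<in> Ob_Unif. indiscrete X}" using sub[of Y] subsetD[OF C_subset, of Y] by simp
  next
    fix Y :: "'u uspace" assume "Y \<in> {X \<in> Ob_Unif. indiscrete X}"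
    then show "Y \<in> C" using sup[of Y] by simp
  qed
qed

end


section \<open>The Hausdorff case: closed morphisms, compactness, and all compact Hausdorff
  spaces\<close>

context varietal_subcategory
begin

context
  fixes D :: "'u uspace" and c d :: 'u
  assumes D: "D \<in> C" "two_point D c d"
    and Hausdorff: "\<And>X. X \<in> C \<Longrightarrow> Hausdorff_space (utopology X)"
begin

lemma ucont_cont: "X \<in> C \<Longrightarrow> Y \<in> C \<Longrightarrow> f \<in> ucont_maps X Y \<Longrightarrow> continuous_map (utopology X) (utopology Y) f"
  using ucont_continuous mem_uspace by blast

lemma closed_equalizer:
  assumes "X \<in> C" "Y \<in> C" "f \<in> ucont_maps X Y" "g \<in> ucont_maps X Y"
  shows "closedin (utopology X) {x \<in> points X. f x = g x}"
  using closedin_continuous_maps_eq[OF Hausdorff[OF assms(2)] ucont_cont[OF assms(1,2,3)] ucont_cont[OF assms(1,2,4)]]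
  by (simp add: topspace_utopology[OF mem_uspace[OF assms(1)]])

lemma closed_preimage:
  assumes "X \<in> C" "Y \<in> C" "f \<in> ucont_maps X Y" "closedin (utopology Y) F"
  shows "closedin (utopology X) {x \<in> points X. f x \<in> F}"
  using closedin_continuous_map_preimage[OF ucont_cont[OF assms(1,2,3)] assms(4)]
  by (simp add: topspace_utopology[OF mem_uspace[OF assms(1)]])

lemma closed_subset_D: "S \<subseteq> {c, d} \<Longrightarrow> closedin (utopology D) S"
  unfolding two_pointD(6)[OF D(2)] by simp

text \<open>If \<open>m\<close> is injective, then two copies of \<open>X\<close> glued along the image of \<open>m\<close> form the quotient of \<open>X \<times> D\<close>
  by an equivalence relation which is the underlying set of an object: it is the closed subspace of
  \<open>X \<times> A \<times> D \<times> D\<close> consisting of all \<open>(x, a, i, j)\<close> with \<open>i = j\<close> and \<open>a = a0\<close>, or \<open>i \<noteq> j\<close> and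
  \<open>x = m a\<close>. Since congruence relations are reflected, the quotient is Hausdorff.\<close>

lemma injective_closed_image:
  assumes A: "A \<in> C" and X: "X \<in> C" and m: "m \<in> ucont_maps A X" and inj: "inj_on m (points A)"
  shows "closedin (utopology X) (m ` points A)"
proof (cases "points A = {}")
  case True
  then show ?thesis by simp
next
  case False
  then obtain a0 where a0: "a0 \<in> points A" by blast
  note ptsD = two_pointD(4)[OF D(2)] and cd = two_pointD(5)[OF D(2)]
  obtain V x1 i1 where V: "V \<in> C" "binary_product X D V x1 i1" by (rule ex_binary_product[OF C_subset products X D(1)])
  note Vp = binary_productD[OF V(2) mem_uspace[OF X] mem_uspace[OF D(1)]]
  obtain P1 u1 u2 where P1: "P1 \<in> C" "binary_product X A P1 u1 u2" by (rule ex_binary_product[OF C_subset products X A])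
  note P1p = binary_productD[OF P1(2) mem_uspace[OF X] mem_uspace[OF A]]
  obtain P2 v1 v2 where P2: "P2 \<in> C" "binary_product D D P2 v1 v2" by (rule ex_binary_product[OF C_subset products D(1) D(1)])
  note P2p = binary_productD[OF P2(2) mem_uspace[OF D(1)] mem_uspace[OF D(1)]]
  obtain P w1 w2 where P: "P \<in> C" "binary_product P1 P2 P w1 w2" by (rule ex_binary_product[OF C_subset products P1(1) P2(1)])
  note Pp = binary_productD[OF P(2) mem_uspace[OF P1(1)] mem_uspace[OF P2(1)]]
  let ?x = "compose (points P) u1 w1" and ?a = "compose (points P) u2 w1"
    and ?i = "compose (points P) v1 w2" and ?j = "compose (points P) v2 w2"
  have x: "?x \<in> ucont_maps P X" and a: "?a \<in> ucont_maps P A" and i: "?i \<in> ucont_maps P D" and j: "?j \<in> ucont_maps P D"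
    using ucont_compose[OF Pp(1) Pp(2) P1p(2)] ucont_compose[OF Pp(1) Pp(2) P1p(3)]
      ucont_compose[OF Pp(1) Pp(3) P2p(2)] ucont_compose[OF Pp(1) Pp(3) P2p(3)] by blast+
  have exP: "\<exists>z\<in>points P. ?x z = xx \<and> ?a z = aa \<and> ?i z = ii \<and> ?j z = jj"
    if pts: "xx \<in> points X" "aa \<in> points A" "ii \<in> points D" "jj \<in> points D" for xx aa ii jj
  proof -
    obtain y where y: "y \<in> points P1" "u1 y = xx" "u2 y = aa" using P1p(4)[OF pts(1,2)] by blast
    obtain v where v: "v \<in> points P2" "v1 v = ii" "v2 v = jj" using P2p(4)[OF pts(3,4)] by blast
    obtain z where z: "z \<in> points P" "w1 z = y" "w2 z = v" using Pp(4)[OF y(1) v(1)] by blast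
    then show ?thesis using y v by (intro bexI[of _ z]) (simp_all add: compose_def)
  qed
  have injP: "z = w" if z: "z \<in> points P" and w: "w \<in> points P"
    and eq: "?x z = ?x w" "?a z = ?a w" "?i z = ?i w" "?j z = ?j w" for z w
  proof (rule Pp(5)[OF z w])
    note mem = ucont_mapsD(3)[OF Pp(2)] ucont_mapsD(3)[OF Pp(3)]
    have "u1 (w1 z) = u1 (w1 w)" "u2 (w1 z) = u2 (w1 w)" "v1 (w2 z) = v1 (w2 w)" "v2 (w2 z) = v2 (w2 w)"
      using eq z w unfolding compose_def by simp_all
    then show "w1 z = w1 w" "w2 z = w2 w"
      using P1p(5)[OF mem(1)[OF z] mem(1)[OF w]] P2p(5)[OF mem(2)[OF z] mem(2)[OF w]] by blast+
  qed
  \<comment> \<open>The defining conditions of \<open>W\<close>, decomposed into equalizers and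
    preimages of points to make closedness evident. Fixing the value \<open>a0\<close> where
    \<open>i = j\<close> keeps the parametrization injective there.\<close>
  let ?F1 = "{z \<in> points P. ?i z = ?j z} \<inter> {z \<in> points P. ?a z \<in> {a0}}"
  let ?F2 = "({z \<in> points P. ?i z \<in> {c}} \<inter> {z \<in> points P. ?j z \<in> {d}} \<union>
      {z \<in> points P. ?i z \<in> {d}} \<inter> {z \<in> points P. ?j z \<in> {c}}) \<inter>
      {z \<in> points P. ?x z = compose (points P) m ?a z}"
  have ca0: "closedin (utopology A) {a0}"
    using closedin_Hausdorff_singleton[OF Hausdorff[OF A]] a0 topspace_utopology[OF mem_uspace[OF A]] by simp
  have "closedin (utopology P) ?F1"
    by (intro closedin_Int closed_equalizer[OF P(1) D(1) i j] closed_preimage[OF P(1) A a ca0])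
  moreover have ma: "compose (points P) m ?a \<in> ucont_maps P X" by (rule ucont_compose[OF Pp(1) a m])
  have "closedin (utopology P) ?F2"
    by (intro closedin_Int closedin_Un closed_equalizer[OF P(1) X x ma] closed_preimage[OF P(1) D(1) i]
        closed_preimage[OF P(1) D(1) j] closed_subset_D) simp_all
  ultimately have "closedin (utopology P) (?F1 \<union> ?F2)" by (rule closedin_Un)
  moreover define W where "W = {z \<in> points P. (?i z = ?j z \<and> ?a z = a0) \<or> (?i z \<noteq> ?j z \<and> ?x z = m (?a z))}"
  have "?F1 \<union> ?F2 = W"
  proof (intro set_eqI iffI)
    fix z assume "z \<in> ?F1 \<union> ?F2"
    then show "z \<in> W" unfolding W_def using cd by (auto simp: compose_def)
  next
    fix z assume z: "z \<in> W"
    then have zP: "z \<in> points P" unfolding W_def by blast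
    have "?i z \<in> {c, d}" "?j z \<in> {c, d}"
      using ucont_mapsD(3)[OF i zP] ucont_mapsD(3)[OF j zP] unfolding ptsD .
    moreover have "compose (points P) m ?a z = m (?a z)" using zP by (simp add: compose_def)
    ultimately show "z \<in> ?F1 \<union> ?F2" using z zP unfolding W_def by auto
  qed
  ultimately have W: "closedin (utopology P) W" by simp
  note sub = closed_subspaceD[OF C_subset closed_subspaces P(1) W]
  let ?R = "usubspace P W"
  have inc: "(\<lambda>z\<in>W. z) \<in> ucont_maps ?R P" by (rule ucont_inclusion[OF Pp(1) sub(2)])
  obtain p0 where p0: "p0 \<in> ucont_maps P V" "\<forall>z\<in>points P. x1 (p0 z) = ?x z \<and> i1 (p0 z) = ?i z"
    using Vp(6)[OF Pp(1) x i] by blast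
  obtain q0 where q0: "q0 \<in> ucont_maps P V" "\<forall>z\<in>points P. x1 (q0 z) = ?x z \<and> i1 (q0 z) = ?j z"
    using Vp(6)[OF Pp(1) x j] by blast
  have res: "compose W f (\<lambda>z\<in>W. z) = (\<lambda>z\<in>W. f z)" for f :: "'u \<Rightarrow> 'u" by (auto simp: compose_def)
  let ?p = "\<lambda>z\<in>W. p0 z" and ?q = "\<lambda>z\<in>W. q0 z"
  have p: "?p \<in> ucont_maps ?R V" and q: "?q \<in> ucont_maps ?R V"
    using ucont_compose[OF sub(3) inc p0(1)] ucont_compose[OF sub(3) inc q0(1)] unfolding points_usubspace res .
  define E where "E = {(v, w) \<in> points V \<times> points V. x1 v = x1 w \<and> (i1 v = i1 w \<or> x1 v \<in> m ` points A)}"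
  have im: "(\<lambda>r. (?p r, ?q r)) ` W = E"
  proof (intro set_eqI iffI)
    fix e assume "e \<in> (\<lambda>r. (?p r, ?q r)) ` W"
    then obtain z where z: "z \<in> W" "e = (p0 z, q0 z)" by auto
    then have zP: "z \<in> points P" using sub(2) by blast
    have "p0 z \<in> points V" "q0 z \<in> points V" using ucont_mapsD(3)[OF p0(1) zP] ucont_mapsD(3)[OF q0(1) zP] .
    moreover have "x1 (p0 z) = ?x z" "i1 (p0 z) = ?i z" "x1 (q0 z) = ?x z" "i1 (q0 z) = ?j z"
      using p0(2) q0(2) zP by blast+
    moreover have "?i z = ?j z \<or> ?x z \<in> m ` points A"
      using z(1) ucont_mapsD(3)[OF a zP] unfolding W_def by blast
    ultimately show "e \<in> E" unfolding E_def z(2) by simp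
  next
    fix e assume "e \<in> E"
    then obtain v w where e: "e = (v, w)" and v: "v \<in> points V" and w: "w \<in> points V" and xx: "x1 v = x1 w"
      and or: "i1 v = i1 w \<or> x1 v \<in> m ` points A" unfolding E_def by blast
    have vX: "x1 v \<in> points X" using ucont_mapsD(3)[OF Vp(2) v] .
    have vD: "i1 v \<in> points D" "i1 w \<in> points D" using ucont_mapsD(3)[OF Vp(3) v] ucont_mapsD(3)[OF Vp(3) w] .
    obtain z where z: "z \<in> W" "?x z = x1 v" "?i z = i1 v" "?j z = i1 w"
    proof (cases "i1 v = i1 w")
      case True
      obtain z where "z \<in> points P" "?x z = x1 v" "?a z = a0" "?i z = i1 v" "?j z = i1 w"
        using exP[OF vX a0 vD] by blast
      then show ?thesis using True by (intro that[of z]) (simp_all add: W_def)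
    next
      case False
      then obtain \<alpha> where \<alpha>: "\<alpha> \<in> points A" "x1 v = m \<alpha>" using or by blast
      obtain z where "z \<in> points P" "?x z = x1 v" "?a z = \<alpha>" "?i z = i1 v" "?j z = i1 w"
        using exP[OF vX \<alpha>(1) vD] by blast
      then show ?thesis using False \<alpha>(2) by (intro that[of z]) (simp_all add: W_def)
    qed
    have zP: "z \<in> points P" using z(1) sub(2) by blast
    have "p0 z = v"
      using Vp(5)[OF ucont_mapsD(3)[OF p0(1) zP] v] p0(2)[rule_format, OF zP] z by simp
    moreover have "q0 z = w"
      using Vp(5)[OF ucont_mapsD(3)[OF q0(1) zP] w] q0(2)[rule_format, OF zP] z xx by simp
    ultimately show "e \<in> (\<lambda>r. (?p r, ?q r)) ` W" unfolding e using z(1) by (intro image_eqI[of _ _ z]) simp_all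
  qed
  have "inj_on (\<lambda>r. (?p r, ?q r)) W"
  proof (rule inj_onI)
    fix r s assume r: "r \<in> W" and s: "s \<in> W" and eq: "(?p r, ?q r) = (?p s, ?q s)"
    have rs: "r \<in> points P" "s \<in> points P" using r s sub(2) by blast+
    have pq: "p0 r = p0 s" "q0 r = q0 s" using eq r s by simp_all
    have xr: "?x r = ?x s"
      using p0(2)[rule_format, OF rs(1)] p0(2)[rule_format, OF rs(2)] arg_cong[OF pq(1), of x1] by metis
    have ir: "?i r = ?i s"
      using p0(2)[rule_format, OF rs(1)] p0(2)[rule_format, OF rs(2)] arg_cong[OF pq(1), of i1] by metis
    have jr: "?j r = ?j s"
      using q0(2)[rule_format, OF rs(1)] q0(2)[rule_format, OF rs(2)] arg_cong[OF pq(2), of i1] by metis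
    \<comment> \<open>Here injectivity of \<open>m\<close> is used: where \<open>i\<close> and
      \<open>j\<close> differ, the coordinate \<open>a\<close> is recovered from
      \<open>x\<close>.\<close>
    have "?a r = ?a s"
    proof (cases "?i r = ?j r")
      case True
      then have "?a r = a0" using r unfolding W_def by blast
      moreover have "?i s = ?j s" using True ir jr by metis
      then have "?a s = a0" using s unfolding W_def by blast
      ultimately show ?thesis by metis
    next
      case False
      then have "?x r = m (?a r)" using r unfolding W_def by blast
      moreover have "?i s \<noteq> ?j s" using False ir jr by metis
      then have "?x s = m (?a s)" using s unfolding W_def by blast
      ultimately have "m (?a r) = m (?a s)" using xr by metis
      then show ?thesis by (rule inj_onD[OF inj _ ucont_mapsD(3)[OF a rs(1)] ucont_mapsD(3)[OF a rs(2)]])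
    qed
    with xr show "r = s" by (intro injP[OF rs _ _ ir jr])
  qed
  moreover have "equiv (points V) E"
  proof (rule equivI)
    show "E \<subseteq> points V \<times> points V" unfolding E_def by blast
    show "refl_on (points V) E" unfolding E_def by (rule refl_onI) simp
    show "sym E" unfolding E_def by (rule symI) (simp, metis)
    show "trans E" unfolding E_def by (rule transI) (simp, metis)
  qed
  ultimately have "concrete_congruence (points ?R) (points V) ?p ?q"
    unfolding concrete_congruence_def points_usubspace im by blast
  from congruence_quotient[OF sub(1) V(1) p q this]
  obtain Y h where Y: "Y \<in> C" and h: "h \<in> ucont_maps V Y"
    and ker: "\<forall>v\<in>points V. \<forall>w\<in>points V. h v = h w \<longleftrightarrow> (\<exists>r\<in>points ?R. ?p r = v \<and> ?q r = w)"
    by blast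
  have hE: "h v = h w \<longleftrightarrow> (v, w) \<in> E" if "v \<in> points V" "w \<in> points V" for v w
    using ker[rule_format, OF that] unfolding im[symmetric] points_usubspace by blast
  \<comment> \<open>Each sheet of \<open>X \<times> D\<close> gives a section. After gluing, the two
    sections agree exactly over the image of \<open>m\<close>, which is thereby an equalizer of maps
    into a Hausdorff object.\<close>
  have sec: "\<exists>s\<in>ucont_maps X V. \<forall>y\<in>points X. x1 (s y) = y \<and> i1 (s y) = k" if k: "k \<in> points D" for k
  proof -
    obtain s where s: "s \<in> ucont_maps X V" "\<forall>z\<in>points X. x1 (s z) = (\<lambda>x\<in>points X. x) z \<and> i1 (s z) = (\<lambda>x\<in>points X. k) z"
      using Vp(6)[OF mem_uspace[OF X] ucont_id[OF mem_uspace[OF X]] ucont_const[OF mem_uspace[OF X] mem_uspace[OF D(1)] k]] by blast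
    have "\<forall>y\<in>points X. x1 (s y) = y \<and> i1 (s y) = k" using s(2) by simp
    then show ?thesis using s(1) by blast
  qed
  obtain s where s: "s \<in> ucont_maps X V" "\<forall>y\<in>points X. x1 (s y) = y \<and> i1 (s y) = c"
    using sec[of c] ptsD by blast
  obtain t where t: "t \<in> ucont_maps X V" "\<forall>y\<in>points X. x1 (t y) = y \<and> i1 (t y) = d"
    using sec[of d] ptsD by blast
  have "closedin (utopology X) {y \<in> points X. compose (points X) h s y = compose (points X) h t y}"
    by (rule closed_equalizer[OF X Y ucont_compose[OF mem_uspace[OF X] s(1) h] ucont_compose[OF mem_uspace[OF X] t(1) h]])
  moreover have "compose (points X) h s y = compose (points X) h t y \<longleftrightarrow> y \<in> m ` points A" if y: "y \<in> points X" for y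
  proof -
    have sV: "s y \<in> points V" "t y \<in> points V" using ucont_mapsD(3)[OF s(1) y] ucont_mapsD(3)[OF t(1) y] .
    have st: "x1 (s y) = y" "i1 (s y) = c" "x1 (t y) = y" "i1 (t y) = d" using s(2) t(2) y by simp_all
    have "h (s y) = h (t y) \<longleftrightarrow> y \<in> m ` points A" unfolding hE[OF sV] E_def using sV st cd by simp
    then show ?thesis using y by (simp add: compose_def)
  qed
  then have "{y \<in> points X. compose (points X) h s y = compose (points X) h t y} = m ` points A"
    using ucont_mapsD(3)[OF m] by blast
  ultimately show ?thesis by simp
qed

text \<open>The kernel of \<open>f\<close> is a closed relation and hence an object. The coequalizer
  of its two projections splits \<open>f\<close> into a surjection followed by an injective morphism
  with the same image.\<close>

lemma closed_image:
  assumes B: "B \<in> C" and X: "X \<in> C" and f: "f \<in> ucont_maps B X"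
  shows "closedin (utopology X) (f ` points B)"
proof -
  let ?E = "{(x, y) \<in> points B \<times> points B. f x = f y}"
  have "closedin (prod_topology (utopology B) (utopology B)) ?E"
    by (rule closedin_graph_rel[OF mem_uspace[OF B] mem_uspace[OF X] Hausdorff[OF X] f])
  from closed_relation_object[OF C_subset products closed_subspaces B this]
  obtain R p q where R: "R \<in> C" and p: "p \<in> ucont_maps R B" and q: "q \<in> ucont_maps R B"
    and im: "(\<lambda>r. (p r, q r)) ` points R = ?E" by blast
  obtain Q h where Q: "Q \<in> C" and h: "h \<in> ucont_maps B Q" "h ` points B = points Q"
    and hpq: "\<forall>r\<in>points R. h (p r) = h (q r)"
    and univ: "\<forall>W\<in>C. \<forall>k\<in>ucont_maps B W. (\<forall>r\<in>points R. k (p r) = k (q r)) \<longrightarrow>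
      (\<exists>m\<in>ucont_maps Q W. \<forall>y\<in>points B. m (h y) = k y)"
    using ex_coequalizer[OF R B p q] by (elim bexE conjE) (rule that)
  have "f (p r) = f (q r)" if "r \<in> points R" for r
    using imageI[OF that, of "\<lambda>r. (p r, q r)"] unfolding im by simp
  then obtain n where n: "n \<in> ucont_maps Q X" "\<forall>y\<in>points B. n (h y) = f y"
    using univ[rule_format, OF X f] by blast
  have "inj_on n (points Q)"
  proof (rule inj_onI)
    fix v w assume "v \<in> points Q" "w \<in> points Q" and eq: "n v = n w"
    then have "v \<in> h ` points B" "w \<in> h ` points B" unfolding h(2) by blast+
    then obtain y z where yz: "y \<in> points B" "z \<in> points B" "v = h y" "w = h z" by blast
    then have "f y = f z" using eq n(2) by metis
    then have "(y, z) \<in> (\<lambda>r. (p r, q r)) ` points R" unfolding im using yz(1,2) by simp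
    then obtain r where "r \<in> points R" "y = p r" "z = q r" by blast
    then show "v = w" using hpq yz(3,4) by simp
  qed
  from injective_closed_image[OF Q X n(1) this]
  have "closedin (utopology X) (n ` h ` points B)" unfolding h(2) .
  moreover have "n ` h ` points B = f ` points B" unfolding image_image using n(2) by (intro image_cong) simp_all
  ultimately show ?thesis by simp
qed

lemma closed_maps:
  assumes B: "B \<in> C" and X: "X \<in> C" and f: "f \<in> ucont_maps B X" and F: "closedin (utopology B) F"
  shows "closedin (utopology X) (f ` F)"
proof -
  note sub = closed_subspaceD[OF C_subset closed_subspaces B F]
  have "compose F f (\<lambda>x\<in>F. x) \<in> ucont_maps (usubspace B F) X"
    using ucont_compose[OF sub(3) ucont_inclusion[OF mem_uspace[OF B] sub(2)] f] by simp
  from closed_image[OF sub(1) X this]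
  have "closedin (utopology X) (compose F f (\<lambda>x\<in>F. x) ` F)" by simp
  moreover have "compose F f (\<lambda>x\<in>F. x) ` F = f ` F" by (intro image_cong) (simp_all add: compose_def)
  ultimately show ?thesis by simp
qed

lemma power_of_D:
  assumes "small I"
  shows "\<exists>A p. concrete_product I (\<lambda>_. D) A p \<and> initial_uspace A I (\<lambda>_. D) p \<in> C"
proof -
  obtain A p where P: "concrete_product I (\<lambda>_. D) A p"
    using ex_concrete_product[OF assms, of "\<lambda>_. D"] D(1) C_subset by blast
  have "initial_uspace A I (\<lambda>_. D) p \<in> C" by (rule closed_under_productsD[OF products assms D(1) P])
  then show ?thesis using P by blast
qed

text \<open>Given a family \<open>\<U>\<close> of closed sets with the finite intersection property, the set of all \<open>(x, y)\<close> in
  \<open>X \<times> D\<^sup>\<U>\<close> such that \<open>x \<in> F\<close> whenever \<open>y\<close> is \<open>d\<close> at \<open>F\<close> is closed, hence so is its projection to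
  \<open>D\<^sup>\<U>\<close>. The constant function \<open>d\<close> is in the closure of this projection.\<close>

lemma object_compact:
  assumes X: "X \<in> C"
  shows "compact_space (utopology X)"
  unfolding compact_space_fip
proof (intro allI impI)
  fix \<U> assume \<U>: "(\<forall>F\<in>\<U>. closedin (utopology X) F) \<and> (\<forall>\<F>. finite \<F> \<and> \<F> \<subseteq> \<U> \<longrightarrow> \<Inter>\<F> \<noteq> {})"
  note UX = mem_uspace[OF X] and ptsD = two_pointD(4)[OF D(2)] and cd = two_pointD(5)[OF D(2)]
  show "\<Inter>\<U> \<noteq> {}"
  proof (cases "\<U> = {}")
    case False
    then obtain F0 where F0: "F0 \<in> \<U>" by blast
    have FX: "F \<subseteq> points X" if "F \<in> \<U>" for F
      using closedin_subset[of "utopology X" F] \<U> that by (simp add: topspace_utopology[OF UX])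
    have "Pow (points X) \<prec> (UNIV :: 'u set)"
      using small_Pow[of "points X"] small_points[OF subsetD[OF C_subset X]] by (simp add: small_def)
    moreover have "\<U> \<subseteq> Pow (points X)" using FX by blast
    ultimately have "\<U> \<prec> (UNIV :: 'u set)" using small_lepoll[OF subset_imp_lepoll] by blast
    then obtain code :: "'u set \<Rightarrow> 'u" where code: "inj_on code \<U>" "small (code ` \<U>)" by (rule ex_encoding)
    let ?I = "code ` \<U>"
    obtain A p where Pr: "concrete_product ?I (\<lambda>_. D) A p" and K: "initial_uspace A ?I (\<lambda>_. D) p \<in> C" (is "?K \<in> C")
      using power_of_D[OF code(2)] by blast
    have unif_K: "unif ?K = inf (INF i\<in>?I. filtercomap (map_prod (p i) (p i)) (unif D)) (principal (A \<times> A))"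
      by (simp add: initial_uspace_def inf_commute)
    \<comment> \<open>Points of the power are prescribed by predicates on \<open>\<U>\<close>; the
      constantly true predicate and membership of a given point will be used.\<close>
    have elt: "\<exists>y\<in>A. \<forall>F\<in>\<U>. p (code F) y = (if \<Phi> F then d else c)" for \<Phi>
    proof -
      have "\<exists>y\<in>A. \<forall>i\<in>?I. p i y = (if \<Phi> (inv_into \<U> code i) then d else c)"
        by (rule concrete_productD(6)[OF Pr]) (simp add: ptsD)
      then obtain y where y: "y \<in> A" "\<forall>i\<in>?I. p i y = (if \<Phi> (inv_into \<U> code i) then d else c)" by blast
      have "p (code F) y = (if \<Phi> F then d else c)" if "F \<in> \<U>" for F
        using y(2)[rule_format, OF imageI[OF that, of code]] inv_into_f_f[OF code(1) that] by simp
      then show ?thesis using y(1) by blast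
    qed
    obtain B q r where B: "B \<in> C" "binary_product X ?K B q r" by (rule ex_binary_product[OF C_subset products X K])
    note Bp = binary_productD[OF B(2) UX mem_uspace[OF K]]
    \<comment> \<open>The implication for the coordinate \<open>F\<close> becomes a union of two
      closed preimages, \<open>c\<close> being the only value other than \<open>d\<close>.\<close>
    let ?S = "\<lambda>F. {z \<in> points B. compose (points B) (p (code F)) r z \<in> {c}} \<union> {z \<in> points B. q z \<in> F}"
    define G where "G = \<Inter>(?S ` \<U>)"
    have G: "closedin (utopology B) G"
      unfolding G_def
    proof (rule closedin_Inter)
      fix T assume "T \<in> ?S ` \<U>"
      then obtain F where F: "F \<in> \<U>" "T = ?S F" by (rule imageE)
      have pF: "p (code F) \<in> ucont_maps ?K D" by (rule concrete_productD(4)[OF Pr imageI[OF F(1)]])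
      have "closedin (utopology X) F" using \<U> F(1) by blast
      then show "closedin (utopology B) T" unfolding F(2)
        by (intro closedin_Un closed_preimage[OF B(1) D(1) ucont_compose[OF Bp(1) Bp(3) pF]]
            closed_preimage[OF B(1) X Bp(2)] closed_subset_D) simp_all
    qed (use False in blast)
    have GB: "z \<in> points B" "\<forall>F\<in>\<U>. p (code F) (r z) = c \<or> q z \<in> F" if "z \<in> G" for z
    proof -
      have zS: "z \<in> ?S F" if "F \<in> \<U>" for F using \<open>z \<in> G\<close> that unfolding G_def by blast
      show zB: "z \<in> points B" using zS[OF F0] by blast
      show "\<forall>F\<in>\<U>. p (code F) (r z) = c \<or> q z \<in> F"
      proof
        fix F assume "F \<in> \<U>"
        from zS[OF this] show "p (code F) (r z) = c \<or> q z \<in> F" using zB by (simp add: compose_def)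
      qed
    qed
    have rG: "closedin (utopology ?K) (r ` G)" by (rule closed_maps[OF B(1) K Bp(3) G])
    obtain y1 where y1: "y1 \<in> A" "\<forall>F\<in>\<U>. p (code F) y1 = (if True then d else c)" using elt[of "\<lambda>_. True"] by blast
    have "y1 \<in> r ` G"
    proof (rule ccontr)
      assume n: "y1 \<notin> r ` G"
      have "openin (utopology ?K) (points ?K - r ` G)"
        using rG unfolding closedin_def topspace_utopology[OF mem_uspace[OF K]] by blast
      moreover have "y1 \<in> points ?K - r ` G" using y1(1) n by simp
      ultimately have "eventually (\<lambda>(y', w). y' = y1 \<longrightarrow> w \<in> points ?K - r ` G) (unif ?K)"
        unfolding openin_utopology by blast
      then have "eventually (\<lambda>z. z \<in> A \<times> A \<longrightarrow> (case z of (y', w) \<Rightarrow> y' = y1 \<longrightarrow> w \<in> points ?K - r ` G))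
          (INF i\<in>?I. filtercomap (map_prod (p i) (p i)) (unif D))" (is "eventually ?P _")
        unfolding unif_K eventually_inf_principal .
      then obtain J where J: "J \<subseteq> ?I" "finite J"
        "eventually ?P (INF i\<in>J. filtercomap (map_prod (p i) (p i)) (unif D))"
        unfolding eventually_INF[of _ _ ?I] by blast
      obtain \<F> where \<F>: "\<F> \<subseteq> \<U>" "finite \<F>" "J = code ` \<F>" using finite_subset_image[OF J(2,1)] by blast
      \<comment> \<open>Including \<open>F0\<close> keeps the common point inside
        \<open>points X\<close> even when \<open>\<F>\<close> is empty.\<close>
      have "finite (insert F0 \<F>) \<and> insert F0 \<F> \<subseteq> \<U>" using \<F>(1,2) F0 by simp
      then have "\<Inter>(insert F0 \<F>) \<noteq> {}" using \<U> by blast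
      then obtain x where x: "x \<in> F0" "\<forall>F\<in>\<F>. x \<in> F" by blast
      have xX: "x \<in> points X" using x(1) FX[OF F0] by blast
      obtain y where y: "y \<in> A" "\<forall>F\<in>\<U>. p (code F) y = (if x \<in> F then d else c)" using elt[of "\<lambda>F. x \<in> F"] by blast
      have "principal {(y1, y)} \<le> (INF i\<in>J. filtercomap (map_prod (p i) (p i)) (unif D))"
      proof (rule INF_greatest, rule filter_leI)
        fix i E assume i: "i \<in> J" and "eventually E (filtercomap (map_prod (p i) (p i)) (unif D))"
        then obtain Q where Q: "eventually Q (unif D)" "\<And>z. Q (map_prod (p i) (p i) z) \<Longrightarrow> E z"
          unfolding eventually_filtercomap by blast
        obtain F where F: "F \<in> \<F>" "i = code F" using i unfolding \<F>(3) by blast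
        then have "p i y1 = d" "p i y = d" using y1(2) y(2) x(2) \<F>(1) by auto
        moreover have "Q (d, d)" by (rule unif_refl[OF mem_uspace[OF D(1)] Q(1)]) (simp add: ptsD)
        ultimately have "E (y1, y)" by (intro Q(2)) simp
        then show "eventually E (principal {(y1, y)})" by (simp add: eventually_principal)
      qed
      from filter_leD[OF this J(3)] have "y \<notin> r ` G"
        using y1(1) y(1) by (simp add: eventually_principal)
      moreover have "\<exists>z\<in>points B. q z = x \<and> r z = y" by (rule Bp(4)) (simp_all add: xX y(1))
      then obtain z where z: "z \<in> points B" "q z = x" "r z = y" by blast
      then have "z \<in> G" unfolding G_def using y(2) by (auto simp: compose_def)
      ultimately show False using z(3) by blast
    qed
    then obtain z where "z \<in> G" "y1 = r z" by blast
    then have "\<forall>F\<in>\<U>. q z \<in> F" using GB(2)[of z] y1(2) cd by auto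
    then show ?thesis by blast
  qed simp
qed

text \<open>The free compact space \<open>?Z\<close> on the points of \<open>K\<close> is a closed
  subspace of a power of \<open>D\<close> and so lies in \<open>C\<close>, and the kernel of its
  surjection onto \<open>K\<close> is a closed congruence. The reflected quotient only provides a
  map \<open>h\<close> to some \<open>Y\<close> with this kernel, so \<open>K\<close> is recovered
  as the image of \<open>h\<close>.\<close>

lemma compact_mem:
  assumes K: "K \<in> compact_spaces"
  shows "K \<in> C"
proof -
  let ?S = "points K"
  have UK: "is_uspace K" and sm: "small ?S" using K Ob_UnifD by blast+
  have Kc: "compact_space (utopology K)" and KH: "Hausdorff_space (utopology K)" using K by (auto simp: compact_T2_def)
  have "Pow ?S \<prec> (UNIV :: 'u set)" using small_Pow[of ?S] sm by (simp add: small_def)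
  then obtain code :: "'u set \<Rightarrow> 'u" where code: "inj_on code (Pow ?S)" "small (code ` Pow ?S)" by (rule ex_encoding)
  obtain A p where P: "concrete_product (code ` Pow ?S) (\<lambda>_. D) A p"
    and P0: "initial_uspace A (code ` Pow ?S) (\<lambda>_. D) p \<in> C" (is "?P \<in> C")
    using power_of_D[OF code(2)] by blast
  obtain F e where F: "closedin (utopology ?P) F"
    and ua: "universal_arrow (full_subcat compact_spaces) ?S (usubspace ?P F) e"
    using universal_arrow_compact[OF D(2) code(1) P] by blast
  let ?Z = "usubspace ?P F"
  have Z: "?Z \<in> C" by (rule closed_subspaceD(1)[OF C_subset closed_subspaces P0 F])
  have "?Z \<in> compact_spaces" and e: "e \<in> ?S \<rightarrow>\<^sub>E points ?Z"
    using ua unfolding universal_arrow_def full_subcat_simps by blast+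
  then have Zc: "compact_space (utopology ?Z)" by (auto simp: compact_T2_def)
  have "(\<lambda>x\<in>?S. x) \<in> ?S \<rightarrow>\<^sub>E points K" by simp
  then obtain m where m: "m \<in> ucont_maps ?Z K" "compose ?S m e = (\<lambda>x\<in>?S. x)"
    using ua K unfolding universal_arrow_def full_subcat_simps by blast
  have me: "m (e x) = x" if "x \<in> ?S" for x using fun_cong[OF m(2), of x] that by (simp add: compose_def)
  have surj: "m ` points ?Z = points K"
  proof (intro set_eqI iffI)
    fix x assume "x \<in> m ` points ?Z"
    then show "x \<in> points K" using ucont_mapsD(3)[OF m(1)] by blast
  next
    fix x assume x: "x \<in> points K"
    have "e x \<in> points ?Z" using e x by (rule PiE_mem)
    then show "x \<in> m ` points ?Z" using me[OF x] by (intro image_eqI[of _ _ "e x"]) simp_all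
  qed
  let ?E = "{(x, y) \<in> points ?Z \<times> points ?Z. m x = m y}"
  have "closedin (prod_topology (utopology ?Z) (utopology ?Z)) ?E"
    by (rule closedin_graph_rel[OF mem_uspace[OF Z] UK KH m(1)])
  from closed_relation_object[OF C_subset products closed_subspaces Z this]
  obtain R a b where R: "R \<in> C" and a: "a \<in> ucont_maps R ?Z" and b: "b \<in> ucont_maps R ?Z"
    and inj: "inj_on (\<lambda>r. (a r, b r)) (points R)" and im: "(\<lambda>r. (a r, b r)) ` points R = ?E" by blast
  have "equiv (points ?Z) ?E"
    by (rule equivI) (auto intro!: refl_onI symI transI)
  then have "concrete_congruence (points R) (points ?Z) a b"
    unfolding concrete_congruence_def im using inj by blast
  from congruence_quotient[OF R Z a b this]
  obtain Y h where Y: "Y \<in> C" and h: "h \<in> ucont_maps ?Z Y"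
    and ker: "\<forall>x\<in>points ?Z. \<forall>y\<in>points ?Z. h x = h y \<longleftrightarrow> (\<exists>r\<in>points R. a r = x \<and> b r = y)" by blast
  have hm: "h x = h y \<longleftrightarrow> m x = m y" if "x \<in> points ?Z" "y \<in> points ?Z" for x y
  proof -
    have "h x = h y \<longleftrightarrow> (x, y) \<in> (\<lambda>r. (a r, b r)) ` points R" using ker[rule_format, OF that] by blast
    then show ?thesis unfolding im using that by simp
  qed
  \<comment> \<open>The map \<open>m\<close> is a topological quotient onto \<open>K\<close>, so
    \<open>h\<close> descends to \<open>K\<close>; equality of the two kernels makes
    \<open>n\<close> injective.\<close>
  have "\<exists>n\<in>ucont_maps K Y. compose (points ?Z) n m = h"
    by (rule compact_factor[OF mem_uspace[OF Z] UK mem_uspace[OF Y] Zc KH m(1) surj h]) (rule hm[THEN iffD2])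
  then obtain n where n: "n \<in> ucont_maps K Y" "compose (points ?Z) n m = h" by blast
  have nm: "n (m z) = h z" if "z \<in> points ?Z" for z using fun_cong[OF n(2), of z] that by (simp add: compose_def)
  have inj_n: "inj_on n (points K)"
  proof (rule inj_onI)
    fix x y assume x: "x \<in> points K" and y: "y \<in> points K" and eq: "n x = n y"
    have ex: "e x \<in> points ?Z" "e y \<in> points ?Z" using PiE_mem[OF e x] PiE_mem[OF e y] .
    have "h (e x) = h (e y)" using nm[OF ex(1)] nm[OF ex(2)] me[OF x] me[OF y] eq by metis
    then have "m (e x) = m (e y)" using hm[OF ex] by blast
    then show "x = y" unfolding me[OF x] me[OF y] .
  qed
  have "n ` m ` points ?Z = h ` points ?Z"
    unfolding image_image by (rule image_cong[OF refl nm])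
  then have "n ` points K = h ` points ?Z" unfolding surj .
  \<comment> \<open>As \<open>h\<close> need not be onto, closedness of images in \<open>C\<close>
    is what turns the copy of \<open>K\<close> inside \<open>Y\<close> into an object.\<close>
  then have cl: "closedin (utopology Y) (n ` points K)" using closed_image[OF Z Y h] by simp
  note sub = closed_subspaceD[OF C_subset closed_subspaces Y cl]
  let ?Y = "usubspace Y (n ` points K)"
  have nY: "n \<in> ucont_maps K ?Y" using n(1) by (subst ucont_usubspace_iff[OF UK sub(2)]) simp
  have "isomorphic Unif K ?Y"
    by (rule compact_Hausdorff_iso[OF UK sub(3) Kc Hausdorff[OF sub(1)] nY _ inj_n]) simp
  from isomorphic_sym[OF this] show ?thesis using iso_closed[OF sub(1)] K by blast
qed

end

theorem classification: "trivial_or_indiscrete_or_compact_T2 C"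
proof (cases "\<forall>X\<in>C. \<forall>x\<in>points X. \<forall>y\<in>points X. x = y")
  case True
  then have "C = {X \<in> Ob_Unif. finite (points X) \<and> card (points X) \<le> 1}"
    by (intro subsingleton_case) blast
  then show ?thesis unfolding trivial_or_indiscrete_or_compact_T2_def by blast
next
  case False
  then obtain X c d where X: "X \<in> C" and c: "c \<in> points X" and d: "d \<in> points X" and cd: "c \<noteq> d" by blast
  show ?thesis
  proof (cases "\<forall>X\<in>C. Hausdorff_space (utopology X)")
    case True
    have H: "Hausdorff_space (utopology X)" if "X \<in> C" for X using True that by blast
    \<comment> \<open>Finite subsets of a Hausdorff space are closed; this is the source of the
      discrete two-point object.\<close>
    have "closedin (utopology X) {c, d}"
      using closedin_Hausdorff_finite[OF H[OF X], of "{c, d}"] c d by (simp add: topspace_utopology[OF mem_uspace[OF X]])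
    note sub = closed_subspaceD[OF C_subset closed_subspaces X this]
    have D: "two_point (usubspace X {c, d}) c d"
      unfolding two_point_def using subsetD[OF C_subset sub(1)] H[OF sub(1)] cd by simp
    have "C = compact_spaces"
    proof (intro set_eqI iffI)
      fix Y assume Y: "Y \<in> C"
      have "compact_space (utopology Y)" by (rule object_compact[OF sub(1) D H Y])
      then show "Y \<in> compact_spaces"
        using subsetD[OF C_subset Y] H[OF Y] unfolding compact_T2_def by blast
    next
      fix Y :: "'u uspace" assume Y: "Y \<in> compact_spaces"
      show "Y \<in> C" by (rule compact_mem[OF sub(1) D H Y])
    qed
    then show ?thesis unfolding trivial_or_indiscrete_or_compact_T2_def by blast
  next
    case False
    then obtain Y where "Y \<in> C" "\<not> Hausdorff_space (utopology Y)" by blast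
    from non_Hausdorff_case[OF this] show ?thesis unfolding trivial_or_indiscrete_or_compact_T2_def by blast
  qed
qed

end

theorem theorem6:
  assumes "inaccessible_type TYPE('u)"
  shows "(\<forall>C :: 'u uspace set. subcategory_of_Unif C \<longrightarrow>
            (closed_under_products C \<and> closed_under_closed_subspaces C \<and> varietal (full_subcat C)
             \<longleftrightarrow> trivial_or_indiscrete_or_compact_T2 C))
       \<and> (\<exists>C :: 'u uspace set. subcategory_of_Unif C \<and>
            closed_under_closed_subspaces C \<and> varietal (full_subcat C) \<and>
            \<not> trivial_or_indiscrete_or_compact_T2 C)
       \<and> (\<exists>C :: 'u uspace set. subcategory_of_Unif C \<and>
            closed_under_products C \<and> varietal (full_subcat C) \<and>
            \<not> trivial_or_indiscrete_or_compact_T2 C)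
       \<and> (\<exists>C :: 'u uspace set. subcategory_of_Unif C \<and>
            closed_under_products C \<and> closed_under_closed_subspaces C \<and>
            \<not> trivial_or_indiscrete_or_compact_T2 C)"
proof -
  interpret inaccessible_universe "TYPE('u)" using assms by unfold_locales
  have "trivial_or_indiscrete_or_compact_T2 C"
    if "subcategory_of_Unif C" "closed_under_products C" "closed_under_closed_subspaces C"
      "varietal (full_subcat C)" for C :: "'u uspace set"
  proof -
    interpret varietal_subcategory "TYPE('u)" C using that by unfold_locales
    show ?thesis by (rule classification)
  qed
  then show ?thesis
    using three_classes products_needed closed_subspaces_needed varietal_needed
    by (intro conjI allI impI iffI) blast+
qed

end
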